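(* Let $F:\mathbb{R}\to\mathbb{R}$ be a continuous centered stationary Gaussian process whose spectral measure $\mu$ is a compactly supported probability measure with $\mu_{\mathrm{ac}}\not\equiv 0$. Let $A$ be the smallest positive number such that $\operatorname{supp}(\mu)\subseteq[-A,A]$. Then: (1) There exist $c,d_1,d_2>0$ such that, for every $T\ge e^8$ and every $\varepsilon\in\left[d_1\frac{\log T}{\sqrt T},\,d_2\right]$, $$\mathbb{P}\left(N_F(T)\ge \frac{A}{\pi}T+\varepsilon T\right)\le \exp\left(-c\,(\varepsilon/\log\varepsilon)^4\,T^2\right).$$ (2) For every $\varepsilon>0$ there exists $c>0$ such that, for all $T\ge 1$, $$\mathbb{P}\left(N_F(T)\ge \frac{A}{\pi}T-\varepsilon T\right)\ge \exp(-cT).$$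
   Context: A centered stationary Gaussian process (SGP) $F:\mathbb{R}\to\mathbb{R}$ is a shift-invariant random function whose finite-dimensional marginals are multivariate normal with zero mean. Its covariance kernel is $k(t)=\mathbb{E}[F(0)F(t)]$, and its spectral measure is the finite, non-negative, symmetric Borel measure $\mu$ on $\mathbb{R}$ with $k(t)=\int_{\mathbb{R}}e^{-i\lambda t}\,d\mu(\lambda)$. It is assumed throughout that $k(0)=1$, i.e. $\mu$ is a probability measure. $\mu_{\mathrm{ac}}$ denotes the absolutely continuous component of $\mu$ with respect to Lebesgue measure, and $\operatorname{supp}(\mu)$ its (closed) support. The zero count is $N_F(T)=\#\{t\in[0,T]: F(t)=0\}$. *)

theory Defs
  imports "HOL-Probability.Probability"
begin

(* The disjunct for the point mass covers variance 0: normal_density 0 0 is the zero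
   function because of the convention x / 0 = 0. *)
definition centered_normal :: "real measure \<Rightarrow> bool" where
  "centered_normal N \<longleftrightarrow>
     N = return borel 0 \<or> (\<exists>\<sigma>>0. N = density lborel (\<lambda>x. ennreal (normal_density 0 \<sigma> x)))"

(* Possibly degenerate multivariate normal law on R^I, defined by its linear functionals. *)
definition centered_multivariate_normal :: "'i set \<Rightarrow> ('i \<Rightarrow> real) measure \<Rightarrow> bool" where
  "centered_multivariate_normal I N \<longleftrightarrow>
     sets N = sets (\<Pi>\<^sub>M i\<in>I. (borel :: real measure)) \<and>
     (\<forall>a :: 'i \<Rightarrow> real. centered_normal (distr N borel (\<lambda>x. \<Sum>i\<in>I. a i * x i)))"

definition marginal :: "'a measure \<Rightarrow> ('i \<Rightarrow> 'a \<Rightarrow> real) \<Rightarrow> 'i set \<Rightarrow> ('i \<Rightarrow> real) measure" where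
  "marginal M F I = distr M (\<Pi>\<^sub>M i\<in>I. borel) (\<lambda>\<omega>. \<lambda>i\<in>I. F i \<omega>)"

definition centered_stationary_gaussian_process ::
    "'a measure \<Rightarrow> (real \<Rightarrow> 'a \<Rightarrow> real) \<Rightarrow> bool" where
  "centered_stationary_gaussian_process M F \<longleftrightarrow>
     prob_space M \<and>
     (\<forall>t. F t \<in> borel_measurable M) \<and>
     (\<forall>I. finite I \<longrightarrow> centered_multivariate_normal I (marginal M F I)) \<and>
     (\<forall>s I. finite I \<longrightarrow> marginal M (\<lambda>t. F (t + s)) I = marginal M F I)"

definition covariance_kernel :: "'a measure \<Rightarrow> (real \<Rightarrow> 'a \<Rightarrow> real) \<Rightarrow> real \<Rightarrow> real" where
  "covariance_kernel M F t = (LINT \<omega>|M. F 0 \<omega> * F t \<omega>)"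

(* char \<mu> (- t) is the integral of exp (- i * t * x) against \<mu>. *)
definition is_spectral_measure ::
    "'a measure \<Rightarrow> (real \<Rightarrow> 'a \<Rightarrow> real) \<Rightarrow> real measure \<Rightarrow> bool" where
  "is_spectral_measure M F \<mu> \<longleftrightarrow>
     finite_measure \<mu> \<and> sets \<mu> = sets borel \<and>
     distr \<mu> borel uminus = \<mu> \<and>
     (\<forall>t. complex_of_real (covariance_kernel M F t) = char \<mu> (- t))"

definition lebesgue_decomposition ::
    "real measure \<Rightarrow> real measure \<Rightarrow> real measure \<Rightarrow> bool" where
  "lebesgue_decomposition \<mu> \<mu>ac \<mu>s \<longleftrightarrow>
     sets \<mu>ac = sets borel \<and> sets \<mu>s = sets borel \<and>
     absolutely_continuous lborel \<mu>ac \<and>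
     (\<exists>S\<in>null_sets lborel. emeasure \<mu>s (- S) = 0) \<and>
     (\<forall>B\<in>sets borel. emeasure \<mu> B = emeasure \<mu>ac B + emeasure \<mu>s B)"

definition measure_support :: "'a::topological_space measure \<Rightarrow> 'a set" where
  "measure_support \<mu> = {x. \<forall>U. open U \<longrightarrow> x \<in> U \<longrightarrow> 0 < emeasure \<mu> U}"

(* Extended-real valued, since card sends infinite sets to 0. *)
definition zero_count :: "(real \<Rightarrow> real) \<Rightarrow> real \<Rightarrow> ereal" where
  "zero_count f T =
     (let Z = {t\<in>{0..T}. f t = 0} in if finite Z then ereal (real (card Z)) else \<infinity>)"

end

theory Submission
  imports Defs "HOL-Complex_Analysis.Complex_Analysis" "HOL-Real_Asymp.Real_Asymp"
begin

text \<open>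
  Upper bound. Since the spectrum lies in the interval from -A to A, the paths extend to entire functions
  of exponential type A. If such an entire function is not too large and has
  (A / \<pi> + \<epsilon>) T zeros in [0, T], then Jensen's inequality on discs of radius of order \<epsilon> T, averaged
  over their centers, shows that it is at most exp (- c \<epsilon>^2 T) on a whole interval of length of order
  \<epsilon>^2 T / ln (1 / \<epsilon>). Values of F on a lattice in such an interval form a Gaussian vector of
  dimension m of order \<epsilon>^2 T / ln (1 / \<epsilon>) whose covariance is at least exp (- C m), by a Remez type
  bound for polynomials on the set where the spectral density is bounded below. Hence such smallness
  has probability at most exp (- c \<epsilon>^2 T m).

  Lower bound. Multiplying the spectral measure by a small factor s^2 outside a neighbourhood of the
  points A and -A changes the density of n lattice values by a factor of at most s^(-n). At spacing \<pi> / A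
  the values of the damped process alternate in sign most of the time, since their correlation is
  close to -1.
\<close>


subsection \<open>Jensen's inequality for functions of exponential type\<close>

text \<open>For fixed \<open>\<epsilon>\<close> the first bound is of order exp (- c T^2), so every
  exceptional event has to be that rare. This is why growth of the paths is only demanded up to a
  factor \<open>T\<close>: a Gaussian exceeds \<open>T\<close> standard deviations with probability
  about exp (- T^2 / 4). The factor \<open>T\<close> is harmless against exp (- c \<epsilon>^2 T) as
  soon as \<epsilon>^2 T dominates ln T, which the lower limit for \<open>\<epsilon>\<close>
  ensures. The lattice spacing is fixed, so the covariance of \<open>m\<close> values may degenerate
  like exp (- C m), and \<open>m\<close> must stay below a small multiple of \<epsilon>^2 T. The
  length of the interval costs one more logarithm, so the exponent obtained is \<epsilon>^4 T^2 / ln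
  (1 / \<epsilon>), slightly better than the one stated. For the second bound the laws compared are
  linear images of one standard Gaussian vector, so the density of the lattice vector is never
  written down. The damping argument needs \<open>T\<close> large; bounded \<open>T\<close> is
  settled by forcing alternating signs on a short, fine lattice.\<close>

lemma sum_abs_sin_shift:
  fixes t :: real and m :: nat
  assumes "m > 0"
  shows "(\<Sum>k<m. \<bar>sin (t + pi / m + k * pi / m)\<bar>) = (\<Sum>k<m. \<bar>sin (t + k * pi / m)\<bar>)"
proof -
  let ?g = "\<lambda>k::nat. \<bar>sin (t + k * pi / m)\<bar>"
  have "(\<Sum>k<m. \<bar>sin (t + pi / m + k * pi / m)\<bar>) = (\<Sum>k<m. ?g (Suc k))"
    by (intro sum.cong) (auto simp: field_simps)
  moreover have "(\<Sum>k<m. ?g (Suc k)) + ?g 0 = (\<Sum>k<m. ?g k) + ?g m"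
    using sum.lessThan_Suc_shift[of ?g m] sum.lessThan_Suc[of ?g m] by simp
  moreover have "?g m = ?g 0"
    using assms by (simp add: sin_add)
  ultimately show ?thesis by simp
qed

text \<open>The sum is periodic in \<open>t\<close> with period pi / m, so \<open>t\<close> may be
  moved into [0, pi / m]. There all the sines are nonnegative, and multiplication by 2 sin (pi / (2
  m)) makes the sum telescope to 2 cos (s - p / 2), which is at most 2.\<close>

lemma sum_abs_sin_le:
  fixes t :: real and m :: nat
  assumes "m > 0"
  shows "(\<Sum>k<m. \<bar>sin (t + k * pi / m)\<bar>) \<le> 1 / sin (pi / (2 * m))"
proof -
  define G where "G = (\<lambda>t::real. \<Sum>k<m. \<bar>sin (t + k * pi / m)\<bar>)"
  have per: "G (t + pi / m) = G t" for t
    unfolding G_def using sum_abs_sin_shift[OF assms] .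
  have pern: "G (t + real n * (pi / m)) = G t" for t and n :: nat
  proof (induction n)
    case (Suc n)
    have "t + real (Suc n) * (pi / m) = (t + real n * (pi / m)) + pi / m"
      by (simp add: algebra_simps add_divide_distrib)
    with per[of "t + real n * (pi / m)"] Suc show ?case by metis
  qed simp
  have peri: "G (t + of_int j * (pi / m)) = G t" for t and j :: int
  proof (cases "j \<ge> 0")
    case True
    then show ?thesis using pern[of t "nat j"] by simp
  next
    case False
    then show ?thesis using pern[of "t + of_int j * (pi / m)" "nat (- j)"]
      by (simp add: algebra_simps)
  qed
  define p where "p = pi / m"
  have p: "p > 0" "p * m = pi" using assms by (auto simp: p_def)
  define j where "j = \<lfloor>t / p\<rfloor>"
  define s where "s = t - of_int j * p"
  have s: "0 \<le> s" "s \<le> p"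
  proof -
    have "of_int j \<le> t / p" "t / p < of_int j + 1" unfolding j_def by linarith+
    with p have "of_int j * p \<le> t" "t \<le> (of_int j + 1) * p"
      by (simp_all add: field_simps)
    then show "0 \<le> s" "s \<le> p" by (auto simp: s_def algebra_simps)
  qed
  have "G t = G s" using peri[of s j] by (simp add: s_def p_def)
  also have "G s = (\<Sum>k<m. sin (s + k * p))"
    unfolding G_def
  proof (rule sum.cong)
    fix k assume k: "k \<in> {..<m}"
    have "s + k * p \<le> (k + 1) * p" using s by (simp add: algebra_simps)
    also have "\<dots> \<le> m * p" using k p by (intro mult_right_mono) auto
    also have "\<dots> = pi" using p by (simp add: mult.commute)
    finally have "sin (s + k * p) \<ge> 0"
      using s p by (intro sin_ge_zero) auto
    then show "\<bar>sin (s + k * pi / m)\<bar> = sin (s + k * p)" by (simp add: p_def)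
  qed simp
  also have "\<dots> * (2 * sin (p / 2)) = cos (s - p / 2) - cos (s - p / 2 + m * p)"
  proof -
    have "(\<Sum>k<n. sin (s + k * p)) * (2 * sin (p / 2)) = cos (s - p / 2) - cos (s - p / 2 + n * p)" for n :: nat
    proof (induction n)
      case (Suc n)
      have "sin (s + n * p) * (2 * sin (p / 2)) = cos (s + n * p - p / 2) - cos (s + n * p + p / 2)"
        by (simp add: cos_add cos_diff)
      with Suc show ?case by (simp add: algebra_simps)
    qed simp
    then show ?thesis .
  qed
  also have "\<dots> = 2 * cos (s - p / 2)" using p by (simp add: mult.commute)
  also have "\<dots> \<le> 2" by simp
  finally have "G t * sin (p / 2) \<le> 1" by simp
  moreover have "sin (p / 2) > 0"
    using p assms by (intro sin_gt_zero) (auto simp: p_def field_simps)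
  ultimately show ?thesis
    by (simp add: G_def p_def field_simps)
qed

text \<open>The product of the rotates of f by all 2m-th roots of unity replaces the mean value inequality for the
  subharmonic function ln |f|, so that the maximum modulus principle suffices.\<close>
lemma exponential_type_center_bound:
  fixes f :: "complex \<Rightarrow> complex"
  assumes hol: "f holomorphic_on UNIV" and R: "R > 0" and A: "A \<ge> 0" and L: "L > 0"
    and bd: "\<And>z. norm z = R \<Longrightarrow> norm (f z) \<le> L * exp (A * \<bar>Im z\<bar>)"
  shows "norm (f 0) \<le> L * exp (2 * A * R / pi)"
proof -
  have main: "norm (f 0) \<le> L * exp (A * R / (real m * sin (pi / (2 * m))))" if m: "m > 0" for m :: nat
  proof -
    \<comment> \<open>With their negatives these are all 2m-th roots of unity. Since the growth
      bound is even in Im z, each pair contributes the same exponent twice, and only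
      \<open>m\<close> angles remain.\<close>
    define w where "w = (\<lambda>k::nat. cis (k * pi / m))"
    define P where "P = (\<lambda>z. \<Prod>k<m. f (w k * z) * f (- w k * z))"
    have holP: "P holomorphic_on UNIV"
      unfolding P_def
      by (intro holomorphic_intros holomorphic_on_compose_gen[OF _ hol, unfolded o_def]) auto
    have bdP: "norm (P z) \<le> L ^ (2 * m) * exp (2 * A * R / sin (pi / (2 * m)))" if z: "norm z = R" for z
    proof -
      have fac: "norm (f (w k * z) * f (- w k * z)) \<le> L\<^sup>2 * exp (2 * A * R * \<bar>sin (Arg z + k * pi / m)\<bar>)" for k
      proof -
        have zz: "z = R * cis (Arg z)" using z R Arg_eq[of z] by (auto simp: cis_conv_exp mult.commute)
        have "w k * z = R * cis (Arg z + k * pi / m)"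
          by (subst zz) (simp add: w_def cis_mult[symmetric] add.commute)
        then have im: "\<bar>Im (w k * z)\<bar> = R * \<bar>sin (Arg z + k * pi / m)\<bar>" using R by (simp add: abs_mult)
        have n: "norm (w k * z) = R" "norm (- w k * z) = R" using z by (simp_all add: norm_mult w_def)
        have "norm (f (w k * z) * f (- w k * z)) \<le> (L * exp (A * \<bar>Im (w k * z)\<bar>)) * (L * exp (A * \<bar>Im (- w k * z)\<bar>))"
          unfolding norm_mult using bd[OF n(1)] bd[OF n(2)] L by (intro mult_mono) auto
        also have "\<bar>Im (- w k * z)\<bar> = \<bar>Im (w k * z)\<bar>" by simp
        also have "(L * exp (A * \<bar>Im (w k * z)\<bar>)) * (L * exp (A * \<bar>Im (w k * z)\<bar>)) = L\<^sup>2 * exp (2 * A * R * \<bar>sin (Arg z + k * pi / m)\<bar>)"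
          unfolding im by (simp add: power2_eq_square exp_add[symmetric])
        finally show ?thesis .
      qed
      have "norm (P z) \<le> (\<Prod>k<m. L\<^sup>2 * exp (2 * A * R * \<bar>sin (Arg z + k * pi / m)\<bar>))"
        unfolding P_def prod_norm[symmetric] by (intro prod_mono) (use fac in auto)
      also have "\<dots> = L ^ (2 * m) * exp (2 * A * R * (\<Sum>k<m. \<bar>sin (Arg z + k * pi / m)\<bar>))"
        by (simp add: prod.distrib power_mult exp_sum[symmetric] sum_distrib_left)
      also have "\<dots> \<le> L ^ (2 * m) * exp (2 * A * R * (1 / sin (pi / (2 * m))))"
        using sum_abs_sin_le[OF m, of "Arg z"] A R L
        by (intro mult_left_mono iffD2[OF exp_le_cancel_iff]) auto
      finally show ?thesis by simp
    qed
    have "norm (P 0) \<le> L ^ (2 * m) * exp (2 * A * R / sin (pi / (2 * m)))"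
    proof (rule maximum_modulus_frontier[of P "cball 0 R"])
      show "P holomorphic_on interior (cball 0 R)"
        using holP holomorphic_on_subset by blast
      show "continuous_on (closure (cball 0 R)) P"
        using holP holomorphic_on_imp_continuous_on continuous_on_subset by blast
    qed (use R bdP in \<open>auto simp: sphere_def\<close>)
    also have "norm (P 0) = norm (f 0) ^ (2 * m)"
      by (simp add: P_def norm_mult norm_power prod_norm[symmetric] power_mult power2_eq_square)
    also have "exp (2 * A * R / sin (pi / (2 * m))) = exp (A * R / (real m * sin (pi / (2 * m)))) ^ (2 * m)"
      using m by (simp add: exp_of_nat_mult[symmetric])
    finally have "norm (f 0) ^ (2 * m) \<le> (L * exp (A * R / (real m * sin (pi / (2 * m))))) ^ (2 * m)"
      by (simp add: power_mult_distrib)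
    then show ?thesis
      using L m by (subst (asm) power_mono_iff) auto
  qed
  \<comment> \<open>The limit replaces the discrete average of |sin| by its mean value 2 / pi, the
    source of the constant in 2 A R / pi.\<close>
  have lim: "(\<lambda>m::nat. L * exp (A * R / (real m * sin (pi / (2 * m))))) \<longlonglongrightarrow> L * exp (A * R / (pi / 2))"
  proof -
    have "(\<lambda>m::nat. real m * sin (pi / (2 * m))) \<longlonglongrightarrow> pi / 2" by real_asymp
    then show ?thesis by (intro tendsto_intros) auto
  qed
  have "norm (f 0) \<le> L * exp (A * R / (pi / 2))"
  proof (rule tendsto_lowerbound[OF lim])
    show "\<forall>\<^sub>F m in sequentially. norm (f 0) \<le> L * exp (A * R / (real m * sin (pi / (2 * m))))"
      using eventually_gt_at_top[of "0::nat"] by eventually_elim (rule main)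
  qed auto
  also have "A * R / (pi / 2) = 2 * A * R / pi" by simp
  finally show ?thesis .
qed

lemma entire_factor_zeros:
  fixes f :: "complex \<Rightarrow> complex"
  assumes "finite S" "f holomorphic_on UNIV" "\<And>a. a \<in> S \<Longrightarrow> f a = 0"
  obtains g where "g holomorphic_on UNIV" "\<And>z. f z = g z * (\<Prod>a\<in>S. z - a)"
  using assms
proof (induction S arbitrary: f thesis rule: finite_induct)
  case empty
  show ?case using empty(1)[of f] empty(2) by simp
next
  case (insert a S)
  define g where "g = (\<lambda>z. if z = a then deriv f a else (f z - f a) / (z - a))"
  have g: "g holomorphic_on UNIV"
    unfolding g_def using insert.prems by (intro pole_lemma) auto
  have fg: "f z = g z * (z - a)" for z
    using insert.prems(3)[of a] by (simp add: g_def)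
  have "g b = 0" if "b \<in> S" for b
    using insert.prems(3)[of b] that insert.hyps fg[of b] by auto
  then obtain g' where g': "g' holomorphic_on UNIV" "\<And>z. g z = g' z * (\<Prod>a\<in>S. z - a)"
    using insert.IH[of g] g by blast
  show ?case
    using insert.prems(1)[OF g'(1)] fg g'(2) insert.hyps by (simp add: ac_simps)
qed

text \<open>Each zero is traded for a factor that has the same modulus on the circle but does not
  vanish inside, and the center bound is applied to the result. The circle mean of A |Im z| is 2 A R
  / pi, so this is the most that the zeros can contribute.\<close>

lemma jensen_inequality_exponential_type:
  fixes f :: "complex \<Rightarrow> complex" and S :: "real set"
  assumes hol: "f holomorphic_on UNIV" and R: "R > 0" and A: "A \<ge> 0" and L: "L > 0"
    and bd: "\<And>z. norm (z - of_real y) = R \<Longrightarrow> norm (f z) \<le> L * exp (A * \<bar>Im z\<bar>)"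
    and S: "finite S" "\<And>a. a \<in> S \<Longrightarrow> f (of_real a) = 0" "\<And>a. a \<in> S \<Longrightarrow> \<bar>a - y\<bar> < R"
  shows "norm (f (of_real y)) * (\<Prod>a\<in>S. R / \<bar>a - y\<bar>) \<le> L * exp (2 * A * R / pi)"
proof (cases "f (of_real y) = 0")
  case True
  then show ?thesis using L by simp
next
  case False
  obtain g where g: "g holomorphic_on UNIV"
    and fg: "\<And>z. f z = g z * (\<Prod>a\<in>of_real ` S. z - a)"
    using entire_factor_zeros[of "of_real ` S" f] S hol by blast
  have fg': "f z = g z * (\<Prod>a\<in>S. z - of_real a)" for z
    unfolding fg by (subst prod.reindex) (auto simp: inj_on_def)
  \<comment> \<open>For real b and |z| = R the factor (R^2 - b z) / R has modulus |z - b|, because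
    R^2 = z cnj z. Hence |H z| = |f (y + z)| on the circle, while at 0 each factor is R instead of
    |a - y|.\<close>
  define H where "H = (\<lambda>z::complex. g (of_real y + z) * (\<Prod>a\<in>S. (R\<^sup>2 - of_real (a - y) * z) / R))"
  have holH: "H holomorphic_on UNIV"
    unfolding H_def
    by (intro holomorphic_intros holomorphic_on_compose_gen[OF _ g, unfolded o_def]) (use R in auto)
  have "norm (H z) = norm (f (of_real y + z))" if z: "norm z = R" for z
  proof -
    have "norm ((R\<^sup>2 - of_real b * z) / R) = norm (z - of_real b)" for b :: real
    proof -
      have "complex_of_real (R\<^sup>2) = z * cnj z" using z by (simp add: complex_norm_square[symmetric])
      then have "R\<^sup>2 - of_real b * z = z * (cnj z - of_real b)" by (simp add: algebra_simps)
      moreover have "norm (cnj z - of_real b) = norm (z - of_real b)"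
        by (metis complex_cnj_complex_of_real complex_cnj_diff complex_mod_cnj)
      ultimately show ?thesis using R z by (simp add: norm_mult norm_divide)
    qed
    then have "norm (H z) = norm (g (of_real y + z)) * (\<Prod>a\<in>S. norm (z - of_real (a - y)))"
      unfolding H_def norm_mult prod_norm[symmetric] by (simp del: of_real_diff)
    then show ?thesis
      unfolding fg' norm_mult prod_norm[symmetric] by (simp add: algebra_simps)
  qed
  then have "norm (H z) \<le> L * exp (A * \<bar>Im z\<bar>)" if "norm z = R" for z
    using bd[of "of_real y + z"] that by simp
  then have "norm (H 0) \<le> L * exp (2 * A * R / pi)"
    by (intro exponential_type_center_bound[OF holH R A L]) auto
  also have "norm (H 0) = norm (g (of_real y)) * R ^ card S"
    using R by (simp add: H_def norm_mult norm_power power2_eq_square prod_norm[symmetric] )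
  also have "norm (g (of_real y)) = norm (f (of_real y)) * (\<Prod>a\<in>S. 1 / \<bar>a - y\<bar>)"
  proof -
    have "(\<Prod>a\<in>S. \<bar>a - y\<bar>) \<noteq> 0" using False S by auto
    moreover have "norm (f (of_real y)) = norm (g (of_real y)) * (\<Prod>a\<in>S. \<bar>a - y\<bar>)"
      unfolding fg' norm_mult prod_norm[symmetric] of_real_diff[symmetric] norm_of_real
      by (simp add: abs_minus_commute)
    ultimately show ?thesis by (simp add: prod_dividef)
  qed
  finally show ?thesis
    by (simp add: prod_dividef)
qed

text \<open>The weight ln (R / |a - y|) that Jensen's inequality gives a zero, taken at the worst
  point y within distance \<open>l\<close> of the center and cut off at 0. A lower bound for the sum
  of these weights therefore serves all y in the interval at once.\<close>

definition tent :: "real \<Rightarrow> real \<Rightarrow> real \<Rightarrow> real" where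
  "tent R l s = max 0 (ln (R / (\<bar>s\<bar> + l)))"

text \<open>The untruncated weight ln (R / |s|) has integral 2 R; uniformity over an interval of
  half-length \<open>l\<close> costs 2 l (1 + ln (R / l)). The inclusion says that the support of
  the weight is not cut off, which holds for zeros in [0, T] when the centers range over
  [- R, T + R].\<close>

lemma tent_integral:
  assumes l: "0 < l" and lR: "l \<le> R" and sub: "{a - (R - l)..a + (R - l)} \<subseteq> {u..v}"
  shows "((\<lambda>x. tent R l (x - a)) has_integral 2 * (R - l - l * ln (R / l))) {u..v}"
proof -
  define G where "G = (\<lambda>s. (s + l) * (ln (R / (s + l)) + 1))"
  have ft: "((\<lambda>s. ln (R / (s + l))) has_integral (G (R - l) - G 0)) {0..R - l}"
  proof (rule fundamental_theorem_of_calculus)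
    fix s assume s: "s \<in> {0..R - l}"
    have "((\<lambda>s. (s + l) * (ln R - ln (s + l) + 1)) has_real_derivative ln R - ln (s + l)) (at s within {0..R - l})"
      using s l lR by (auto intro!: derivative_eq_intros)
    then have "(G has_real_derivative ln (R / (s + l))) (at s within {0..R - l})"
      by (rule has_field_derivative_transform_within[of _ _ _ _ 1, THEN back_subst[of "\<lambda>d. (G has_real_derivative d) _"]])
        (use s l lR in \<open>auto simp: G_def ln_div\<close>)
    then show "(G has_vector_derivative ln (R / (s + l))) (at s within {0..R - l})"
      by (simp add: has_real_derivative_iff_has_vector_derivative)
  qed (use lR in auto)
  have val: "G (R - l) - G 0 = R - l - l * ln (R / l)"
    using l lR by (simp add: G_def algebra_simps)
  have pos: "((\<lambda>s. tent R l s) has_integral (R - l - l * ln (R / l))) {0..R - l}"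
  proof (rule has_integral_eq[OF _ ft[unfolded val]])
    fix s assume "s \<in> {0..R - l}"
    then have "R / (\<bar>s\<bar> + l) \<ge> 1" using l by (simp add: field_simps)
    then show "ln (R / (s + l)) = tent R l s"
      using \<open>s \<in> _\<close> by (simp add: tent_def)
  qed
  have sym: "(\<lambda>s. tent R l (- s)) = tent R l" by (auto simp: tent_def)
  have neg: "(tent R l has_integral (R - l - l * ln (R / l))) {- (R - l)..0}"
    using has_integral_reflect_real[where f = "tent R l" and a = 0 and b = "R - l", unfolded sym] pos
    by simp
  have both: "((\<lambda>s. tent R l s) has_integral (2 * (R - l - l * ln (R / l)))) {- (R - l)..R - l}"
    using has_integral_combine[OF _ _ neg pos] lR by (simp add: algebra_simps)
  have "((\<lambda>x. tent R l (x - a)) has_integral (2 * (R - l - l * ln (R / l)))) {a - (R - l)..a + (R - l)}"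
    using has_integral_shift_real_ivl[OF both, where c = "- a"] by (simp add: algebra_simps)
  then show ?thesis
  proof (rule has_integral_on_superset[OF _ _ sub])
    fix x assume "x \<notin> {a - (R - l)..a + (R - l)}"
    then have "\<bar>x - a\<bar> + l > R" by auto
    then have "R / (\<bar>x - a\<bar> + l) \<le> 1" "R / (\<bar>x - a\<bar> + l) > 0"
      using l lR by (auto simp: field_simps)
    then show "tent R l (x - a) = 0" by (simp add: tent_def)
  qed
qed

text \<open>Averaging over all centers x turns the number of zeros into a lower bound for the
  logarithmic potential at one center, uniformly on a neighbourhood of it.\<close>
lemma exists_center_tent_sum:
  assumes l: "0 < l" and lR: "l \<le> R" and S: "finite S" "S \<subseteq> {0..T}" and T: "T > 0"
  obtains x where "x \<in> {- R..T + R}"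
    "(\<Sum>a\<in>S. tent R l (x - a)) \<ge> real (card S) * (2 * (R - l - l * ln (R / l))) / (T + 2 * R)"
proof (rule ccontr)
  note center = that
  let ?V = "real (card S) * (2 * (R - l - l * ln (R / l)))"
  assume "\<not> thesis"
  then have less: "(\<Sum>a\<in>S. tent R l (x - a)) < ?V / (T + 2 * R)" if "x \<in> {- R..T + R}" for x
    using that center[of x] \<open>\<not> thesis\<close> by force
  have hi: "((\<lambda>x. \<Sum>a\<in>S. tent R l (x - a)) has_integral (\<Sum>a\<in>S. 2 * (R - l - l * ln (R / l)))) {- R..T + R}"
    using S l lR by (intro has_integral_sum tent_integral) auto
  have hc: "((\<lambda>x. V / (T + 2 * R)) has_integral V) {- R..T + R}" for V
  proof -
    have "T + R * 2 > 0" using T l lR by linarith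
    then have "measure lborel {- R..T + R} *\<^sub>R (V / (T + 2 * R)) = V"
      using T l lR by (simp add: field_simps)
    then show ?thesis using has_integral_const_real[of "V / (T + 2 * R)" "- R" "T + R"] by simp
  qed
  have cont: "continuous_on {- R..T + R} (\<lambda>x. \<Sum>a\<in>S. tent R l (x - a))"
    unfolding tent_def using l lR
    by (intro continuous_intros) (auto simp: add_nonneg_pos less_imp_neq[symmetric])
  have "integral {- R..T + R} (\<lambda>x. \<Sum>a\<in>S. tent R l (x - a)) < integral {- R..T + R} (\<lambda>x. ?V / (T + 2 * R))"
    using less T l lR cont by (intro integral_less_real) (auto intro!: continuous_intros)
  then show False unfolding integral_unique[OF hi] integral_unique[OF hc] by simp
qed

text \<open>\<open>d\<close> is the surplus of the averaged zero potential over the growth 2 A R /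
  pi allowed by the type; it turns into the smallness exp (- d). Circles of radius \<open>R\<close>
  around points within \<open>l\<close> of a center in [- R, T + R] stay in |Re z| \<le> T + 3 R,
  where growth is assumed.\<close>

lemma excess_zeros_imp_small_on_interval:
  fixes f :: "complex \<Rightarrow> complex" and S :: "real set"
  assumes hol: "f holomorphic_on UNIV" and A: "A > 0" and L: "L > 0"
    and l: "0 < l" and lR: "l \<le> R" and T: "T > 0"
    and growth: "\<And>z. \<bar>Re z\<bar> \<le> T + 3 * R \<Longrightarrow> \<bar>Im z\<bar> \<le> R \<Longrightarrow> norm (f z) \<le> L * exp (A * \<bar>Im z\<bar>)"
    and S: "finite S" "S \<subseteq> {0..T}" "\<And>a. a \<in> S \<Longrightarrow> f (of_real a) = 0"
    and excess: "2 * A * R / pi + d \<le> real (card S) * (2 * (R - l - l * ln (R / l))) / (T + 2 * R)"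
  obtains x where "x \<in> {- R..T + R}" "\<And>y. y \<in> {x - l..x + l} \<Longrightarrow> norm (f (of_real y)) \<le> L * exp (- d)"
proof -
  obtain x where x: "x \<in> {- R..T + R}"
    "(\<Sum>a\<in>S. tent R l (x - a)) \<ge> real (card S) * (2 * (R - l - l * ln (R / l))) / (T + 2 * R)"
    using exists_center_tent_sum[OF l lR S(1,2) T] by blast
  show thesis
  proof (rule that[OF x(1)])
    fix y assume y: "y \<in> {x - l..x + l}"
    show "norm (f (of_real y)) \<le> L * exp (- d)"
    proof (cases "f (of_real y) = 0")
      case True
      then show ?thesis using L by simp
    next
      case False
      \<comment> \<open>Exactly the zeros with positive weight. They lie inside the circle of radius
        \<open>R\<close> around every y of the interval, so Jensen's inequality applies to the same
        zeros for each y.\<close>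
      define S' where "S' = {a\<in>S. \<bar>x - a\<bar> + l < R}"
      have S': "finite S'" "S' \<subseteq> S" using S by (auto simp: S'_def)
      have jen: "norm (f (of_real y)) * (\<Prod>a\<in>S'. R / \<bar>a - y\<bar>) \<le> L * exp (2 * A * R / pi)"
      proof (rule jensen_inequality_exponential_type[OF hol])
        fix z :: complex assume z: "norm (z - of_real y) = R"
        have "\<bar>Re (z - of_real y)\<bar> \<le> R" "\<bar>Im (z - of_real y)\<bar> \<le> R"
          using abs_Re_le_cmod[of "z - of_real y"] abs_Im_le_cmod[of "z - of_real y"] z by auto
        then show "norm (f z) \<le> L * exp (A * \<bar>Im z\<bar>)"
          using x(1) y l lR T by (intro growth) auto
      qed (use S S' l lR A L y in \<open>auto simp: S'_def\<close>)
      have "exp (\<Sum>a\<in>S. tent R l (x - a)) = exp (\<Sum>a\<in>S'. tent R l (x - a))"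
      proof (intro arg_cong[where f = exp] sum.mono_neutral_right S(1) S'(2) ballI)
        fix a assume "a \<in> S - S'"
        then have "R / (\<bar>x - a\<bar> + l) \<le> 1" "R / (\<bar>x - a\<bar> + l) > 0"
          using l lR by (auto simp: S'_def field_simps)
        then show "tent R l (x - a) = 0" by (simp add: tent_def)
      qed
      also have "\<dots> = (\<Prod>a\<in>S'. R / (\<bar>x - a\<bar> + l))"
        unfolding exp_sum[OF S'(1)]
      proof (intro prod.cong refl)
        fix a assume "a \<in> S'"
        then have "R / (\<bar>x - a\<bar> + l) \<ge> 1" using l lR by (simp add: S'_def field_simps)
        then show "exp (tent R l (x - a)) = R / (\<bar>x - a\<bar> + l)" by (simp add: tent_def)
      qed
      also have "\<dots> \<le> (\<Prod>a\<in>S'. R / \<bar>a - y\<bar>)"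
      proof (intro prod_mono conjI)
        fix a assume a: "a \<in> S'"
        have "a \<noteq> y" using False a S' S(3) by auto
        then show "R / (\<bar>x - a\<bar> + l) \<le> R / \<bar>a - y\<bar>"
          using y l lR by (intro divide_left_mono mult_pos_pos) auto
      qed (use l lR in auto)
      finally have "norm (f (of_real y)) * exp (\<Sum>a\<in>S. tent R l (x - a)) \<le> L * exp (2 * A * R / pi)"
        using jen by (meson mult_left_mono norm_ge_zero order.trans)
      then have "norm (f (of_real y)) \<le> L * exp (2 * A * R / pi) * exp (- (\<Sum>a\<in>S. tent R l (x - a)))"
        by (simp add: exp_minus field_simps)
      also have "\<dots> = L * exp (2 * A * R / pi - (\<Sum>a\<in>S. tent R l (x - a)))"
        by (simp add: exp_diff exp_minus divide_inverse mult.assoc)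
      also have "\<dots> \<le> L * exp (- d)" using L x(2) excess by (intro mult_left_mono) auto
      finally show ?thesis .
    qed
  qed
qed

subsection \<open>Gaussian vectors and small balls\<close>

text \<open>The exponential only changes the variance of the density to 1 / (1 + c). Positive
  \<open>c\<close> yields the small ball bound; \<open>c\<close> between - 1 and 0 yields the
  exponential moment behind the tail bound.\<close>

lemma std_normal_exp_square:
  fixes c :: real
  assumes "c > - 1"
  shows "has_bochner_integral std_normal_distribution (\<lambda>x. exp (- c * x\<^sup>2 / 2)) (1 / sqrt (1 + c))"
proof -
  define s where "s = 1 / sqrt (1 + c)"
  have s: "s > 0" "s\<^sup>2 = 1 / (1 + c)" using assms by (auto simp: s_def power_divide)
  have eq: "std_normal_density x * exp (- c * x\<^sup>2 / 2) = s * normal_density 0 s x" for x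
  proof -
    have "sqrt (2 * pi * s\<^sup>2) = sqrt (2 * pi) * s" using s(1) by (simp add: real_sqrt_mult)
    moreover have "- x\<^sup>2 / 2 + - c * x\<^sup>2 / 2 = - x\<^sup>2 / (2 * s\<^sup>2)"
      unfolding s(2) using assms by (simp add: field_simps)
    ultimately show ?thesis using s(1)
      by (simp add: std_normal_density_def normal_density_def exp_add[symmetric])
  qed
  have "has_bochner_integral lborel (\<lambda>x. s * normal_density 0 s x) (s * 1)"
    using s(1) by (intro has_bochner_integral_mult_right)
      (simp add: has_bochner_integral_iff integrable_normal_density)
  then have "has_bochner_integral lborel (\<lambda>x. std_normal_density x *\<^sub>R exp (- c * x\<^sup>2 / 2)) s"
    by (simp only: real_scaleR_def eq mult_1_right)
  then show ?thesis
    unfolding s_def[symmetric] by (intro has_bochner_integral_density) auto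
qed

text \<open>With \<open>s = 0\<close> the point mass is also an image of the standard normal law, so
  variance 0 needs no separate treatment afterwards.\<close>

lemma centered_normal_imp_scaled:
  assumes "centered_normal N"
  obtains s where "s \<ge> 0" "N = distr std_normal_distribution borel (\<lambda>x. s * x)"
  using assms unfolding centered_normal_def
proof (elim disjE exE conjE)
  assume "N = return borel 0"
  moreover have "distr std_normal_distribution borel (\<lambda>x. 0 * x) = return borel (0 :: real)"
    using prob_space.distr_const[OF prob_space_normal_density[of 1 0], of "0 :: real" borel]
    by simp
  ultimately show thesis using that[of 0] by simp
next
  fix s :: real assume s: "s > 0" "N = density lborel (\<lambda>x. ennreal (normal_density 0 s x))"
  interpret prob_space std_normal_distribution by (rule prob_space_normal_density) simp
  have "distributed std_normal_distribution lborel (\<lambda>x. x) (\<lambda>x. ennreal (normal_density 0 1 x))"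
    unfolding distributed_def by (auto simp: distr_id2)
  from normal_density_affine[OF this, of s 0] s(1)
  have "distributed std_normal_distribution lborel (\<lambda>x. s * x) (\<lambda>x. ennreal (normal_density 0 s x))"
    by simp
  then have "distr std_normal_distribution lborel (\<lambda>x. s * x) = N"
    unfolding distributed_def s(2) by simp
  moreover have "distr std_normal_distribution lborel (\<lambda>x. s * x) = distr std_normal_distribution borel (\<lambda>x. s * x)"
    by (intro distr_cong) auto
  ultimately show thesis using that[of s] s(1) by simp
qed

lemma centered_normal_moments:
  assumes X: "X \<in> borel_measurable M" and N: "centered_normal (distr M borel X)"
  shows "integrable M (\<lambda>\<omega>. (X \<omega>)\<^sup>2)"
    and "(CLINT \<omega>|M. iexp (X \<omega>)) = complex_of_real (exp (- (LINT \<omega>|M. (X \<omega>)\<^sup>2) / 2))"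
    and "\<lbrakk>(LINT \<omega>|M. (X \<omega>)\<^sup>2) \<le> s\<^sup>2; s > 0; u \<ge> 0\<rbrakk> \<Longrightarrow>
           measure M {\<omega>\<in>space M. \<bar>X \<omega>\<bar> \<ge> u} \<le> sqrt 2 * exp (- (u\<^sup>2 / (4 * s\<^sup>2)))"
proof -
  let ?S = std_normal_distribution
  obtain r where r: "r \<ge> 0" and d: "distr M borel X = distr ?S borel (\<lambda>x. r * x)"
    using centered_normal_imp_scaled[OF N] by blast
  have i1: "integrable ?S (\<lambda>x. x\<^sup>2)"
    using integrable_std_normal_distribution_moment[of 2] by simp
  have e1: "(LINT x|?S. x\<^sup>2) = 1"
    using std_normal_distribution_even_moments(1)[of 1] by simp
  have "integrable (distr M borel X) (\<lambda>x. x\<^sup>2)"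
    unfolding d using i1 by (subst integrable_distr_eq) (auto simp: power_mult_distrib)
  then show int: "integrable M (\<lambda>\<omega>. (X \<omega>)\<^sup>2)"
    using X by (subst (asm) integrable_distr_eq) auto
  have "(LINT \<omega>|M. (X \<omega>)\<^sup>2) = (LINT x|distr M borel X. x\<^sup>2)"
    using X by (subst integral_distr) auto
  also have "\<dots> = (LINT x|?S. r\<^sup>2 * x\<^sup>2)"
    unfolding d by (subst integral_distr) (auto simp: power_mult_distrib)
  also have "\<dots> = r\<^sup>2" using i1 e1 by simp
  finally have var: "(LINT \<omega>|M. (X \<omega>)\<^sup>2) = r\<^sup>2" .
  have "(CLINT \<omega>|M. iexp (X \<omega>)) = (CLINT x|distr M borel X. iexp x)"
    using X by (subst integral_distr) auto
  also have "\<dots> = char ?S r"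
    unfolding d char_def by (subst integral_distr) auto
  also have "\<dots> = complex_of_real (exp (- (LINT \<omega>|M. (X \<omega>)\<^sup>2) / 2))"
    unfolding char_std_normal_distribution var by simp
  finally show "(CLINT \<omega>|M. iexp (X \<omega>)) = complex_of_real (exp (- (LINT \<omega>|M. (X \<omega>)\<^sup>2) / 2))" .
  assume s: "(LINT \<omega>|M. (X \<omega>)\<^sup>2) \<le> s\<^sup>2" "s > 0" and u: "u \<ge> 0"
  \<comment> \<open>The tail comes from Markov's inequality for exp (x^2 / 4), whose mean is the
    constant sqrt 2 of the bound. Only an upper bound \<open>s\<close> for the standard deviation
    enters, so degenerate laws are included.\<close>
  have hb: "has_bochner_integral ?S (\<lambda>x. exp (x\<^sup>2 / 4)) (sqrt 2)"
    using std_normal_exp_square[of "- 1 / 2"] by (simp add: real_sqrt_divide)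
  have "measure M {\<omega>\<in>space M. \<bar>X \<omega>\<bar> \<ge> u} = measure (distr M borel X) {x. \<bar>x\<bar> \<ge> u}"
    using X by (subst measure_distr) (auto intro!: arg_cong[where f = "measure M"])
  also have "\<dots> = measure ?S {x. \<bar>r * x\<bar> \<ge> u}"
    unfolding d by (subst measure_distr) (auto intro!: arg_cong[where f = "measure ?S"])
  also have "\<dots> \<le> (LINT x|?S. exp (- (u\<^sup>2 / (4 * s\<^sup>2))) * exp (x\<^sup>2 / 4))"
  proof -
    interpret prob_space ?S by (rule prob_space_normal_density) simp
    have "measure ?S {x. \<bar>r * x\<bar> \<ge> u} = (LINT x|?S. indicator {x. \<bar>r * x\<bar> \<ge> u} x)"
      by simp
    also have "\<dots> \<le> (LINT x|?S. exp (- (u\<^sup>2 / (4 * s\<^sup>2))) * exp (x\<^sup>2 / 4))"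
    proof (rule integral_mono)
      show "integrable ?S (\<lambda>x. exp (- (u\<^sup>2 / (4 * s\<^sup>2))) * exp (x\<^sup>2 / 4))"
        using hb by (intro integrable_mult_right) (simp add: has_bochner_integral_iff)
      fix x :: real
      show "indicator {x. \<bar>r * x\<bar> \<ge> u} x \<le> exp (- (u\<^sup>2 / (4 * s\<^sup>2))) * exp (x\<^sup>2 / 4)"
      proof (cases "u \<le> \<bar>r * x\<bar>")
        case True
        then have "u\<^sup>2 \<le> \<bar>r * x\<bar>\<^sup>2" using u by (intro power_mono) auto
        also have "\<dots> \<le> s\<^sup>2 * x\<^sup>2" using s var by (auto simp: power_mult_distrib intro!: mult_right_mono)
        finally have "u\<^sup>2 / (4 * s\<^sup>2) \<le> x\<^sup>2 / 4" using s(2) by (simp add: field_simps)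
        then show ?thesis using True by (simp add: exp_add[symmetric])
      qed auto
    qed (auto intro!: integrable_real_indicator simp: emeasure_eq_measure)
    finally show ?thesis .
  qed
  also have "\<dots> = sqrt 2 * exp (- (u\<^sup>2 / (4 * s\<^sup>2)))"
    using hb by (simp add: has_bochner_integral_iff)
  finally show "measure M {\<omega>\<in>space M. \<bar>X \<omega>\<bar> \<ge> u} \<le> sqrt 2 * exp (- (u\<^sup>2 / (4 * s\<^sup>2)))" .
qed

text \<open>\<open>Q a\<close> stands for the variance of the linear functional with coefficients
  \<open>a\<close>. Gaussian vectors are handled through this form alone, without densities or an
  invertible covariance matrix.\<close>

definition has_gaussian_cf :: "'a measure \<Rightarrow> 'i set \<Rightarrow> ('i \<Rightarrow> 'a \<Rightarrow> real) \<Rightarrow> (('i \<Rightarrow> real) \<Rightarrow> real) \<Rightarrow> bool" where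
  "has_gaussian_cf M I X Q \<longleftrightarrow>
     (\<forall>a. (CLINT \<omega>|M. iexp (\<Sum>i\<in>I. a i * X i \<omega>)) = complex_of_real (exp (- Q a / 2)))"

text \<open>The Gaussian weight exp (- x^2 / (2 e^2)) is an average of characters over a normal law, so Fubini's
  theorem evaluates its expectation from the characteristic function alone.\<close>
lemma gaussian_small_ball:
  fixes X :: "'i \<Rightarrow> 'a \<Rightarrow> real"
  assumes M: "prob_space M" and I: "finite I" and X: "\<And>i. i \<in> I \<Longrightarrow> X i \<in> borel_measurable M"
    and cf: "has_gaussian_cf M I X Q" and l: "l > 0" and Q: "\<And>a. l * (\<Sum>i\<in>I. (a i)\<^sup>2) \<le> Q a"
    and e: "e > 0"
  shows "measure M {\<omega>\<in>space M. \<forall>i\<in>I. \<bar>X i \<omega>\<bar> \<le> e} \<le> (exp (1 / 2) * e / sqrt l) ^ card I"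
proof -
  interpret M: prob_space M by fact
  let ?S = std_normal_distribution
  interpret S: prob_space ?S by (rule prob_space_normal_density) simp
  interpret PS: product_prob_space "\<lambda>_. ?S" I ..
  define P where "P = (\<Pi>\<^sub>M i\<in>I. ?S)"
  interpret P: prob_space P unfolding P_def by (rule PS.prob_space_axioms)
  interpret MP: pair_sigma_finite M P ..
  interpret MPP: pair_prob_space M P ..
  have setsP: "sets P = sets (\<Pi>\<^sub>M i\<in>I. borel)" unfolding P_def by (intro sets_PiM_cong) auto
  have mP: "(\<lambda>u. u i) \<in> borel_measurable P" if "i \<in> I" for i
    using measurable_component_singleton[OF that, of "\<lambda>_. ?S"] by (simp add: P_def)
  define G where "G = (\<lambda>\<omega>. \<Prod>i\<in>I. exp (- (X i \<omega> / e)\<^sup>2 / 2))"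
  have G_eq: "complex_of_real (G \<omega>) = (CLINT u|P. iexp (\<Sum>i\<in>I. (u i / e) * X i \<omega>))" for \<omega>
  proof -
    have "complex_of_real (G \<omega>) = (\<Prod>i\<in>I. char ?S (X i \<omega> / e))"
      unfolding G_def char_std_normal_distribution by simp
    also have "\<dots> = (CLINT u|P. (\<Prod>i\<in>I. iexp (X i \<omega> / e * u i)))"
      unfolding char_def P_def
      by (rule PS.product_integral_prod[symmetric, OF I]) (auto intro!: S.integrable_const_bound[of _ 1] simp flip: of_real_mult of_real_divide)
    also have "\<dots> = (CLINT u|P. iexp (\<Sum>i\<in>I. (u i / e) * X i \<omega>))"
      using I by (simp add: exp_sum[symmetric] sum_distrib_left mult.commute)
    finally show ?thesis .
  qed
  have G_meas: "G \<in> borel_measurable M" unfolding G_def using X by measurable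
  have G01: "0 \<le> G \<omega>" "G \<omega> \<le> 1" for \<omega>
    unfolding G_def by (auto intro!: prod_nonneg prod_le_1)
  have G_int: "integrable M G"
    by (rule M.integrable_const_bound[of _ 1]) (use G_meas G01 in auto)
  have hb: "has_bochner_integral ?S (\<lambda>x. exp (- (l / e\<^sup>2) * x\<^sup>2 / 2)) (1 / sqrt (1 + l / e\<^sup>2))"
    using l e by (intro std_normal_exp_square) (simp add: field_simps add_pos_pos less_trans[of _ 0])
  have "complex_of_real (LINT \<omega>|M. G \<omega>) = (CLINT \<omega>|M. complex_of_real (G \<omega>))"
    by simp
  also have "\<dots> = (CLINT \<omega>|M. CLINT u|P. iexp (\<Sum>i\<in>I. (u i / e) * X i \<omega>))"
    unfolding G_eq ..
  also have "\<dots> = (CLINT u|P. CLINT \<omega>|M. iexp (\<Sum>i\<in>I. (u i / e) * X i \<omega>))"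
  proof (rule MP.Fubini_integral[symmetric])
    have [measurable]: "(\<lambda>x. \<Sum>i\<in>I. (snd x i / e) * X i (fst x)) \<in> borel_measurable (M \<Otimes>\<^sub>M P)"
      using X mP by (intro borel_measurable_sum borel_measurable_times borel_measurable_divide
          measurable_compose[OF measurable_fst] measurable_compose[OF measurable_snd]) auto
    have "(\<lambda>x. iexp (\<Sum>i\<in>I. (snd x i / e) * X i (fst x))) \<in> borel_measurable (M \<Otimes>\<^sub>M P)"
      by measurable
    then show "integrable (M \<Otimes>\<^sub>M P) (\<lambda>(\<omega>, u). iexp (\<Sum>i\<in>I. (u i / e) * X i \<omega>))"
      by (intro MPP.P.integrable_const_bound[of _ 1]) (auto simp: split_beta')
  qed
  also have "\<dots> = (CLINT u|P. complex_of_real (exp (- Q (\<lambda>i. u i / e) / 2)))"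
  proof -
    have "(CLINT \<omega>|M. iexp (\<Sum>i\<in>I. (u i / e) * X i \<omega>)) = complex_of_real (exp (- Q (\<lambda>i. u i / e) / 2))" for u
      by (rule cf[unfolded has_gaussian_cf_def, rule_format])
    then show ?thesis by (simp only:)
  qed
  also have "\<dots> = complex_of_real (LINT u|P. exp (- Q (\<lambda>i. u i / e) / 2))"
    by (rule integral_complex_of_real)
  finally have "(LINT \<omega>|M. G \<omega>) = (LINT u|P. exp (- Q (\<lambda>i. u i / e) / 2))"
    by (simp only: of_real_eq_iff)
  also have "\<dots> \<le> (LINT u|P. (\<Prod>i\<in>I. exp (- (l / e\<^sup>2) * (u i)\<^sup>2 / 2)))"
  proof (rule integral_mono')
    show "integrable P (\<lambda>u. \<Prod>i\<in>I. exp (- (l / e\<^sup>2) * (u i)\<^sup>2 / 2))"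
      using I mP l by (intro P.integrable_const_bound[of _ 1])
        (auto intro!: prod_le_1 borel_measurable_prod simp: abs_prod)
    fix u
    have "(l / e\<^sup>2) * (\<Sum>i\<in>I. (u i)\<^sup>2) \<le> Q (\<lambda>i. u i / e)"
      using Q[of "\<lambda>i. u i / e"] by (simp add: power_divide sum_divide_distrib[symmetric])
    then show "exp (- Q (\<lambda>i. u i / e) / 2) \<le> (\<Prod>i\<in>I. exp (- (l / e\<^sup>2) * (u i)\<^sup>2 / 2))"
      using I by (simp add: exp_sum[symmetric] sum_distrib_left sum_negf sum_divide_distrib[symmetric])
  qed (auto intro!: prod_nonneg)
  also have "\<dots> = (\<Prod>i\<in>I. 1 / sqrt (1 + l / e\<^sup>2))"
    unfolding P_def using hb
    by (subst PS.product_integral_prod[OF I]) (auto simp: has_bochner_integral_iff)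
  also have "\<dots> \<le> (\<Prod>i\<in>I. e / sqrt l)"
  proof (intro prod_mono conjI)
    have "sqrt l / e = sqrt (l / e\<^sup>2)" using e by (simp add: real_sqrt_divide)
    also have "\<dots> \<le> sqrt (1 + l / e\<^sup>2)" by simp
    finally have "sqrt l / e \<le> sqrt (1 + l / e\<^sup>2)" .
    moreover have "sqrt l / e > 0" "1 + l / e\<^sup>2 > 0" using e l by (simp_all add: add_pos_pos)
    ultimately have "1 / sqrt (1 + l / e\<^sup>2) \<le> 1 / (sqrt l / e)"
      by (intro divide_left_mono mult_pos_pos) auto
    then show "1 / sqrt (1 + l / e\<^sup>2) \<le> e / sqrt l" by simp
  qed (use l in auto)
  finally have EG: "(LINT \<omega>|M. G \<omega>) \<le> (e / sqrt l) ^ card I" by simp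
  have "measure M {\<omega>\<in>space M. \<forall>i\<in>I. \<bar>X i \<omega>\<bar> \<le> e} = (LINT \<omega>|M. indicator {\<omega>\<in>space M. \<forall>i\<in>I. \<bar>X i \<omega>\<bar> \<le> e} \<omega>)"
    by (auto simp: Int_def intro!: arg_cong[where f = M.prob])
  also have "\<dots> \<le> (LINT \<omega>|M. exp (1 / 2) ^ card I * G \<omega>)"
  proof (rule integral_mono')
    fix \<omega>
    \<comment> \<open>On the event each Gaussian weight is at least exp (- 1 / 2); this is the
      origin of exp (1 / 2) per coordinate.\<close>
    have "1 \<le> exp (1 / 2) ^ card I * G \<omega>" if *: "\<forall>i\<in>I. \<bar>X i \<omega>\<bar> \<le> e"
    proof -
      have "exp (- 1 / 2) ^ card I = (\<Prod>i\<in>I. exp (- 1 / 2 :: real))" by simp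
      also have "\<dots> \<le> G \<omega>" unfolding G_def
      proof (intro prod_mono conjI)
        fix i assume "i \<in> I"
        then have "\<bar>X i \<omega> / e\<bar> \<le> 1" using * e by simp
        then have "(X i \<omega> / e)\<^sup>2 \<le> 1" by (simp add: abs_square_le_1)
        then show "exp (- 1 / 2) \<le> exp (- (X i \<omega> / e)\<^sup>2 / 2)" by simp
      qed auto
      finally have "exp (1 / 2) ^ card I * exp (- 1 / 2) ^ card I \<le> exp (1 / 2) ^ card I * G \<omega>"
        by (intro mult_left_mono) auto
      then show ?thesis by (simp add: power_mult_distrib[symmetric] exp_add[symmetric])
    qed
    then show "indicator {\<omega>\<in>space M. \<forall>i\<in>I. \<bar>X i \<omega>\<bar> \<le> e} \<omega> \<le> exp (1 / 2) ^ card I * G \<omega>"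
      using G01 by (auto simp: indicator_def)
  qed (use G_int G01 in auto)
  also have "\<dots> = exp (1 / 2) ^ card I * (LINT \<omega>|M. G \<omega>)" using G_int by simp
  also have "\<dots> \<le> exp (1 / 2) ^ card I * (e / sqrt l) ^ card I"
    using EG by (intro mult_left_mono) auto
  finally show ?thesis by (simp add: power_mult_distrib[symmetric])
qed

subsection \<open>A Remez type bound for trigonometric polynomials\<close>

text \<open>Greedy choice from the left: take a point of \<open>E\<close> close to its infimum and
  discard everything up to distance \<open>s\<close> beyond it.\<close>

lemma separated_points:
  fixes E :: "real set" and s :: real
  assumes "E \<in> sets borel" "E \<subseteq> {a..b}" "s > 0" "real m * s < measure lborel E"
  obtains x :: "nat \<Rightarrow> real" where "\<And>i. i < m \<Longrightarrow> x i \<in> E" "\<And>i. Suc i < m \<Longrightarrow> x i + s \<le> x (Suc i)"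
  using assms
proof (induction m arbitrary: E a thesis)
  case 0
  show ?case by (rule 0(1)[of "\<lambda>_. 0"]) auto
next
  case (Suc m)
  note E = Suc.prems(2,3)
  have fin: "emeasure lborel E \<noteq> \<infinity>"
    using emeasure_mono[OF E(2), of lborel] by (auto simp: top_unique emeasure_lborel_Icc_eq split: if_splits)
  \<comment> \<open>The surplus of measure. A first point within \<open>d\<close> of the infimum
    wastes less than \<open>d\<close>, so what remains after removing \<open>s\<close> still has
    measure above m s.\<close>
  define d where "d = measure lborel E - real (Suc m) * s"
  have d: "d > 0" using Suc.prems by (simp add: d_def)
  have ne: "E \<noteq> {}" using Suc.prems(4,5) by (auto simp: mult_less_0_iff)
  have bb: "bdd_below E" using E by (meson bdd_below_Icc bdd_below_mono)
  obtain p where p: "p \<in> E" "p < Inf E + d" using cInf_lessD[OF ne, of "Inf E + d"] d by auto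
  define E' where "E' = E \<inter> {p + s..}"
  have sub: "E \<subseteq> {Inf E..p + s} \<union> E'" using bb by (auto simp: E'_def intro: cInf_lower)
  have "measure lborel E \<le> measure lborel ({Inf E..p + s} \<union> E')"
  proof (intro measure_mono_fmeasurable sub)
    have "E \<in> fmeasurable lborel" using fin E by (simp add: fmeasurable_def less_top)
    then have "E' \<in> fmeasurable lborel" by (rule fmeasurableI2) (use E in \<open>auto simp: E'_def\<close>)
    then show "{Inf E..p + s} \<union> E' \<in> fmeasurable lborel"
      by (intro fmeasurable.Un) (auto simp: fmeasurable_def emeasure_lborel_Icc_eq)
  qed (use E in auto)
  also have "\<dots> \<le> measure lborel {Inf E..p + s} + measure lborel E'"
    using E by (intro measure_Un_le) (auto simp: E'_def)
  also have "measure lborel {Inf E..p + s} = p + s - Inf E"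
    using cInf_lower[OF p(1) bb] \<open>s > 0\<close> by simp
  finally have "real m * s < measure lborel E'" using p by (simp add: d_def algebra_simps)
  then obtain x where x: "\<And>i. i < m \<Longrightarrow> x i \<in> E'" "\<And>i. Suc i < m \<Longrightarrow> x i + s \<le> x (Suc i)"
    using Suc.IH[where E = E' and a = a] E \<open>s > 0\<close> by (auto simp: E'_def)
  show ?case
    by (rule Suc.prems(1)[of "case_nat p x"]) (use x p in \<open>auto simp: E'_def split: nat.splits\<close>)
qed

lemma coeff_prod_unit_roots_le:
  fixes w :: "'i \<Rightarrow> complex"
  assumes "finite S" "\<And>j. j \<in> S \<Longrightarrow> norm (w j) = 1"
  shows "norm (coeff (\<Prod>j\<in>S. [:- w j, 1:]) k) \<le> 2 ^ card S"
  using assms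
proof (induction S arbitrary: k rule: finite_induct)
  case empty
  then show ?case by (simp add: coeff_1)
next
  case (insert j S)
  let ?q = "\<Prod>j\<in>S. [:- w j, 1:]"
  have b: "norm (coeff ?q k) \<le> 2 ^ card S" for k using insert by auto
  have "coeff ([:- w j, 1:] * ?q) k = - w j * coeff ?q k + (if k = 0 then 0 else coeff ?q (k - 1))"
    by (cases k) (simp_all add: coeff_pCons)
  also have "norm \<dots> \<le> norm (- w j * coeff ?q k) + norm (if k = 0 then 0 else coeff ?q (k - 1))"
    by (rule norm_triangle_ineq)
  also have "\<dots> \<le> 2 ^ card S + 2 ^ card S"
    using b[of k] b[of "k - 1"] insert.prems[of j] by (intro add_mono) (auto simp: norm_mult)
  finally show ?case using insert.hyps by simp
qed

text \<open>Lagrange interpolation at the nodes \<open>w i\<close>. Separation in proportion to the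
  index distance bounds the i-th denominator below by t^(m - 1) i! (m - 1 - i)!, and these
  factorials keep the bound exponential in \<open>m\<close> when \<open>t\<close> is of order 1 / m.
  The numerator has coefficients at most 2^(m - 1), since each linear factor with a unit root at
  most doubles them.\<close>

lemma lagrange_coeff_bound:
  fixes p :: "complex poly" and w :: "nat \<Rightarrow> complex"
  assumes deg: "degree p < m" and w: "\<And>i. i < m \<Longrightarrow> norm (w i) = 1"
    and v: "\<And>i. i < m \<Longrightarrow> norm (poly p (w i)) \<le> V" and t: "t > 0"
    and sep: "\<And>i j. i < m \<Longrightarrow> j < m \<Longrightarrow> t * \<bar>real i - real j\<bar> \<le> norm (w i - w j)"
  shows "norm (coeff p k) \<le> V * (\<Sum>i<m. 2 ^ (m - 1) / (t ^ (m - 1) * (fact i * fact (m - 1 - i))))"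
proof -
  define D where "D = (\<lambda>i. \<Prod>j\<in>{..<m} - {i}. w i - w j)"
  define l where "l = (\<lambda>i. smult (poly p (w i) / D i) (\<Prod>j\<in>{..<m} - {i}. [:- w j, 1:]))"
  have wne: "w i \<noteq> w j" if "i < m" "j < m" "i \<noteq> j" for i j
    using sep[of i j] that t by (auto simp: mult_le_0_iff)
  have Dne: "D i \<noteq> 0" if "i < m" for i unfolding D_def using wne that by auto
  have "p = (\<Sum>i<m. l i)"
  proof (rule poly_eqI_degree[where A = "w ` {..<m}"])
    have c: "card (w ` {..<m}) = m"
      by (subst card_image) (auto simp: inj_on_def dest: wne)
    show "degree p < card (w ` {..<m})" using deg c by simp
    have "degree (l i) \<le> m - 1" if "i < m" for i
    proof -
      have "degree (l i) \<le> degree (\<Prod>j\<in>{..<m} - {i}. [:- w j, 1:])"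
        unfolding l_def by (rule degree_smult_le)
      also have "\<dots> \<le> (\<Sum>j\<in>{..<m} - {i}. degree [:- w j, 1:])"
        by (rule order.trans[OF degree_prod_sum_le]) (auto simp: o_def)
      also have "\<dots> = m - 1" using that by simp
      finally show ?thesis .
    qed
    then have "degree (\<Sum>i<m. l i) \<le> m - 1"
      by (intro degree_sum_le) auto
    then show "degree (\<Sum>i<m. l i) < card (w ` {..<m})" using c deg by simp
    fix x assume "x \<in> w ` {..<m}"
    then obtain i where i: "i < m" "x = w i" by auto
    have "poly (l j) (w i) = (if j = i then poly p (w i) else 0)" if "j < m" for j
    proof (cases "j = i")
      case True
      then show ?thesis using Dne[OF i(1)] by (simp add: l_def poly_prod D_def)
    next
      case False
      then have "(\<Prod>j\<in>{..<m} - {j}. poly [:- w j, 1:] (w i)) = 0"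
        using i by (intro prod_zero) auto
      then show ?thesis using False by (simp add: l_def poly_prod)
    qed
    then show "poly p x = poly (\<Sum>i<m. l i) x" using i by (simp add: poly_sum)
  qed
  then have "norm (coeff p k) \<le> (\<Sum>i<m. norm (coeff (l i) k))"
    by (metis coeff_sum sum_norm_le norm_sum)
  also have "\<dots> \<le> (\<Sum>i<m. V * (2 ^ (m - 1) / (t ^ (m - 1) * (fact i * fact (m - 1 - i)))))"
  proof (rule sum_mono)
    fix i assume "i \<in> {..<m}"
    then have i: "i < m" by simp
    have V: "V \<ge> 0" using v[OF i] norm_ge_zero order_trans by blast
    have "t ^ (m - 1) * (fact i * fact (m - 1 - i)) = (\<Prod>j\<in>{..<m} - {i}. t * \<bar>real i - real j\<bar>)"
    proof -
      have split: "{..<m} - {i} = {..<i} \<union> {i<..<m}" using i by auto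
      have 1: "(\<Prod>j<i. \<bar>real i - real j\<bar>) = fact i"
      proof -
        have "(\<Prod>j<i. \<bar>real i - real j\<bar>) = (\<Prod>j<i. real (i - j))" by (intro prod.cong) (auto simp: of_nat_diff)
        also have "\<dots> = (\<Prod>j\<in>{1..i}. real j)"
          by (rule prod.reindex_bij_witness[of _ "\<lambda>j. i - j" "\<lambda>j. i - j"]) auto
        finally show ?thesis by (simp add: fact_prod)
      qed
      have 2: "(\<Prod>j\<in>{i<..<m}. \<bar>real i - real j\<bar>) = fact (m - 1 - i)"
      proof -
        have "(\<Prod>j\<in>{i<..<m}. \<bar>real i - real j\<bar>) = (\<Prod>j\<in>{1..m - 1 - i}. real j)"
          by (rule prod.reindex_bij_witness[of _ "\<lambda>j. i + j" "\<lambda>j. j - i"]) auto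
        then show ?thesis by (simp add: fact_prod)
      qed
      have "(\<Prod>j\<in>{..<m} - {i}. \<bar>real i - real j\<bar>) = fact i * fact (m - 1 - i)"
        unfolding split by (subst prod.union_disjoint) (simp_all only: 1 2, auto)
      then show ?thesis using i by (simp add: prod.distrib)
    qed
    also have "\<dots> \<le> (\<Prod>j\<in>{..<m} - {i}. norm (w i - w j))"
      using sep i t by (intro prod_mono) auto
    also have "\<dots> = norm (D i)" by (simp add: D_def prod_norm)
    finally have Dge: "t ^ (m - 1) * (fact i * fact (m - 1 - i)) \<le> norm (D i)" .
    have "norm (coeff (l i) k) = norm (poly p (w i)) * norm (coeff (\<Prod>j\<in>{..<m} - {i}. [:- w j, 1:]) k) / norm (D i)"
      by (simp add: l_def norm_mult norm_divide)
    also have "\<dots> \<le> V * 2 ^ (m - 1) / norm (D i)"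
      using v[OF i] V coeff_prod_unit_roots_le[of "{..<m} - {i}" w k] w i
      by (intro divide_right_mono mult_mono) auto
    also have "\<dots> \<le> V * 2 ^ (m - 1) / (t ^ (m - 1) * (fact i * fact (m - 1 - i)))"
      using Dge V t Dne[OF i] by (intro divide_left_mono mult_pos_pos mult_nonneg_nonneg) auto
    finally show "norm (coeff (l i) k) \<le> V * (2 ^ (m - 1) / (t ^ (m - 1) * (fact i * fact (m - 1 - i))))"
      by simp
  qed
  finally show ?thesis by (simp add: sum_distrib_left)
qed

lemma sum_inverse_fact_fact: "(\<Sum>i<Suc n. 1 / (fact i * fact (n - i))) = (2 ^ n / fact n :: real)"
proof -
  have "(2 ^ n :: real) = (\<Sum>i\<le>n. of_nat (n choose i))"
    using binomial_ring[of 1 "1 :: real" n] by simp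
  also have "\<dots> = (\<Sum>i\<le>n. fact n / (fact i * fact (n - i)))"
    by (intro sum.cong) (auto simp: binomial_fact)
  finally show ?thesis by (simp add: sum_divide_distrib lessThan_Suc_atMost)
qed

text \<open>The chord is 2 |sin ((a - b) / 2)|, and sin x \<ge> x / 2 on [0, 1] because cos \<ge> 1
  / 2 up to pi / 3. Restricting the angles to [- 1, 1] prevents wrapping around the circle; this is
  why lattice spacings satisfy \<open>h * A \<le> 1\<close>.\<close>

lemma chord_ge:
  fixes a b :: real
  assumes "\<bar>a\<bar> \<le> 1" "\<bar>b\<bar> \<le> 1"
  shows "\<bar>a - b\<bar> / 2 \<le> norm (cis a - cis b)"
proof -
  have pos: "x / 2 \<le> sin x" if x: "0 \<le> x" "x \<le> 1" for x :: real
  proof -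
    have "sin 0 - 0 / 2 \<le> sin x - x / 2"
    proof (rule DERIV_nonneg_imp_nondecreasing[OF x(1)])
      fix u assume u: "0 \<le> u" "u \<le> x"
      have "cos (pi / 3) \<le> cos u"
        using u x pi_gt3 by (intro cos_monotone_0_pi_le) auto
      then show "\<exists>y. ((\<lambda>x. sin x - x / 2) has_real_derivative y) (at u) \<and> 0 \<le> y"
        by (intro exI[of _ "cos u - 1 / 2"]) (auto simp: cos_60 intro!: derivative_eq_intros)
    qed
    then show ?thesis by simp
  qed
  have "\<bar>x\<bar> / 2 \<le> \<bar>sin x\<bar>" if "\<bar>x\<bar> \<le> 1" for x :: real
    using pos[of "\<bar>x\<bar>"] that by (cases "x \<ge> 0") auto
  moreover have "\<bar>(a - b) / 2\<bar> \<le> 1" using assms by auto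
  ultimately have half: "\<bar>(a - b) / 2\<bar> / 2 \<le> \<bar>sin ((a - b) / 2)\<bar>" by blast
  have "(norm (cis a - cis b))\<^sup>2 = (cos a - cos b)\<^sup>2 + (sin a - sin b)\<^sup>2"
    by (simp add: cmod_power2)
  also have "\<dots> = ((sin a)\<^sup>2 + (cos a)\<^sup>2) + ((sin b)\<^sup>2 + (cos b)\<^sup>2) - 2 * cos (a - b)"
    by (simp add: cos_diff power2_eq_square algebra_simps)
  also have "\<dots> = (2 * \<bar>sin ((a - b) / 2)\<bar>)\<^sup>2"
  proof -
    have "2 * ((a - b) / 2) = a - b" by simp
    then have "cos (a - b) = 1 - 2 * (sin ((a - b) / 2))\<^sup>2" using cos_double_sin by metis
    then show ?thesis by (simp add: power_mult_distrib)
  qed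
  finally have "norm (cis a - cis b) = 2 * \<bar>sin ((a - b) / 2)\<bar>"
    by (rule power2_eq_imp_eq) auto
  with half show ?thesis by simp
qed

text \<open>Chebyshev's inequality leaves half of E on which the polynomial is small; interpolation at
  separated points of that half controls all its coefficients.\<close>
lemma trigonometric_lower_bound:
  fixes \<mu> :: "real measure" and h :: real
  assumes mu: "finite_measure \<mu>" "sets \<mu> = sets borel"
    and E: "E \<in> sets borel" "E \<subseteq> {- A..A}" "measure lborel E > 0"
    and k: "\<kappa> > 0" "\<And>B. B \<in> sets borel \<Longrightarrow> \<kappa> * measure lborel (B \<inter> E) \<le> measure \<mu> B"
    and h: "h > 0" "h * A \<le> 1"
  obtains C where "C \<ge> 1"
    "\<And>(m :: nat) (c :: nat \<Rightarrow> real). (\<Sum>k<m. (c k)\<^sup>2) \<le> C ^ m * (LINT x|\<mu>. (norm (\<Sum>k<m. of_real (c k) * cis (x * (k * h))))\<^sup>2)"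
proof -
  interpret mu: finite_measure \<mu> by fact
  define b where "b = measure lborel E"
  \<comment> \<open>\<open>D\<close> bounds 4 / (t m) for the node separation \<open>t\<close>
    below, \<open>K\<close> comes from the Chebyshev level, and exp 3 collects m^m / m! \<le> exp m
    (squared) and the number m \<le> exp m of coefficients.\<close>
  define D where "D = max 1 (32 / (h * b))"
  define K where "K = max 1 (2 / (\<kappa> * b))"
  define C where "C = K * D\<^sup>2 * exp 3"
  have b: "b > 0" using E by (simp add: b_def)
  have D: "D \<ge> 1" "32 / (h * b) \<le> D" by (auto simp: D_def)
  have K: "K \<ge> 1" "2 / (\<kappa> * b) \<le> K" by (auto simp: K_def)
  show thesis
  proof (rule that)
    have "1 * 1\<^sup>2 * 1 \<le> C" unfolding C_def
      using D K by (intro mult_mono power_mono) auto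
    then show "C \<ge> 1" by simp
    then have C0: "C \<ge> 0" by simp
    fix m :: nat and c :: "nat \<Rightarrow> real"
    define g where "g = (\<lambda>x::real. (norm (\<Sum>k<m. of_real (c k) * cis (x * (k * h))))\<^sup>2)"
    define Q where "Q = (LINT x|\<mu>. g x)"
    have g_meas[measurable]: "g \<in> borel_measurable \<mu>"
      unfolding measurable_cong_sets[OF mu(2) refl] g_def
      by (intro borel_measurable_continuous_onI continuous_intros)
    have g_bd: "norm (g x) \<le> (\<Sum>k<m. \<bar>c k\<bar>)\<^sup>2" for x
    proof -
      have "norm (\<Sum>k<m. of_real (c k) * cis (x * (k * h))) \<le> (\<Sum>k<m. \<bar>c k\<bar>)"
        by (rule order.trans[OF norm_sum]) (simp add: norm_mult)
      then show ?thesis by (simp add: g_def power_mono)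
    qed
    have g_int: "integrable \<mu> g"
      by (rule mu.integrable_const_bound[of _ "(\<Sum>k<m. \<bar>c k\<bar>)\<^sup>2"]) (use g_bd g_meas in auto)
    have g0: "g x \<ge> 0" for x by (simp add: g_def)
    have Q0: "Q \<ge> 0" by (simp add: Q_def g0)
    \<comment> \<open>The additional \<open>d\<close> keeps the Chebyshev level positive even if
      \<open>Q\<close> vanishes; it tends to 0 at the end.\<close>
    have "(\<Sum>k<m. (c k)\<^sup>2) \<le> C ^ m * (Q + d)" if d: "d > 0" for d
    proof (cases "m = 0")
      case True
      then show ?thesis using d Q0 by simp
    next
      case False
      \<comment> \<open>The level at which Chebyshev's inequality leaves less than half of the
        measure of \<open>E\<close> to the set where the polynomial is at least
        \<open>V\<close>.\<close>
      define V where "V = sqrt (2 * (Q + d) / (\<kappa> * b))"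
      have V: "V > 0" "V\<^sup>2 = 2 * (Q + d) / (\<kappa> * b)" using Q0 d k b by (auto simp: V_def)
      define B where "B = {x. g x \<ge> V\<^sup>2}"
      have B: "B \<in> sets borel"
        using measurable_sets[OF g_meas, of "{V\<^sup>2..}"] mu(2) sets_eq_imp_space_eq[OF mu(2)]
        by (simp add: B_def vimage_def)
      have "\<kappa> * measure lborel (B \<inter> E) \<le> measure \<mu> B" by (rule k(2)[OF B])
      also have "measure \<mu> B \<le> Q / V\<^sup>2"
        using integral_Markov_inequality_measure[OF g_int, of UNIV "V\<^sup>2"] mu(2) sets_eq_imp_space_eq[OF mu(2)] g0 V(1)
        by (simp add: B_def Q_def)
      also have "\<dots> < \<kappa> * (b / 2)"
        unfolding V(2) using Q0 d k b by (simp add: field_simps)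
      finally have small: "measure lborel (B \<inter> E) < b / 2" using k by simp
      have fin: "emeasure lborel E \<noteq> \<infinity>"
        using emeasure_mono[OF E(2), of lborel] by (auto simp: top_unique emeasure_lborel_Icc_eq split: if_splits)
      have "measure lborel (E - B \<inter> E) = b - measure lborel (B \<inter> E)"
        unfolding b_def using fin E B by (intro measure_Diff) auto
      then have big: "measure lborel (E - B \<inter> E) > b / 2" using small by simp
      \<comment> \<open>\<open>m\<close> gaps of this length use b / 4, less than the measure above
        b / 2 that is available.\<close>
      define s where "s = b / (4 * m)"
      have s: "s > 0" "real m * s = b / 4" using b False by (auto simp: s_def)
      obtain x :: "nat \<Rightarrow> real" where x: "\<And>i. i < m \<Longrightarrow> x i \<in> E - B \<inter> E" "\<And>i. Suc i < m \<Longrightarrow> x i + s \<le> x (Suc i)"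
        using separated_points[of "E - B \<inter> E" "- A" A s m] E B s big b by auto
      have sep1: "s * (real j - real i) \<le> x j - x i" if "i \<le> j" "j < m" for i j
        using that
      proof (induction j rule: dec_induct)
        case (step j)
        then show ?case using x(2)[of j] by (simp add: algebra_simps)
      qed simp
      have sep2: "s * \<bar>real i - real j\<bar> \<le> \<bar>x i - x j\<bar>" if "i < m" "j < m" for i j
        using sep1[of i j] sep1[of j i] that s(1) by (cases "i \<le> j") (auto simp: abs_if mult_less_0_iff)
      define w where "w = (\<lambda>i. cis (x i * h))"
      define p where "p = (\<Sum>k<m. monom (complex_of_real (c k)) k)"
      have pp: "poly p (cis (y * h)) = (\<Sum>k<m. of_real (c k) * cis (y * (k * h)))" for y
      proof -
        have "cis (y * h) ^ k = cis (y * (k * h))" for k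
          using Complex.DeMoivre[of "y * h" k] by (simp add: ac_simps)
        then show ?thesis by (simp add: p_def poly_sum poly_monom)
      qed
      define t where "t = h * s / 2"
      have t: "t > 0" using h s by (simp add: t_def)
      have "\<bar>c k\<bar> \<le> V * (\<Sum>i<m. 2 ^ (m - 1) / (t ^ (m - 1) * (fact i * fact (m - 1 - i))))" if k: "k < m" for k
      proof -
        have "coeff p k = of_real (c k)" using k by (simp add: p_def coeff_sum)
        moreover have "norm (coeff p k) \<le> V * (\<Sum>i<m. 2 ^ (m - 1) / (t ^ (m - 1) * (fact i * fact (m - 1 - i))))"
        proof (rule lagrange_coeff_bound[where w = w])
          have "degree p \<le> m - 1" unfolding p_def
            by (intro degree_sum_le) (auto intro!: order.trans[OF degree_monom_le])
          then show "degree p < m" using False by simp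
          fix i assume i: "i < m"
          show "norm (w i) = 1" by (simp add: w_def)
          have "\<not> g (x i) \<ge> V\<^sup>2" using x(1)[OF i] by (auto simp: B_def)
          then have "(norm (poly p (w i)))\<^sup>2 \<le> V\<^sup>2" by (simp add: w_def pp g_def)
          then show "norm (poly p (w i)) \<le> V" by (rule power2_le_imp_le) (use V in auto)
          fix j assume j: "j < m"
          have bd: "\<bar>x i * h\<bar> \<le> 1" if "i < m" for i
          proof -
            have "\<bar>x i\<bar> \<le> A" using x(1)[OF that] E(2) by (auto simp: abs_le_iff)
            then have "\<bar>x i\<bar> * h \<le> A * h" using h by (intro mult_right_mono) auto
            also have "\<dots> \<le> 1" using h by (simp add: mult.commute)
            finally show ?thesis using h by (simp add: abs_mult)
          qed
          have "t * \<bar>real i - real j\<bar> \<le> h * \<bar>x i - x j\<bar> / 2"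
            using sep2[OF i j] h by (simp add: t_def)
          also have "\<dots> = \<bar>x i * h - x j * h\<bar> / 2"
            using h by (simp add: left_diff_distrib[symmetric] abs_mult)
          also have "\<dots> \<le> norm (w i - w j)"
            unfolding w_def by (intro chord_ge bd i j)
          finally show "t * \<bar>real i - real j\<bar> \<le> norm (w i - w j)" .
        qed (use t in auto)
        ultimately show ?thesis by simp
      qed
      moreover have "(\<Sum>i<m. 2 ^ (m - 1) / (t ^ (m - 1) * (fact i * fact (m - 1 - i)))) \<le> (D * exp 1) ^ m"
      proof -
        obtain n where n: "m = Suc n" using False by (cases m) auto
        have "(\<Sum>i<m. 2 ^ (m - 1) / (t ^ (m - 1) * (fact i * fact (m - 1 - i)))) = 2 ^ n / t ^ n * (\<Sum>i<Suc n. 1 / (fact i * fact (n - i)))"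
          unfolding n by (simp add: sum_distrib_left del: sum.lessThan_Suc)
        also have "\<dots> = (4 / t) ^ n / fact n"
          unfolding sum_inverse_fact_fact by (simp add: power_divide power_mult_distrib[symmetric])
        also have "4 / t = (32 / (h * b)) * m" using b h False by (simp add: t_def s_def field_simps)
        also have "\<dots> ^ n / fact n \<le> (D * m) ^ n / fact n"
          using D h b by (intro divide_right_mono power_mono mult_right_mono) auto
        also have "\<dots> = D ^ n * (real m ^ m / fact m)"
          unfolding n by (simp add: power_mult_distrib field_simps del: of_nat_Suc)
        also have "\<dots> \<le> D ^ m * exp m"
        proof (intro mult_mono)
          show "D ^ n \<le> D ^ m" using D n by (intro power_increasing) auto
          have sm: "(\<lambda>n. real m ^ n / fact n) sums exp (real m)"
            using exp_converges[of "real m"] by (simp add: divide_inverse mult.commute)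
          show "real m ^ m / fact m \<le> exp m"
            using sum_le_suminf[OF sums_summable[OF sm], of "{m}"] sums_unique[OF sm] by simp
        qed (use D in auto)
        also have "\<dots> = (D * exp 1) ^ m" by (simp add: power_mult_distrib exp_of_nat_mult[symmetric])
        finally show ?thesis .
      qed
      ultimately have ck: "\<bar>c k\<bar> \<le> V * (D * exp 1) ^ m" if "k < m" for k
        using that V by (meson mult_left_mono order.trans less_imp_le)
      have "(\<Sum>k<m. (c k)\<^sup>2) \<le> (\<Sum>k<m. (V * (D * exp 1) ^ m)\<^sup>2)"
        using ck by (intro sum_mono) (auto simp: abs_le_square_iff[symmetric] intro: order.trans[OF _ abs_ge_self])
      also have "\<dots> = real m * (V\<^sup>2 * ((D * exp 1)\<^sup>2) ^ m)"
        by (simp add: power_mult_distrib power_mult[symmetric] mult.commute)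
      also have "\<dots> \<le> exp 1 ^ m * ((K ^ m * (Q + d)) * ((D * exp 1)\<^sup>2) ^ m)"
      proof (intro mult_mono)
        have "real m \<le> exp (real m)" using exp_ge_add_one_self[of "real m"] by linarith
        then show "real m \<le> exp 1 ^ m" by (simp add: exp_of_nat_mult[symmetric])
        have "V\<^sup>2 = 2 / (\<kappa> * b) * (Q + d)" by (simp add: V)
        also have "\<dots> \<le> K * (Q + d)" using K Q0 d by (intro mult_right_mono) auto
        also have "K \<le> K ^ m" using K False by (intro self_le_power) auto
        finally show "V\<^sup>2 \<le> K ^ m * (Q + d)" using Q0 d by (simp add: mult_right_mono)
      qed (use Q0 d K in auto)
      also have "\<dots> = C ^ m * (Q + d)"
      proof -
        have "C = exp 1 * K * (D * exp 1)\<^sup>2"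
          by (simp add: C_def power_mult_distrib exp_double[symmetric] exp_add[symmetric] mult_ac)
        then show ?thesis by (simp add: power_mult_distrib)
      qed
      finally show ?thesis .
    qed
    then have ev: "\<forall>\<^sub>F d in at_right 0. (\<Sum>k<m. (c k)\<^sup>2) \<le> C ^ m * (Q + d)"
      by (intro eventually_mono[OF eventually_at_right_less])
    have "((\<lambda>d. C ^ m * (Q + d)) \<longlongrightarrow> C ^ m * (Q + 0)) (at_right 0)"
      by (intro tendsto_intros)
    from tendsto_lowerbound[OF this ev] have "(\<Sum>k<m. (c k)\<^sup>2) \<le> C ^ m * Q" by simp
    then show "(\<Sum>k<m. (c k)\<^sup>2) \<le> C ^ m * (LINT x|\<mu>. (norm (\<Sum>k<m. of_real (c k) * cis (x * (k * h))))\<^sup>2)"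
      by (simp add: Q_def g_def)
  qed
qed

subsection \<open>Stationary Gaussian processes\<close>

locale stationary_gaussian =
  fixes M :: "'a measure" and F :: "real \<Rightarrow> 'a \<Rightarrow> real" and \<mu> :: "real measure"
  assumes gp: "centered_stationary_gaussian_process M F" and spec: "is_spectral_measure M F \<mu>"
begin

sublocale prob_space M
  using gp by (simp add: centered_stationary_gaussian_process_def)

sublocale mu: finite_measure \<mu>
  using spec by (simp add: is_spectral_measure_def)

lemma sets_mu[measurable_cong]: "sets \<mu> = sets borel"
  using spec by (simp add: is_spectral_measure_def)

lemma space_mu: "space \<mu> = UNIV"
  using sets_eq_imp_space_eq[OF sets_mu] by simp

lemma F_measurable[measurable]: "F t \<in> borel_measurable M"
  using gp by (simp add: centered_stationary_gaussian_process_def)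

lemma continuous_imp_integrable_mu:
  fixes g :: "real \<Rightarrow> real"
  assumes "continuous_on UNIV g" "\<And>x. \<bar>g x\<bar> \<le> B"
  shows "integrable \<mu> g"
  using assms borel_measurable_continuous_onI[OF assms(1)]
  by (intro mu.integrable_const_bound[of _ B]) (auto simp: measurable_cong_sets[OF sets_mu refl])

lemma linear_combination_normal:
  fixes \<tau> :: "'i \<Rightarrow> real"
  assumes K: "finite K"
  shows "centered_normal (distr M borel (\<lambda>\<omega>. \<Sum>k\<in>K. c k * F (\<tau> k) \<omega>))"
proof -
  define I where "I = \<tau> ` K"
  \<comment> \<open>\<open>\<tau>\<close> need not be injective, whereas the definition of the
    process speaks of sets of times; coefficients at equal times are therefore added up.\<close>
  define a where "a = (\<lambda>t. \<Sum>k | k \<in> K \<and> \<tau> k = t. c k)"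
  have I: "finite I" using K by (simp add: I_def)
  have "centered_normal (distr (marginal M F I) borel (\<lambda>x. \<Sum>i\<in>I. a i * x i))"
    using gp I by (simp add: centered_stationary_gaussian_process_def centered_multivariate_normal_def)
  also have "distr (marginal M F I) borel (\<lambda>x. \<Sum>i\<in>I. a i * x i) = distr M borel (\<lambda>\<omega>. \<Sum>i\<in>I. a i * F i \<omega>)"
    unfolding marginal_def by (subst distr_distr) (auto simp: o_def intro!: distr_cong)
  also have "(\<lambda>\<omega>. \<Sum>i\<in>I. a i * F i \<omega>) = (\<lambda>\<omega>. \<Sum>k\<in>K. c k * F (\<tau> k) \<omega>)"
  proof
    fix \<omega>
    have "(\<Sum>k\<in>K. c k * F (\<tau> k) \<omega>) = (\<Sum>t\<in>I. \<Sum>k | k \<in> K \<and> \<tau> k = t. c k * F (\<tau> k) \<omega>)"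
      unfolding I_def by (rule sum.image_gen[OF K])
    also have "\<dots> = (\<Sum>i\<in>I. a i * F i \<omega>)"
      unfolding a_def sum_distrib_right by (intro sum.cong) auto
    finally show "(\<Sum>i\<in>I. a i * F i \<omega>) = (\<Sum>k\<in>K. c k * F (\<tau> k) \<omega>)" by simp
  qed
  finally show ?thesis .
qed

lemma F_square_integrable: "integrable M (\<lambda>\<omega>. (F t \<omega>)\<^sup>2)"
  using linear_combination_normal[of "{()}" "\<lambda>_. 1" "\<lambda>_. t"]
  by (intro centered_normal_moments) auto

lemma F_prod_integrable: "integrable M (\<lambda>\<omega>. F s \<omega> * F t \<omega>)"
proof (rule Bochner_Integration.integrable_bound)
  show "integrable M (\<lambda>\<omega>. (F s \<omega>)\<^sup>2 + (F t \<omega>)\<^sup>2)"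
    by (intro Bochner_Integration.integrable_add F_square_integrable)
  have "\<bar>a * b\<bar> \<le> a\<^sup>2 + b\<^sup>2" for a b :: real
    using sum_squares_bound[of "\<bar>a\<bar>" "\<bar>b\<bar>"] abs_ge_zero[of "a * b"] unfolding abs_mult power2_abs
    by linarith
  then show "AE \<omega> in M. norm (F s \<omega> * F t \<omega>) \<le> norm ((F s \<omega>)\<^sup>2 + (F t \<omega>)\<^sup>2)"
    by (intro AE_I2) (metis abs_ge_self order.trans real_norm_def)
qed auto

lemma covariance: "(LINT \<omega>|M. F s \<omega> * F t \<omega>) = (LINT x|\<mu>. cos ((t - s) * x))"
proof -
  define I where "I = {0, t - s}"
  have I: "finite I" "0 \<in> I" "t - s \<in> I" by (auto simp: I_def)
  have st: "marginal M (\<lambda>u. F (u + s)) I = marginal M F I"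
    using gp I(1) by (simp add: centered_stationary_gaussian_process_def)
  have m: "(\<lambda>x. x 0 * x (t - s)) \<in> borel_measurable (\<Pi>\<^sub>M i\<in>I. borel :: real measure)"
    using I by (intro borel_measurable_times measurable_component_singleton)
  have "(LINT \<omega>|M. F s \<omega> * F t \<omega>) = (LINT x|marginal M (\<lambda>u. F (u + s)) I. x 0 * x (t - s))"
    unfolding marginal_def using m I by (subst integral_distr) auto
  also have "\<dots> = covariance_kernel M F (t - s)"
    unfolding st unfolding marginal_def covariance_kernel_def using m I by (subst integral_distr) auto
  also have "\<dots> = Re (char \<mu> (- (t - s)))"
    using spec by (metis Re_complex_of_real is_spectral_measure_def)
  also have "\<dots> = (LINT x|\<mu>. Re (iexp (- (t - s) * x)))"
    unfolding char_def by (intro integral_Re[symmetric] mu.integrable_const_bound[of _ 1]) auto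
  also have "\<dots> = (LINT x|\<mu>. cos ((t - s) * x))"
  proof (intro Bochner_Integration.integral_cong refl)
    fix x
    have "- (t - s) * x = - ((t - s) * x)" by (rule mult_minus_left)
    then show "Re (iexp (- (t - s) * x)) = cos ((t - s) * x)"
      by (metis Re_exp cis.sel(1) cis_conv_exp cos_minus)
  qed
  finally show ?thesis .
qed

lemma norm_trig_sum:
  "(norm (\<Sum>k\<in>K. of_real (c k) * cis (x * \<tau> k)))\<^sup>2 = (\<Sum>j\<in>K. \<Sum>k\<in>K. c j * c k * cos ((\<tau> k - \<tau> j) * x))"
proof -
  have "(norm (\<Sum>k\<in>K. of_real (c k) * cis (x * \<tau> k)))\<^sup>2 = (\<Sum>k\<in>K. c k * cos (x * \<tau> k))\<^sup>2 + (\<Sum>k\<in>K. c k * sin (x * \<tau> k))\<^sup>2"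
    by (simp add: cmod_power2)
  also have "\<dots> = (\<Sum>j\<in>K. \<Sum>k\<in>K. c j * c k * cos ((\<tau> k - \<tau> j) * x))"
    unfolding power2_eq_square sum_product sum.distrib[symmetric]
    by (intro sum.cong refl) (simp add: left_diff_distrib cos_diff algebra_simps)
  finally show ?thesis .
qed

text \<open>The squared norm in L^2(\<open>\<mu>\<close>) of a trigonometric polynomial. By the
  spectral isometry, proved next, it is the variance of the same combination of values of
  \<open>F\<close>, so that variances can be estimated pointwise in the frequency.\<close>

definition spectral_form :: "'i set \<Rightarrow> ('i \<Rightarrow> real) \<Rightarrow> ('i \<Rightarrow> real) \<Rightarrow> real" where
  "spectral_form K \<tau> c = (LINT x|\<mu>. (norm (\<Sum>k\<in>K. of_real (c k) * cis (x * \<tau> k)))\<^sup>2)"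

lemma variance_linear_combination:
  assumes K: "finite K"
  shows "(LINT \<omega>|M. (\<Sum>k\<in>K. c k * F (\<tau> k) \<omega>)\<^sup>2) = spectral_form K \<tau> c"
proof -
  have "(LINT \<omega>|M. (\<Sum>k\<in>K. c k * F (\<tau> k) \<omega>)\<^sup>2)
      = (LINT \<omega>|M. (\<Sum>j\<in>K. \<Sum>k\<in>K. c j * c k * (F (\<tau> j) \<omega> * F (\<tau> k) \<omega>)))"
    unfolding power2_eq_square sum_product by (simp add: ac_simps)
  also have "\<dots> = (\<Sum>j\<in>K. \<Sum>k\<in>K. c j * c k * (LINT x|\<mu>. cos ((\<tau> k - \<tau> j) * x)))"
    using F_prod_integrable by (simp add: covariance)
  also have "\<dots> = (LINT x|\<mu>. (\<Sum>j\<in>K. \<Sum>k\<in>K. c j * c k * cos ((\<tau> k - \<tau> j) * x)))"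
    using continuous_imp_integrable_mu[of "\<lambda>x. cos ((\<tau> k - \<tau> j) * x)" 1 for k j]
    by (simp add: continuous_intros)
  finally show ?thesis by (simp add: spectral_form_def norm_trig_sum)
qed

lemma gaussian_cf:
  assumes K: "finite K"
  shows "has_gaussian_cf M K (\<lambda>k. F (\<tau> k)) (spectral_form K \<tau>)"
  unfolding has_gaussian_cf_def variance_linear_combination[OF K, symmetric]
  using K by (intro allI centered_normal_moments(2) linear_combination_normal) auto

lemma tail_bound:
  assumes "finite K" "spectral_form K \<tau> c \<le> s\<^sup>2" "s > 0" "u \<ge> 0"
  shows "prob {\<omega>\<in>space M. \<bar>\<Sum>k\<in>K. c k * F (\<tau> k) \<omega>\<bar> \<ge> u} \<le> sqrt 2 * exp (- (u\<^sup>2 / (4 * s\<^sup>2)))"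
  using assms
  by (intro centered_normal_moments(3) linear_combination_normal) (auto simp: variance_linear_combination)

end

text \<open>The complement of the support is a union of open null sets, and by Lindelof's theorem
  countably many of them suffice.\<close>

lemma AE_measure_support:
  fixes \<mu> :: "real measure"
  assumes "sets \<mu> = sets borel"
  shows "AE x in \<mu>. x \<in> measure_support \<mu>"
proof -
  define U where "U = {V. open V \<and> emeasure \<mu> V = 0}"
  obtain U' where U': "U' \<subseteq> U" "countable U'" "\<Union>U' = \<Union>U"
    using Lindelof[of U] by (auto simp: U_def)
  have "\<Union>U' \<in> null_sets \<mu>"
    using U' null_sets_UN'[of U' "\<lambda>x. x" \<mu>]
    by (force simp: U_def null_sets_def assms)
  moreover have "- measure_support \<mu> \<subseteq> \<Union>U"
    by (auto simp: measure_support_def U_def zero_less_iff_neq_zero)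
  ultimately show ?thesis
    using U'(3) by (intro AE_I'[of "\<Union>U'"]) auto
qed

subsection \<open>Newton series and entire extension of the paths\<close>

text \<open>All factors are replaced by positive majorants. The bound is a coefficient of the
  binomial series for (1 - x)^(- r), so Newton series can be summed in closed form.\<close>

lemma norm_gbinomial_le:
  fixes w :: complex
  assumes "norm w \<le> r"
  shows "norm (w gchoose n) \<le> pochhammer r n / fact n"
proof -
  have "norm (pochhammer (- w) n) = (\<Prod>i<n. norm (- w + of_nat i))"
    by (simp add: pochhammer_prod prod_norm atLeast0LessThan)
  also have "\<dots> \<le> (\<Prod>i<n. r + of_nat i)"
    using assms by (intro prod_mono) (auto intro!: order.trans[OF norm_triangle_ineq4])
  also have "\<dots> = pochhammer r n" by (simp add: pochhammer_prod atLeast0LessThan)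
  finally show ?thesis
    by (simp add: gbinomial_pochhammer norm_mult norm_divide norm_power divide_right_mono)
qed

lemma pochhammer_series:
  fixes x r :: real
  assumes "0 \<le> x" "x < 1"
  shows "(\<lambda>n. pochhammer r n / fact n * x ^ n) sums (1 - x) powr (- r)"
proof -
  have "(\<lambda>n. (- r gchoose n) * (- x) ^ n) sums (1 + (- x)) powr (- r)"
    using assms by (intro gen_binomial_real) auto
  moreover have "(- r gchoose n) * (- x) ^ n = pochhammer r n / fact n * x ^ n" for n
  proof -
    have "(- 1) ^ n * (- x) ^ n = x ^ n" using power_mult_distrib[of "- 1" "- x" n] by simp
    then have "(- 1) ^ n * c * (- x) ^ n = c * x ^ n" for c by (metis mult.assoc mult.left_commute)
    from this[of "pochhammer r n / fact n"] show ?thesis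
      by (simp add: gbinomial_pochhammer)
  qed
  ultimately show ?thesis by simp
qed

text \<open>Newton's interpolation series with step \<open>h\<close>: if \<open>d n\<close> is the
  n-th forward difference of a function at base point 0, the series takes the values of that
  function at the nonnegative multiples of \<open>h\<close>.\<close>

definition newton_series :: "(nat \<Rightarrow> real) \<Rightarrow> real \<Rightarrow> complex \<Rightarrow> complex" where
  "newton_series d h z = (\<Sum>n. (z / of_real h gchoose n) * of_real (d n))"

lemma newton_term_bound:
  fixes z :: complex
  assumes d: "\<bar>d n\<bar> \<le> L * x ^ n" and z: "norm z \<le> r" and h: "h > 0"
  shows "norm ((z / of_real h gchoose n) * of_real (d n)) \<le> L * (pochhammer (r / h) n / fact n * x ^ n)"
proof -
  have "norm (z / of_real h) \<le> r / h" using z h by (simp add: norm_divide divide_right_mono)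
  then have "norm (z / of_real h gchoose n) \<le> pochhammer (r / h) n / fact n" by (rule norm_gbinomial_le)
  then have "norm ((z / of_real h gchoose n) * of_real (d n)) \<le> (pochhammer (r / h) n / fact n) * (L * x ^ n)"
    unfolding norm_mult using d by (intro mult_mono) (auto intro: order.trans[OF norm_ge_zero])
  then show ?thesis by (simp add: ac_simps)
qed

lemma newton_series_sums:
  fixes z :: complex
  assumes d: "\<And>n. \<bar>d n\<bar> \<le> L * x ^ n" and x: "0 \<le> x" "x < 1" and h: "h > 0"
  shows "(\<lambda>n. (z / of_real h gchoose n) * of_real (d n)) sums newton_series d h z"
  unfolding newton_series_def
proof (rule summable_sums, rule summable_comparison_test')
  show "summable (\<lambda>n. L * (pochhammer (norm z / h) n / fact n * x ^ n))"
    using pochhammer_series[OF x] by (intro summable_mult) (auto simp: sums_iff)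
  fix n :: nat
  show "norm ((z / of_real h gchoose n) * of_real (d n)) \<le> L * (pochhammer (norm z / h) n / fact n * x ^ n)"
    by (rule newton_term_bound[OF d order.refl h])
qed

text \<open>Exponential growth of rate - ln (1 - x) / h. Differences that decay like (A h)^n thus
  give a rate close to \<open>A\<close> for small \<open>h\<close>.\<close>

lemma newton_series_bound:
  fixes z :: complex
  assumes d: "\<And>n. \<bar>d n\<bar> \<le> L * x ^ n" and x: "0 \<le> x" "x < 1" and h: "h > 0"
  shows "norm (newton_series d h z) \<le> L * (1 - x) powr (- (norm z / h))"
proof -
  have s: "(\<lambda>n. L * (pochhammer (norm z / h) n / fact n * x ^ n)) sums (L * (1 - x) powr (- (norm z / h)))"
    by (intro sums_mult pochhammer_series x)
  have "norm (newton_series d h z) \<le> (\<Sum>n. L * (pochhammer (norm z / h) n / fact n * x ^ n))"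
    unfolding newton_series_def
    using s by (intro norm_suminf_le newton_term_bound[OF d order.refl h]) (auto simp: sums_iff)
  also have "\<dots> = L * (1 - x) powr (- (norm z / h))" using s by (simp add: sums_iff)
  finally show ?thesis .
qed

lemma newton_series_holomorphic:
  assumes d: "\<And>n. \<bar>d n\<bar> \<le> L * x ^ n" and x: "0 \<le> x" "x < 1" and h: "h > 0"
  shows "newton_series d h holomorphic_on UNIV"
proof (rule holomorphic_uniform_sequence[OF open_UNIV])
  fix n
  show "(\<lambda>z. \<Sum>i<n. (z / of_real h gchoose i) * of_real (d i)) holomorphic_on UNIV"
    unfolding gbinomial_prod_rev by (intro holomorphic_intros) (use h in auto)
next
  fix z :: complex
  have "uniform_limit (cball z 1) (\<lambda>n z. \<Sum>i<n. (z / of_real h gchoose i) * of_real (d i)) (newton_series d h) sequentially"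
    unfolding newton_series_def[abs_def]
  proof (rule Weierstrass_m_test)
    fix n w assume "w \<in> cball z 1"
    then have "norm w \<le> norm z + 1" 
      using norm_triangle_ineq2[of w z] by (simp add: dist_norm norm_minus_commute)
    then show "norm ((w / of_real h gchoose n) * of_real (d n)) \<le> L * (pochhammer ((norm z + 1) / h) n / fact n * x ^ n)"
      by (intro newton_term_bound d h)
  next
    show "summable (\<lambda>n. L * (pochhammer ((norm z + 1) / h) n / fact n * x ^ n))"
      using pochhammer_series[OF x] by (intro summable_mult) (auto simp: sums_iff)
  qed
  then show "\<exists>e>0. cball z e \<subseteq> UNIV \<and>
      uniform_limit (cball z e) (\<lambda>n z. \<Sum>i<n. (z / of_real h gchoose i) * of_real (d i)) (newton_series d h) sequentially"
    by (intro exI[of _ 1]) auto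
qed

context stationary_gaussian
begin

definition fdiff :: "real \<Rightarrow> real \<Rightarrow> nat \<Rightarrow> 'a \<Rightarrow> real" where
  "fdiff h j n \<omega> = (\<Sum>k\<le>n. (- 1) ^ (n - k) * real (n choose k) * F (j + k * h) \<omega>)"

lemma fdiff_measurable[measurable]: "fdiff h j n \<in> borel_measurable M"
  unfolding fdiff_def[abs_def] by measurable

lemma fdiff_symbol:
  fixes x j h :: real
  shows
  "(\<Sum>k\<le>n. of_real ((- 1) ^ (n - k) * real (n choose k)) * cis (x * (j + k * h))) = cis (x * j) * (cis (x * h) - 1) ^ n"
proof -
  have "(cis (x * h) - 1) ^ n = (\<Sum>k\<le>n. of_nat (n choose k) * cis (x * h) ^ k * (- 1) ^ (n - k))"
    using binomial_ring[of "cis (x * h)" "- 1" n] by simp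
  also have "cis (x * j) * \<dots> = (\<Sum>k\<le>n. of_real ((- 1) ^ (n - k) * real (n choose k)) * cis (x * (j + k * h)))"
    unfolding sum_distrib_left
    by (intro sum.cong refl) (simp add: Complex.DeMoivre cis_mult[symmetric] distrib_left ac_simps)
  finally show ?thesis by simp
qed

text \<open>Under the spectral isometry the n-th difference becomes cis (x j) (cis (x h) - 1)^n. On
  the spectrum its modulus is at most (A h)^n, which therefore bounds the standard
  deviation.\<close>

lemma fdiff_tail:
  assumes A: "AE x in \<mu>. \<bar>x\<bar> \<le> A" and mu1: "measure \<mu> UNIV = 1" and h: "h > 0" and A0: "A > 0" and u: "u \<ge> 0"
  shows "prob {\<omega>\<in>space M. \<bar>fdiff h j n \<omega>\<bar> \<ge> u * (A * h) ^ n} \<le> sqrt 2 * exp (- (u\<^sup>2 / 4))"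
proof -
  let ?s = "(A * h) ^ n"
  have s: "?s > 0" using h A0 by simp
  have var: "spectral_form {..n} (\<lambda>k. j + k * h) (\<lambda>k. (- 1) ^ (n - k) * real (n choose k)) \<le> ?s\<^sup>2"
  proof -
    have "spectral_form {..n} (\<lambda>k. j + k * h) (\<lambda>k. (- 1) ^ (n - k) * real (n choose k)) = (LINT x|\<mu>. (norm (cis (x * h) - 1) ^ n)\<^sup>2)"
      unfolding spectral_form_def fdiff_symbol by (simp only: norm_mult norm_power norm_cis mult_1)
    also have "\<dots> \<le> (LINT x|\<mu>. ?s\<^sup>2)"
    proof (rule integral_mono_AE)
      have "norm (cis (x * h) - 1) \<le> 2" for x
        using norm_triangle_ineq4[of "cis (x * h)" 1] by simp
      then show "integrable \<mu> (\<lambda>x. (norm (cis (x * h) - 1) ^ n)\<^sup>2)"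
        by (intro continuous_imp_integrable_mu[of _ "(2 ^ n)\<^sup>2"] continuous_intros) (auto intro!: power_mono)
      show "AE x in \<mu>. (norm (cis (x * h) - 1) ^ n)\<^sup>2 \<le> ?s\<^sup>2"
        using A
      proof eventually_elim
        case (elim x)
        have "norm (cis (x * h) - 1) \<le> \<bar>x * h\<bar>"
          using iexp_approx1[of "x * h" 0] by (simp add: cis_conv_exp)
        also have "\<dots> \<le> A * h" using elim h by (simp add: abs_mult mult_right_mono)
        finally show ?case by (intro power_mono) auto
      qed
    qed auto
    also have "\<dots> = ?s\<^sup>2" using mu1 space_mu by simp
    finally show ?thesis .
  qed
  have "0 < ?s\<^sup>2" using s by (rule zero_less_power)
  then have eq: "(u * ?s)\<^sup>2 / (4 * ?s\<^sup>2) = u\<^sup>2 / 4"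
    unfolding power_mult_distrib[of u] by (metis less_irrefl nonzero_mult_divide_mult_cancel_right)
  show ?thesis
    using tail_bound[OF _ var s, of "u * ?s"] u s unfolding eq fdiff_def by simp
qed

text \<open>Newton's forward differences are used instead of Taylor coefficients because they are finite linear
  combinations of values of F; for the step h tending to 0 the exponential type tends to A.\<close>
lemma newton_series_eq_F:
  assumes A: "AE x in \<mu>. \<bar>x\<bar> \<le> A" and h: "h > 0" "A * h < 1" and x: "0 \<le> x" "x < 1"
  shows "AE \<omega> in M. (\<forall>n. \<bar>fdiff h j n \<omega>\<bar> \<le> L * x ^ n) \<longrightarrow>
           newton_series (\<lambda>n. fdiff h j n \<omega>) h (of_real (t - j)) = of_real (F t \<omega>)"
proof -
  define g where "g = (\<lambda>n. ((t - j) / h) gchoose n)"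
  \<comment> \<open>\<open>D N\<close> is the remainder of the Newton series in L^2 of the
    probability space, and \<open>R N\<close> its image in L^2(\<open>\<mu>\<close>) under the
    isometry.\<close>
  define D where "D = (\<lambda>N \<omega>. F t \<omega> - (\<Sum>n<N. g n * fdiff h j n \<omega>))"
  define R where "R = (\<lambda>N x. cis (x * t) - (\<Sum>n<N. of_real (g n) * (cis (x * j) * (cis (x * h) - 1) ^ n)))"
  have gc: "(of_real (t - j) / of_real h gchoose n) = complex_of_real (g n)" for n
    by (simp add: g_def gbinomial_prod_rev)
  have nz: "norm (cis (x * h) - 1) \<le> A * h" if "\<bar>x\<bar> \<le> A" for x
  proof -
    have "norm (cis (x * h) - 1) \<le> \<bar>x * h\<bar>"
      using iexp_approx1[of "x * h" 0] by (simp add: cis_conv_exp)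
    also have "\<dots> \<le> A * h" using that h by (simp add: abs_mult mult_right_mono)
    finally show ?thesis .
  qed
  have sumsR: "(\<lambda>n. of_real (g n) * (cis (x * j) * (cis (x * h) - 1) ^ n)) sums cis (x * t)" if x: "\<bar>x\<bar> \<le> A" for x
  proof -
    have "(\<lambda>n. (of_real ((t - j) / h) gchoose n) * (cis (x * h) - 1) ^ n) sums (1 + (cis (x * h) - 1)) powr of_real ((t - j) / h)"
      using nz[OF x] h by (intro gen_binomial_complex) auto
    also have "(1 + (cis (x * h) - 1)) powr of_real ((t - j) / h) = cis (x * (t - j))"
    proof -
      \<comment> \<open>The binomial series represents the principal power; it equals cis (x (t -
        j)) because |x h| < pi keeps the logarithm on the principal branch.\<close>
      have "\<bar>x * h\<bar> \<le> A * h" using x h by (simp add: abs_mult mult_right_mono)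
      then have "\<bar>x * h\<bar> < pi" using h pi_gt3 by linarith
      then have "Ln (cis (x * h)) = \<i> * of_real (x * h)"
        unfolding cis_conv_exp by (intro Ln_exp) auto
      moreover have "of_real ((t - j) / h) * (\<i> * of_real (x * h)) = \<i> * complex_of_real (x * (t - j))"
        using h by (simp add: field_simps)
      ultimately show ?thesis by (simp add: powr_def) (simp add: cis_conv_exp)
    qed
    finally have "(\<lambda>n. cis (x * j) * ((of_real ((t - j) / h) gchoose n) * (cis (x * h) - 1) ^ n)) sums (cis (x * j) * cis (x * (t - j)))"
      by (rule sums_mult)
    moreover have "cis (x * j) * cis (x * (t - j)) = cis (x * t)" by (simp add: cis_mult algebra_simps)
    moreover have "of_real ((t - j) / h) gchoose n = complex_of_real (g n)" for n using gc[of n] by simp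
    ultimately show ?thesis by (simp only: ac_simps)
  qed
  have int_D: "integrable M (\<lambda>\<omega>. (D N \<omega>)\<^sup>2)" and E_D: "(LINT \<omega>|M. (D N \<omega>)\<^sup>2) = (LINT x|\<mu>. (norm (R N x))\<^sup>2)" for N
  proof -
    \<comment> \<open>The remainder is written as one linear combination, \<open>None\<close>
      indexing \<open>F t\<close> and \<open>Some (n, k)\<close> the k-th term of the n-th
      difference, so that the isometry applies to it as a whole.\<close>
    define K where "K = insert None (Some ` (SIGMA n:{..<N}. {..n}))"
    define c where "c = (\<lambda>p. case p of None \<Rightarrow> 1 | Some (n, k) \<Rightarrow> - g n * ((- 1) ^ (n - k) * real (n choose k)))"
    define \<tau> where "\<tau> = (\<lambda>p. case p of None \<Rightarrow> t | Some (n :: nat, k :: nat) \<Rightarrow> j + k * h)"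
    have K: "finite K" by (simp add: K_def)
    have split: "(\<Sum>p\<in>K. f p) = f None + (\<Sum>n<N. \<Sum>k\<le>n. f (Some (n, k)))" for f :: "(nat \<times> nat) option \<Rightarrow> 'b :: comm_monoid_add"
      unfolding K_def by (subst sum.insert) (auto simp: sum.reindex sum.Sigma)
    have 1: "(\<Sum>p\<in>K. c p * F (\<tau> p) \<omega>) = D N \<omega>" for \<omega>
      unfolding split by (simp add: D_def c_def \<tau>_def fdiff_def sum_distrib_left sum_negf mult.assoc)
    have 2: "(\<Sum>p\<in>K. of_real (c p) * cis (x * \<tau> p)) = R N x" for x
      unfolding split R_def fdiff_symbol[symmetric]
      by (simp add: c_def \<tau>_def sum_distrib_left sum_negf mult.assoc)
    show "integrable M (\<lambda>\<omega>. (D N \<omega>)\<^sup>2)"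
      unfolding 1[symmetric] using K by (intro centered_normal_moments(1) linear_combination_normal) auto
    show "(LINT \<omega>|M. (D N \<omega>)\<^sup>2) = (LINT x|\<mu>. (norm (R N x))\<^sup>2)"
      using variance_linear_combination[OF K, of c \<tau>] unfolding spectral_form_def 1 2 .
  qed
  define B where "B = (\<Sum>n. \<bar>g n\<bar> * (A * h) ^ n)"
  have lim: "(\<lambda>N. LINT x|\<mu>. (norm (R N x))\<^sup>2) \<longlonglongrightarrow> (LINT x|\<mu>. 0)"
  proof (rule integral_dominated_convergence[where w = "\<lambda>_. (1 + B)\<^sup>2"])
    have "continuous_on UNIV (\<lambda>x. (norm (R N x))\<^sup>2)" for N
      unfolding R_def by (intro continuous_intros)
    then show "(\<lambda>x. (norm (R N x))\<^sup>2) \<in> borel_measurable \<mu>" for N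
      unfolding measurable_cong_sets[OF sets_mu refl] by (rule borel_measurable_continuous_onI)
    show "AE x in \<mu>. (\<lambda>N. (norm (R N x))\<^sup>2) \<longlonglongrightarrow> 0"
      using A
    proof eventually_elim
      case (elim x)
      have "(\<lambda>N. cis (x * t) - (\<Sum>n<N. of_real (g n) * (cis (x * j) * (cis (x * h) - 1) ^ n))) \<longlonglongrightarrow> cis (x * t) - cis (x * t)"
        using sumsR[OF elim] unfolding sums_def by (intro tendsto_intros)
      then have "(\<lambda>N. (norm (R N x))\<^sup>2) \<longlonglongrightarrow> (norm (0 :: complex))\<^sup>2"
        unfolding R_def by (intro tendsto_intros) simp
      then show ?case by simp
    qed
    show "AE x in \<mu>. norm ((norm (R N x))\<^sup>2) \<le> (1 + B)\<^sup>2" for N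
      using A
    proof eventually_elim
      case (elim x)
      have Ah: "0 \<le> A * h" using elim h by simp
      have "summable (\<lambda>n. \<bar>g n\<bar> * (A * h) ^ n)"
      proof (rule summable_comparison_test')
        show "summable (\<lambda>n. pochhammer \<bar>(t - j) / h\<bar> n / fact n * (A * h) ^ n)"
          using pochhammer_series[OF Ah h(2)] by (auto simp: sums_iff)
        fix n
        have "\<bar>g n\<bar> \<le> pochhammer \<bar>(t - j) / h\<bar> n / fact n"
          using norm_gbinomial_le[of "of_real (t - j) / of_real h" "\<bar>(t - j) / h\<bar>" n] unfolding gc
          by (simp add: norm_divide flip: of_real_diff)
        then show "norm (\<bar>g n\<bar> * (A * h) ^ n) \<le> pochhammer \<bar>(t - j) / h\<bar> n / fact n * (A * h) ^ n"
          unfolding real_norm_def abs_mult abs_abs abs_of_nonneg[OF zero_le_power[OF Ah]]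
          by (rule mult_right_mono[OF _ zero_le_power[OF Ah]])
      qed
      then have "(\<Sum>n<N. \<bar>g n\<bar> * (A * h) ^ n) \<le> B"
        unfolding B_def using Ah by (intro sum_le_suminf) auto
      moreover have "norm (\<Sum>n<N. of_real (g n) * (cis (x * j) * (cis (x * h) - 1) ^ n)) \<le> (\<Sum>n<N. \<bar>g n\<bar> * (A * h) ^ n)"
        using nz[OF elim] by (intro sum_norm_le) (auto simp: norm_mult norm_power intro!: mult_left_mono power_mono)
      ultimately have "norm (R N x) \<le> 1 + B"
        unfolding R_def by (intro order.trans[OF norm_triangle_ineq4]) auto
      then show ?case by (simp add: power_mono)
    qed
  qed auto
  have "(\<lambda>N. LINT \<omega>|M. norm ((D N \<omega>)\<^sup>2)) \<longlonglongrightarrow> 0"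
    using lim by (simp add: E_D)
  \<comment> \<open>Mean square convergence gives an almost sure limit only along a subsequence.
    That suffices: for the given \<open>\<omega>\<close> the full series already converges by the
    bounds on the differences, so the limits agree.\<close>
  from tendsto_L1_AE_subseq[OF int_D this] obtain r :: "nat \<Rightarrow> nat"
    where r: "strict_mono r" "AE \<omega> in M. (\<lambda>n. (D (r n) \<omega>)\<^sup>2) \<longlonglongrightarrow> 0" by auto
  from r(2) show ?thesis
  proof eventually_elim
    case (elim \<omega>)
    show ?case
    proof
      assume d: "\<forall>n. \<bar>fdiff h j n \<omega>\<bar> \<le> L * x ^ n"
      have "(\<lambda>n. complex_of_real (g n) * of_real (fdiff h j n \<omega>)) sums newton_series (\<lambda>n. fdiff h j n \<omega>) h (of_real (t - j))"
        using newton_series_sums[of "\<lambda>n. fdiff h j n \<omega>" L x h "of_real (t - j)"] d x h unfolding gc by auto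
      then have "(\<lambda>N. complex_of_real (F t \<omega> - D N \<omega>)) \<longlonglongrightarrow> newton_series (\<lambda>n. fdiff h j n \<omega>) h (of_real (t - j))"
        unfolding sums_def by (simp add: D_def)
      then have l1: "(\<lambda>n. complex_of_real (F t \<omega> - D (r n) \<omega>)) \<longlonglongrightarrow> newton_series (\<lambda>n. fdiff h j n \<omega>) h (of_real (t - j))"
        using r(1) by (rule LIMSEQ_subseq_LIMSEQ[unfolded o_def])
      have "(\<lambda>n. sqrt ((D (r n) \<omega>)\<^sup>2)) \<longlonglongrightarrow> sqrt 0"
        using elim by (rule tendsto_real_sqrt)
      then have "(\<lambda>n. D (r n) \<omega>) \<longlonglongrightarrow> 0" by (simp add: tendsto_rabs_zero_iff)
      then have "(\<lambda>n. complex_of_real (F t \<omega> - D (r n) \<omega>)) \<longlonglongrightarrow> complex_of_real (F t \<omega> - 0)"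
        by (intro tendsto_intros)
      from LIMSEQ_unique[OF l1 this]
      show "newton_series (\<lambda>n. fdiff h j n \<omega>) h (of_real (t - j)) = of_real (F t \<omega>)" by simp
    qed
  qed
qed

end

section \<open>Simultaneous bounds for all differences and growth of the extended paths\<close>

context stationary_gaussian
begin

text \<open>The enlarged rate A + 1 / (2 T) makes the union bound over \<open>n\<close> converge:
  the threshold is T (B / A)^n standard deviations, and by Bernoulli's inequality its square is at
  least T^2 + n / A, so the tails decay geometrically with ratio exp (- 1 / (4 A)).\<close>

lemma fdiff_all_bounded:
  assumes A: "AE x in \<mu>. \<bar>x\<bar> \<le> A" and A0: "A > 0" and mu1: "measure \<mu> UNIV = 1"
    and T: "T \<ge> 1" and h: "h > 0"
  shows "prob {\<omega>\<in>space M. \<not> (\<forall>n. \<bar>fdiff h j n \<omega>\<bar> \<le> T * ((A + 1 / (2 * T)) * h) ^ n)}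
           \<le> sqrt 2 * exp (- (T\<^sup>2 / 4)) / (1 - exp (- (1 / (4 * A))))"
proof -
  define B where "B = A + 1 / (2 * T)"
  define q where "q = exp (- (1 / (4 * A)))"
  define u where "u = (\<lambda>n. T * (B / A) ^ n)"
  define E where "E = (\<lambda>n. {\<omega>\<in>space M. \<bar>fdiff h j n \<omega>\<bar> \<ge> u n * (A * h) ^ n})"
  have q: "0 < q" "q < 1" using A0 by (auto simp: q_def)
  have E[measurable]: "E n \<in> sets M" for n unfolding E_def by measurable
  have PE: "prob (E n) \<le> sqrt 2 * exp (- (T\<^sup>2 / 4)) * q ^ n" for n
  proof -
    have "B / A = 1 + 1 / (2 * T * A)" using A0 T by (simp add: B_def field_simps)
    have "1 + real (2 * n) * (1 / (2 * T * A)) \<le> (1 + 1 / (2 * T * A)) ^ (2 * n)"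
      using A0 T by (intro Bernoulli_inequality) (simp add: order.trans[of _ 0])
    then have "T\<^sup>2 * (1 + n / (T * A)) \<le> T\<^sup>2 * (B / A) ^ (2 * n)"
      unfolding \<open>B / A = _\<close> using T by (intro mult_left_mono) auto
    moreover have "T\<^sup>2 * (1 + n / (T * A)) = T\<^sup>2 + n * T / A"
      using T A0 by (simp add: field_simps power2_eq_square)
    moreover have "real n * 1 / A \<le> n * T / A" using T A0 by (intro divide_right_mono mult_left_mono) auto
    moreover have "(u n)\<^sup>2 = T\<^sup>2 * (B / A) ^ (2 * n)"
      by (simp only: u_def power_mult_distrib power_mult[symmetric] mult.commute[of n 2])
    ultimately have "T\<^sup>2 + n / A \<le> (u n)\<^sup>2" by simp
    then have "- ((u n)\<^sup>2 / 4) \<le> - (T\<^sup>2 / 4) + n * (- (1 / (4 * A)))" using A0 by (simp add: field_simps)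
    then have "exp (- ((u n)\<^sup>2 / 4)) \<le> exp (- (T\<^sup>2 / 4)) * q ^ n"
      unfolding q_def exp_of_nat_mult[symmetric] exp_add[symmetric] by simp
    then have "sqrt 2 * exp (- ((u n)\<^sup>2 / 4)) \<le> sqrt 2 * exp (- (T\<^sup>2 / 4)) * q ^ n" by simp
    moreover have "prob (E n) \<le> sqrt 2 * exp (- ((u n)\<^sup>2 / 4))"
      unfolding E_def using T A0 by (intro fdiff_tail A mu1 h A0) (simp add: u_def B_def)
    ultimately show ?thesis by linarith
  qed
  have sm: "(\<lambda>n. sqrt 2 * exp (- (T\<^sup>2 / 4)) * q ^ n) sums (sqrt 2 * exp (- (T\<^sup>2 / 4)) * (1 / (1 - q)))"
    using q by (intro sums_mult geometric_sums) auto
  have smE: "summable (\<lambda>n. prob (E n))"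
    by (rule summable_comparison_test'[OF sums_summable[OF sm]]) (use PE in auto)
  have "u n * (A * h) ^ n = T * (B * h) ^ n" for n
    using A0 by (simp add: u_def power_divide power_mult_distrib)
  then have "{\<omega>\<in>space M. \<not> (\<forall>n. \<bar>fdiff h j n \<omega>\<bar> \<le> T * ((A + 1 / (2 * T)) * h) ^ n)} \<subseteq> (\<Union>n. E n)"
    by (auto simp: E_def B_def[symmetric] not_le intro: less_imp_le)
  then have "prob {\<omega>\<in>space M. \<not> (\<forall>n. \<bar>fdiff h j n \<omega>\<bar> \<le> T * ((A + 1 / (2 * T)) * h) ^ n)} \<le> prob (\<Union>n. E n)"
    by (intro finite_measure_mono) auto
  also have "\<dots> \<le> (\<Sum>n. prob (E n))"
    using smE by (intro finite_measure_subadditive_countably) auto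
  also have "\<dots> \<le> sqrt 2 * exp (- (T\<^sup>2 / 4)) * (1 / (1 - q))"
    using suminf_le[OF PE smE sums_summable[OF sm]] sums_unique[OF sm] by simp
  finally show ?thesis by (simp add: q_def)
qed

text \<open>A series based at one point is only good near that point, so one is used at every
  integer \<open>j\<close> with |j| \<le> J. All of them continue the same path, hence coincide, and
  a point z is estimated from the integer nearest to Re z, at distance at most |Im z| + 1.\<close>

lemma entire_extension:
  assumes A: "AE x in \<mu>. \<bar>x\<bar> \<le> A" and A0: "A > 0" and mu1: "measure \<mu> UNIV = 1"
    and cont: "\<forall>\<omega>\<in>space M. continuous_on UNIV (\<lambda>t. F t \<omega>)"
    and T: "T \<ge> 1"
  obtains G where "G \<in> events"
    "prob (space M - G) \<le> (2 * real J + 1) * (sqrt 2 * exp (- (T\<^sup>2 / 4)) / (1 - exp (- (1 / (4 * A)))))"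
    "\<And>\<omega>. \<omega> \<in> G \<Longrightarrow> \<exists>f. f holomorphic_on UNIV \<and> (\<forall>t. f (of_real t) = of_real (F t \<omega>)) \<and>
       (\<forall>z. \<bar>Re z\<bar> \<le> real J \<longrightarrow> \<bar>Im z\<bar> \<le> T \<longrightarrow> norm (f z) \<le> T * exp (A + 2) * exp (A * \<bar>Im z\<bar>))"
proof -
  define B where "B = A + 1 / (2 * T)"
  \<comment> \<open>Chosen so that (A + 1 / T) (1 - x) = B; the growth rate x / (h (1 - x)) is then
    at most A + 1 / T. For |Im z| \<le> T the excess 1 / T costs at most a factor exp 2.\<close>
  define h where "h = 1 / (2 * T * (A + 1 / T) * B)"
  define x where "x = B * h"
  have B: "B > 0" "A \<le> B" using A0 T by (auto simp: B_def add_pos_pos)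
  have h: "h > 0" using A0 T B by (auto simp: h_def add_pos_pos)
  have "2 * T * (A + 1 / T) = 2 * (T * A + 1)" using T by (simp add: field_simps)
  then have x_eq: "x = 1 / (2 * (T * A + 1))" using B by (simp add: x_def h_def)
  have x: "0 < x" "x < 1 / 2" unfolding x_eq using A0 T by (auto simp: field_simps add_pos_pos)
  have Ah: "A * h < 1"
  proof -
    have "A * h \<le> x" unfolding x_def using B h by (intro mult_right_mono) auto
    then show ?thesis using x by simp
  qed
  have rate: "x / h / (1 - x) \<le> A + 1 / T"
  proof -
    have "B \<le> (A + 1 / T) * (1 - x)"
    proof -
      have "(A + 1 / T) * x = 1 / (2 * T)"
      proof -
        have "A + 1 / T = (T * A + 1) / T" using T by (simp add: field_simps)
        moreover have "T * A + 1 > 0" using A0 T by (simp add: add_pos_pos)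
        moreover have "y / T * (1 / (2 * y)) = 1 / (2 * T)" if "y > 0" for y
          using that T by simp
        ultimately show ?thesis unfolding x_eq by metis
      qed
      moreover have "1 / T = 1 / (2 * T) + 1 / (2 * T)" by (simp add: field_simps)
      ultimately show ?thesis unfolding B_def right_diff_distrib' mult_1_right by linarith
    qed
    then show ?thesis using x h by (simp add: x_def field_simps)
  qed
  define P where "P = (\<lambda>j \<omega>. \<forall>n. \<bar>fdiff h j n \<omega>\<bar> \<le> T * x ^ n)"
  define bad where "bad = (\<lambda>j::int. {\<omega>\<in>space M. \<not> P j \<omega>})"
  have bad[measurable]: "bad j \<in> sets M" for j unfolding bad_def P_def by measurable
  \<comment> \<open>Each time has its own null set; rational times are countably many, and
    continuity of the path together with that of the series extends the equality to all
    times.\<close>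
  have "AE \<omega> in M. \<forall>j::int. \<forall>t\<in>\<rat>. P j \<omega> \<longrightarrow> newton_series (\<lambda>n. fdiff h j n \<omega>) h (of_real (t - j)) = of_real (F t \<omega>)"
    unfolding P_def using x
    by (intro AE_all_countable[THEN iffD2] AE_ball_countable[THEN iffD2] allI ballI newton_series_eq_F[OF A h Ah])
      (auto simp: countable_rat)
  then obtain N where N: "N \<in> null_sets M" and
    NP: "\<And>\<omega> j t. \<omega> \<in> space M \<Longrightarrow> \<omega> \<notin> N \<Longrightarrow> t \<in> \<rat> \<Longrightarrow> P (of_int j) \<omega> \<Longrightarrow>
          newton_series (\<lambda>n. fdiff h (of_int j) n \<omega>) h (of_real (t - of_int j)) = of_real (F t \<omega>)"
    unfolding eventually_ae_filter by blast
  define G where "G = space M - ((\<Union>j\<in>{- int J..int J}. bad j) \<union> N)"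
  show thesis
  proof (rule that[of G])
    show "G \<in> events" unfolding G_def using N by auto
    have "space M - G \<subseteq> (\<Union>j\<in>{- int J..int J}. bad j) \<union> N" by (auto simp: G_def)
    then have "prob (space M - G) \<le> prob ((\<Union>j\<in>{- int J..int J}. bad j) \<union> N)"
      using N by (intro finite_measure_mono) auto
    also have "\<dots> \<le> prob (\<Union>j\<in>{- int J..int J}. bad j) + prob N"
      using N by (intro measure_Un_le) auto
    also have "prob N = 0" using N by (simp add: null_sets_def measure_def)
    also have "prob (\<Union>j\<in>{- int J..int J}. bad j) \<le> (\<Sum>j\<in>{- int J..int J}. prob (bad j))"
      by (intro finite_measure_subadditive_finite) auto
    also have "\<dots> \<le> (\<Sum>j\<in>{- int J..int J}. sqrt 2 * exp (- (T\<^sup>2 / 4)) / (1 - exp (- (1 / (4 * A)))))"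
      unfolding bad_def P_def x_def B_def by (intro sum_mono fdiff_all_bounded A A0 mu1 T h)
    finally show "prob (space M - G) \<le> (2 * real J + 1) * (sqrt 2 * exp (- (T\<^sup>2 / 4)) / (1 - exp (- (1 / (4 * A)))))"
      by (simp add: algebra_simps)
    fix \<omega> assume \<omega>: "\<omega> \<in> G"
    then have sp: "\<omega> \<in> space M" "\<omega> \<notin> N" and PJ: "\<And>j. j \<in> {- int J..int J} \<Longrightarrow> P j \<omega>"
      by (auto simp: G_def bad_def)
    define f where "f = (\<lambda>j::int. \<lambda>z. newton_series (\<lambda>n. fdiff h j n \<omega>) h (z - of_int j))"
    have hol: "f j holomorphic_on UNIV" if "j \<in> {- int J..int J}" for j
      unfolding f_def
      by (rule holomorphic_on_compose_gen[OF _ newton_series_holomorphic[of _ T x], unfolded o_def])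
        (use PJ[OF that] x h in \<open>auto simp: P_def intro!: holomorphic_intros\<close>)
    have fF: "f j (of_real t) = of_real (F t \<omega>)" if j: "j \<in> {- int J..int J}" for j t
    proof -
      have "closed {t. f j (of_real t) = of_real (F t \<omega>)}"
      proof (rule closed_Collect_eq)
        show "continuous_on UNIV (\<lambda>t. f j (of_real t))"
          by (rule continuous_on_compose2[OF holomorphic_on_imp_continuous_on[OF hol[OF j]]])
            (auto intro!: continuous_intros)
        show "continuous_on UNIV (\<lambda>t. complex_of_real (F t \<omega>))"
          using cont sp by (intro continuous_on_of_real) auto
      qed
      moreover have "f j (of_real t) = of_real (F t \<omega>)" if "t \<in> \<rat>" for t
        using NP[OF sp that PJ[OF j]] unfolding f_def by simp
      then have "\<rat> \<subseteq> {t. f j (of_real t) = of_real (F t \<omega>)}" by blast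
      ultimately have "closure \<rat> \<subseteq> {t. f j (of_real t) = of_real (F t \<omega>)}"
        by (rule closure_minimal[rotated])
      then show ?thesis by (auto simp: Rats_closure_real)
    qed
    \<comment> \<open>Identity theorem: both functions agree with the path on the real axis.\<close>
    have same: "f j z = f 0 z" if j: "j \<in> {- int J..int J}" for j z
    proof -
      have "f j z - f 0 z = 0"
      proof (rule analytic_continuation[of "\<lambda>z. f j z - f 0 z" UNIV \<real> 0])
        show "(\<lambda>z. f j z - f 0 z) holomorphic_on UNIV"
          using hol[OF j] hol[of 0] by (intro holomorphic_intros) auto
        show "(0 :: complex) islimpt \<real>"
        proof (rule islimpt_sequential[THEN iffD2], intro exI conjI allI)
          show "(\<lambda>n. complex_of_real (inverse (real (Suc n)))) \<longlonglongrightarrow> 0"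
            using tendsto_of_real[OF LIMSEQ_inverse_real_of_nat, where 'a = complex] by simp
          show "complex_of_real (inverse (real (Suc n))) \<in> \<real> - {0}" for n
            by (simp del: of_nat_Suc)
        qed
        show "f j z - f 0 z = 0" if "z \<in> \<real>" for z
          using that fF[OF j] fF[of 0] by (auto elim!: Reals_cases)
      qed auto
      then show ?thesis by simp
    qed
    show "\<exists>f. f holomorphic_on UNIV \<and> (\<forall>t. f (of_real t) = of_real (F t \<omega>)) \<and>
       (\<forall>z. \<bar>Re z\<bar> \<le> real J \<longrightarrow> \<bar>Im z\<bar> \<le> T \<longrightarrow> norm (f z) \<le> T * exp (A + 2) * exp (A * \<bar>Im z\<bar>))"
    proof (intro exI conjI allI impI)
      show "f 0 holomorphic_on UNIV" "f 0 (of_real t) = of_real (F t \<omega>)" for t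
        using hol[of 0] fF[of 0] by auto
      fix z :: complex assume z: "\<bar>Re z\<bar> \<le> real J" "\<bar>Im z\<bar> \<le> T"
      define j where "j = round (Re z)"
      have j: "j \<in> {- int J..int J}"
      proof -
        have "Re z \<le> of_int (int J)" "of_int (- int J) \<le> Re z" using z by auto
        then have "round (Re z) \<le> round (of_int (int J) :: real)" "round (of_int (- int J) :: real) \<le> round (Re z)"
          by (auto simp only: intro: round_mono)
        then show ?thesis unfolding round_of_int j_def by simp
      qed
      have nz: "norm (z - of_int j) \<le> \<bar>Im z\<bar> + 1"
        using cmod_le[of "z - of_int j"] of_int_round_abs_le[of "Re z"] by (simp add: j_def abs_minus_commute)
      have "norm (f 0 z) \<le> T * (1 - x) powr (- (norm (z - of_int j) / h))"
        unfolding same[OF j, symmetric] unfolding f_def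
        by (rule newton_series_bound) (use PJ[OF j] x h in \<open>auto simp: P_def\<close>)
      also have "(1 - x) powr (- (norm (z - of_int j) / h)) \<le> exp (A + 2) * exp (A * \<bar>Im z\<bar>)"
      proof -
        have "ln (1 / (1 - x)) \<le> 1 / (1 - x) - 1" using x by (intro ln_le_minus_one) auto
        then have ln: "- ln (1 - x) \<le> x / (1 - x)" using x by (simp add: ln_div field_simps)
        have "norm (z - of_int j) / h * (- ln (1 - x)) \<le> (\<bar>Im z\<bar> + 1) / h * (x / (1 - x))"
          using nz ln x h by (intro mult_mono divide_right_mono) auto
        also have "\<dots> = (\<bar>Im z\<bar> + 1) * (x / h / (1 - x))" by simp
        also have "\<dots> \<le> (\<bar>Im z\<bar> + 1) * (A + 1 / T)" using rate by (intro mult_left_mono) auto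
        also have "\<dots> = A * \<bar>Im z\<bar> + A + (\<bar>Im z\<bar> + 1) / T" by (simp add: algebra_simps add_divide_distrib)
        also have "(\<bar>Im z\<bar> + 1) / T \<le> 2" using z T by (simp add: field_simps)
        finally have "norm (z - of_int j) / h * (- ln (1 - x)) \<le> (A + 2) + A * \<bar>Im z\<bar>" by simp
        then show ?thesis unfolding exp_add[symmetric] powr_def using x by simp
      qed
      finally show "norm (f 0 z) \<le> T * exp (A + 2) * exp (A * \<bar>Im z\<bar>)" using T by (simp add: mult.assoc)
    qed
  qed
qed

end

subsection \<open>Overcrowding\<close>

text \<open>\<open>R\<close> is a small multiple of \<open>\<epsilon> * T\<close> so that the
  enlarged range T + 2 R is T (1 + \<delta>), and \<open>l\<close> carries a logarithm so that l (1
  + ln (R / l)) is at most \<delta> R. Together the losses are a factor (1 - \<delta>) / (1 +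
  \<delta>) \<ge> 1 - 2 \<delta>. With \<delta> = \<epsilon> / (4 K), where \<open>K\<close> bounds
  A / pi + \<epsilon>, they consume half of the surplus \<open>\<epsilon>\<close> in the zero
  density; the other half is the \<epsilon> R in the conclusion.\<close>

lemma excess_potential:
  fixes A \<epsilon> T R l n :: real
  defines "K \<equiv> A / pi + 1"
  assumes A: "A > 0" and e: "0 < \<epsilon>" "\<epsilon> \<le> 1 / (16 * K)" and T: "T > 0"
    and R: "R = \<epsilon> * T / (8 * K)" and l: "l = \<epsilon> / (16 * K * ln (1 / \<epsilon>)) * R"
    and n: "n \<ge> (A / pi + \<epsilon>) * T"
  shows "ln (1 / \<epsilon>) \<ge> 1" "0 < l" "l \<le> R" "R \<le> T"
    "2 * A * R / pi + \<epsilon> * R \<le> n * (2 * (R - l - l * ln (R / l))) / (T + 2 * R)"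
proof -
  have K: "K \<ge> 1" using A by (simp add: K_def)
  have "1 / (16 * K) \<le> 1 / 16" using K by (simp add: field_simps)
  then have e16: "\<epsilon> \<le> 1 / 16" using e(2) by linarith
  define L where "L = ln (1 / \<epsilon>)"
  have "exp 1 \<le> (3 :: real)" by (rule exp_le)
  also have "3 \<le> 1 / \<epsilon>" using e16 e(1) by (simp add: field_simps)
  finally have L1: "L \<ge> 1" using e(1) by (simp add: L_def ln_ge_iff)
  then show "ln (1 / \<epsilon>) \<ge> 1" by (simp add: L_def)
  have Rpos: "R > 0" using R e T K by simp
  show lpos: "0 < l" unfolding l L_def[symmetric] using Rpos e K L1 by simp
  have "1 * 1 \<le> 16 * K * L" using K L1 by (intro mult_mono) auto
  then have KL: "1 \<le> 16 * K * L" by simp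
  have "\<epsilon> / (16 * K * L) \<le> 1 / 1" using e e16 K L1
    by (intro frac_le) (auto intro: order.trans[OF _ mult_mono[of 16 "16 * K" 1 L]])
  then show lR: "l \<le> R" unfolding l L_def[symmetric] using Rpos by (intro mult_left_le_one_le) (use e K L1 in auto)
  have "\<epsilon> / (8 * K) \<le> 1 / 1" using e e16 K by (intro frac_le) auto
  then have "\<epsilon> / (8 * K) * T \<le> 1 * T" using T by (intro mult_right_mono) auto
  then show "R \<le> T" unfolding R by simp
  define \<delta> where "\<delta> = \<epsilon> / (4 * K)"
  have d: "0 < \<delta>" "\<delta> \<le> 1" using e K e16 unfolding \<delta>_def by (auto simp: divide_le_eq)
  have "R / l = 16 * K * (L * (1 / \<epsilon>))" unfolding l L_def[symmetric] using Rpos e K L1 by simp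
  moreover have "ln (16 * K * (L * (1 / \<epsilon>))) = ln (16 * K) + ln (L * (1 / \<epsilon>))"
    using e K L1 by (intro ln_mult_pos mult_pos_pos) auto
  moreover have "ln (L * (1 / \<epsilon>)) = ln L + L"
    unfolding L_def[symmetric] using ln_mult_pos[of L "1 / \<epsilon>"] e L1 unfolding L_def[symmetric] by simp
  ultimately have "ln (R / l) = ln (16 * K) + ln L + L" by simp
  moreover have "ln (16 * K) \<le> L"
  proof -
    have "16 * K \<le> 1 / \<epsilon>" using e K by (simp add: field_simps)
    then show ?thesis unfolding L_def using K e by (subst ln_le_cancel_iff) auto
  qed
  moreover have "ln L \<le> L" using ln_bound[of L] L1 by simp
  ultimately have "1 + ln (R / l) \<le> 4 * L" using L1 by simp
  then have "l * (1 + ln (R / l)) \<le> l * (4 * L)" using lpos by simp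
  also have "\<dots> = \<delta> * R" unfolding l \<delta>_def L_def[symmetric] using L1 K by simp
  finally have p: "R * (1 - \<delta>) \<le> R - l - l * ln (R / l)" by (simp add: algebra_simps)
  have TR: "T + 2 * R = T * (1 + \<delta>)" unfolding R \<delta>_def using K by (simp add: field_simps)
  have "2 * A * R / pi + \<epsilon> * R = 2 * R * (A / pi + \<epsilon> - \<epsilon> / 2)" by (simp add: field_simps)
  also have "\<dots> \<le> 2 * R * (A / pi + \<epsilon> - (A / pi + \<epsilon>) * (2 * \<delta>))"
  proof -
    have "(A / pi + \<epsilon>) * (2 * \<delta>) \<le> K * (2 * \<delta>)" using e16 d unfolding K_def by (intro mult_right_mono) auto
    also have "\<dots> = \<epsilon> / 2" unfolding \<delta>_def using K by simp
    finally show ?thesis using Rpos by (intro mult_left_mono) auto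
  qed
  also have "\<dots> = 2 * R * (A / pi + \<epsilon>) * (1 - 2 * \<delta>)"
    by (simp only: right_diff_distrib mult_1_right mult.assoc)
  also have "\<dots> \<le> 2 * R * (A / pi + \<epsilon>) * ((1 - \<delta>) / (1 + \<delta>))"
  proof (intro mult_left_mono)
    have "(1 - 2 * \<delta>) * (1 + \<delta>) \<le> 1 - \<delta>" using d by (simp add: algebra_simps)
    then show "1 - 2 * \<delta> \<le> (1 - \<delta>) / (1 + \<delta>)" using d by (simp add: pos_le_divide_eq)
  qed (use Rpos A e in auto)
  also have "\<dots> = (A / pi + \<epsilon>) * T * (2 * (R * (1 - \<delta>))) / (T * (1 + \<delta>))"
  proof -
    have "(A / pi + \<epsilon>) * T * (2 * (R * (1 - \<delta>))) = T * (2 * R * (A / pi + \<epsilon>) * (1 - \<delta>))"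
      by (simp only: ac_simps)
    then show ?thesis using T by simp
  qed
  also have "\<dots> \<le> n * (2 * (R - l - l * ln (R / l))) / (T * (1 + \<delta>))"
  proof -
    have "0 \<le> (A / pi + \<epsilon>) * T" using A e T by simp
    then have "0 \<le> n" using n by linarith
    then show ?thesis using n p T d Rpos by (intro divide_right_mono mult_mono) auto
  qed
  finally show "2 * A * R / pi + \<epsilon> * R \<le> n * (2 * (R - l - l * ln (R / l))) / (T + 2 * R)"
    unfolding TR .
qed

lemma zero_count_ge_imp_zeros:
  assumes "zero_count f T \<ge> ereal x" "real n < x + 1"
  obtains S where "finite S" "card S = n" "S \<subseteq> {0..T}" "\<And>a. a \<in> S \<Longrightarrow> f a = 0"
proof -
  let ?Z = "{t\<in>{0..T}. f t = 0}"
  have "\<exists>S\<subseteq>?Z. finite S \<and> card S = n"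
  proof (cases "finite ?Z")
    case True
    then have "x \<le> real (card ?Z)" using assms(1) by (simp add: zero_count_def Let_def)
    then have "n \<le> card ?Z" using assms(2) by linarith
    then show ?thesis using obtain_subset_with_card_n[of n ?Z] by blast
  next
    case False
    then show ?thesis using infinite_arbitrarily_large[OF False, of n] by blast
  qed
  then show thesis using that by blast
qed

context stationary_gaussian
begin

text \<open>Translating the lattice multiplies the trigonometric polynomial by a unimodular factor,
  so one constant \<open>C\<close> serves every starting point. The quadratic form is at least C^(-
  m) times the Euclidean one, which costs at most a factor C^m per coordinate.\<close>

lemma lattice_small_ball:
  assumes E: "E \<in> sets borel" "E \<subseteq> {- A..A}" "measure lborel E > 0"
    and k: "\<kappa> > 0" "\<And>B. B \<in> sets borel \<Longrightarrow> \<kappa> * measure lborel (B \<inter> E) \<le> measure \<mu> B"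
    and h: "h > 0" "h * A \<le> 1"
  obtains C where "C \<ge> 1"
    "\<And>m c. (\<Sum>k<m. (c k)\<^sup>2) \<le> C ^ m * spectral_form {..<m} (\<lambda>k. real k * h) c"
    "\<And>m s \<eta>. \<eta> > 0 \<Longrightarrow> prob {\<omega>\<in>space M. \<forall>k<m. \<bar>F (s + real k * h) \<omega>\<bar> \<le> \<eta>} \<le> (exp (1 / 2) * \<eta> * C ^ m) ^ m"
proof -
  obtain C where C: "C \<ge> 1"
    "\<And>(m :: nat) (c :: nat \<Rightarrow> real). (\<Sum>k<m. (c k)\<^sup>2) \<le> C ^ m * (LINT x|\<mu>. (norm (\<Sum>k<m. of_real (c k) * cis (x * (k * h))))\<^sup>2)"
    by (rule trigonometric_lower_bound[OF mu.finite_measure_axioms sets_mu E k h]) (assumption, rule that)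
  show thesis
  proof (rule that[OF C(1)])
    show lower: "(\<Sum>k<m. (c k)\<^sup>2) \<le> C ^ m * spectral_form {..<m} (\<lambda>k. real k * h) c" for m :: nat and c :: "nat \<Rightarrow> real"
      using C(2)[of c m] by (simp add: spectral_form_def)
    fix m :: nat and s \<eta> :: real assume \<eta>: "\<eta> > 0"
    have shift: "spectral_form {..<m} (\<lambda>k. s + real k * h) c = spectral_form {..<m} (\<lambda>k. real k * h) c" for c
    proof -
      have "(\<Sum>k<m. of_real (c k) * cis (x * (s + real k * h))) = cis (x * s) * (\<Sum>k<m. of_real (c k) * cis (x * (real k * h)))" for x
        by (simp add: sum_distrib_left distrib_left cis_mult[symmetric] ac_simps)
      then show ?thesis by (simp add: spectral_form_def norm_mult)
    qed
    have C0: "C ^ m > 0" using C(1) by simp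
    have "prob {\<omega>\<in>space M. \<forall>k\<in>{..<m}. \<bar>F (s + real k * h) \<omega>\<bar> \<le> \<eta>} \<le> (exp (1 / 2) * \<eta> / sqrt (1 / C ^ m)) ^ card {..<m}"
    proof (rule gaussian_small_ball[OF prob_space_axioms _ _ gaussian_cf])
      show "1 / C ^ m * (\<Sum>k<m. (c k)\<^sup>2) \<le> spectral_form {..<m} (\<lambda>k. s + real k * h) c" for c
        unfolding shift using lower[of c m] C0 by (simp add: field_simps)
    qed (use \<eta> C0 in auto)
    also have "exp (1 / 2) * \<eta> / sqrt (1 / C ^ m) = exp (1 / 2) * \<eta> * sqrt (C ^ m)"
      by (simp add: real_sqrt_divide)
    also have "\<dots> ^ card {..<m} \<le> (exp (1 / 2) * \<eta> * C ^ m) ^ m"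
    proof -
      have "sqrt (C ^ m) \<le> C ^ m" using C(1) C0 by (intro real_le_lsqrt self_le_power) auto
      then show ?thesis using \<eta> C0 by (auto intro!: power_mono mult_left_mono)
    qed
    finally show "prob {\<omega>\<in>space M. \<forall>k<m. \<bar>F (s + real k * h) \<omega>\<bar> \<le> \<eta>} \<le> (exp (1 / 2) * \<eta> * C ^ m) ^ m"
      by (simp add: lessThan_def)
  qed
qed

text \<open>The interval on which \<open>F\<close> is small depends on the path. It always contains
  \<open>m\<close> consecutive points of the fixed lattice of spacing 1 / A, so a union bound over
  the order of \<open>T\<close> possible starting points removes this dependence. The first term of
  the bound is the failure of the growth estimate.\<close>

lemma overcrowding_core:
  assumes A: "AE x in \<mu>. \<bar>x\<bar> \<le> A" and A0: "A > 0" and mu1: "measure \<mu> UNIV = 1"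
    and cont: "\<forall>\<omega>\<in>space M. continuous_on UNIV (\<lambda>t. F t \<omega>)"
    and small: "\<And>m s \<eta>. \<eta> > 0 \<Longrightarrow> prob {\<omega>\<in>space M. \<forall>k<m. \<bar>F (s + real k * (1 / A)) \<omega>\<bar> \<le> \<eta>} \<le> (exp (1 / 2) * \<eta> * C ^ m) ^ m"
    and T: "T \<ge> 1" and l: "0 < l" "l \<le> R" "R \<le> T"
    and n: "2 * A * R / pi + d \<le> real n * (2 * (R - l - l * ln (R / l))) / (T + 2 * R)"
    and m: "real m \<le> 2 * l * A"
    and x: "real n < x + 1"
  shows "prob {\<omega>\<in>space M. zero_count (\<lambda>t. F t \<omega>) T \<ge> ereal x}
    \<le> 11 * T * (sqrt 2 * exp (- (T\<^sup>2 / 4)) / (1 - exp (- (1 / (4 * A)))))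
      + (5 * A + 2) * T * (exp (1 / 2) * (T * exp (A + 2) * exp (- d)) * C ^ m) ^ m"
    (is "prob ?Z \<le> ?rhs")
proof -
  \<comment> \<open>|Re z| \<le> T + 3 R and R \<le> T require the growth estimate up to 4
    T.\<close>
  define J where "J = nat \<lceil>4 * T\<rceil>"
  have J: "4 * T \<le> real J" "real J \<le> 4 * T + 1" using T unfolding J_def by linarith+
  define \<eta> where "\<eta> = T * exp (A + 2) * exp (- d)"
  have \<eta>: "\<eta> > 0" using T by (simp add: \<eta>_def)
  obtain G where G: "G \<in> events"
    "prob (space M - G) \<le> (2 * real J + 1) * (sqrt 2 * exp (- (T\<^sup>2 / 4)) / (1 - exp (- (1 / (4 * A)))))"
    "\<And>\<omega>. \<omega> \<in> G \<Longrightarrow> \<exists>f. f holomorphic_on UNIV \<and> (\<forall>t. f (of_real t) = of_real (F t \<omega>)) \<and>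
       (\<forall>z. \<bar>Re z\<bar> \<le> real J \<longrightarrow> \<bar>Im z\<bar> \<le> T \<longrightarrow> norm (f z) \<le> T * exp (A + 2) * exp (A * \<bar>Im z\<bar>))"
    using entire_extension[OF A A0 mu1 cont T] by metis
  define I where "I = {\<lceil>(- R - l) * A\<rceil>..\<lceil>(T + R - l) * A\<rceil>}"
  define D where "D = (\<lambda>i::int. {\<omega>\<in>space M. \<forall>k<m. \<bar>F (of_int i / A + real k * (1 / A)) \<omega>\<bar> \<le> \<eta>})"
  have D[measurable]: "D i \<in> events" for i unfolding D_def by measurable
  have sub: "?Z \<subseteq> (space M - G) \<union> (\<Union>i\<in>I. D i)"
  proof
    fix \<omega> assume \<omega>: "\<omega> \<in> ?Z"
    show "\<omega> \<in> (space M - G) \<union> (\<Union>i\<in>I. D i)"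
    proof (cases "\<omega> \<in> G")
      case True
      obtain f where f: "f holomorphic_on UNIV" "\<And>t. f (of_real t) = of_real (F t \<omega>)"
        "\<And>z. \<bar>Re z\<bar> \<le> real J \<Longrightarrow> \<bar>Im z\<bar> \<le> T \<Longrightarrow> norm (f z) \<le> T * exp (A + 2) * exp (A * \<bar>Im z\<bar>)"
        using G(3)[OF True] by blast
      obtain S where S: "finite S" "card S = n" "S \<subseteq> {0..T}" "\<And>a. a \<in> S \<Longrightarrow> F a \<omega> = 0"
        using zero_count_ge_imp_zeros[of x "\<lambda>t. F t \<omega>" T n] \<omega> x by auto
      obtain y where y: "y \<in> {- R..T + R}"
        "\<And>t. t \<in> {y - l..y + l} \<Longrightarrow> norm (f (of_real t)) \<le> T * exp (A + 2) * exp (- d)"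
      proof (rule excess_zeros_imp_small_on_interval[OF f(1) A0 _ l(1,2)])
        show "norm (f z) \<le> T * exp (A + 2) * exp (A * \<bar>Im z\<bar>)" if "\<bar>Re z\<bar> \<le> T + 3 * R" "\<bar>Im z\<bar> \<le> R" for z
          using that l J by (intro f(3)) auto
        show "2 * A * R / pi + d \<le> real (card S) * (2 * (R - l - l * ln (R / l))) / (T + 2 * R)"
          using n S(2) by simp
      qed (use T S f(2) in auto)
      define i where "i = \<lceil>(y - l) * A\<rceil>"
      have "(- R - l) * A \<le> (y - l) * A" "(y - l) * A \<le> (T + R - l) * A"
        using y(1) A0 by (auto intro!: mult_right_mono)
      then have "i \<in> I" unfolding I_def i_def by (auto intro!: ceiling_mono)
      moreover have "\<omega> \<in> D i"
        unfolding D_def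
      proof (intro CollectI conjI allI impI)
        show "\<omega> \<in> space M" using \<omega> by simp
        fix k assume k: "k < m"
        define t where "t = of_int i / A + real k * (1 / A)"
        \<comment> \<open>Rounding up loses less than one lattice step, and the last index is only m
          - 1, so \<open>m \<le> 2 * l * A\<close> keeps all points in the interval.\<close>
        have iA: "(y - l) * A \<le> of_int i" "of_int i \<le> (y - l) * A + 1" unfolding i_def by linarith+
        have tA: "t * A = of_int i + real k" using A0 by (simp add: t_def field_simps)
        have "(y - l) * A \<le> t * A" "t * A \<le> (y + l) * A"
          using iA m k unfolding tA by (auto simp: algebra_simps)
        then have "t \<in> {y - l..y + l}" using A0 by simp
        from y(2)[OF this] show "\<bar>F t \<omega>\<bar> \<le> \<eta>" by (simp add: f(2) \<eta>_def)
      qed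
      ultimately show ?thesis by blast
    qed (use \<omega> in auto)
  qed
  have cardI: "real (card I) \<le> (5 * A + 2) * T"
  proof -
    have card: "real (card {\<lceil>a\<rceil>..\<lceil>b\<rceil>}) \<le> b - a + 2" if "a \<le> b" for a b :: real
    proof -
      have "real (card {\<lceil>a\<rceil>..\<lceil>b\<rceil>}) = of_int (\<lceil>b\<rceil> - \<lceil>a\<rceil> + 1)"
        using ceiling_mono[OF that] by simp
      then show ?thesis by linarith
    qed
    have "real (card I) \<le> (T + R - l) * A - (- R - l) * A + 2"
      unfolding I_def using l T A0 by (intro card mult_right_mono) auto
    also have "\<dots> = (T + 2 * R) * A + 2" by (simp add: algebra_simps)
    also have "\<dots> \<le> (5 * T) * A + 2 * T" using l T A0 by (intro add_mono mult_right_mono) auto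
    finally show ?thesis by (simp add: algebra_simps)
  qed
  have G0: "0 \<le> sqrt 2 * exp (- (T\<^sup>2 / 4)) / (1 - exp (- (1 / (4 * A))))" using A0 by simp
  have mZ: "prob ?Z \<le> prob ((space M - G) \<union> (\<Union>i\<in>I. D i))"
  proof (cases "?Z \<in> events")
    case True
    then show ?thesis using sub G(1) by (intro finite_measure_mono) (auto simp: I_def)
  next
    case False
    then show ?thesis by (simp add: measure_notin_sets)
  qed
  also have "\<dots> \<le> prob (space M - G) + prob (\<Union>i\<in>I. D i)"
    using G(1) by (intro measure_Un_le) (auto simp: I_def)
  also have "prob (space M - G) \<le> 11 * T * (sqrt 2 * exp (- (T\<^sup>2 / 4)) / (1 - exp (- (1 / (4 * A)))))"
    using J T by (intro order.trans[OF G(2)] mult_right_mono G0) auto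
  also have "prob (\<Union>i\<in>I. D i) \<le> (\<Sum>i\<in>I. prob (D i))"
    by (intro finite_measure_subadditive_finite) (auto simp: I_def)
  also have "\<dots> \<le> (\<Sum>i\<in>I. (exp (1 / 2) * \<eta> * C ^ m) ^ m)"
    unfolding D_def by (intro sum_mono small \<eta>)
  also have "\<dots> = real (card I) * (exp (1 / 2) * \<eta> * C ^ m) ^ m" by simp
  also have "\<dots> \<le> (5 * A + 2) * T * (exp (1 / 2) * \<eta> * C ^ m) ^ m"
    using cardI order.trans[OF measure_nonneg small[OF \<eta>, of m 0]] by (intro mult_right_mono)
  finally show ?thesis by (simp add: \<eta>_def)
qed

text \<open>The smallness exponent \<epsilon> R is a multiple of \<epsilon>^2 T, and the number
  \<open>m\<close> of lattice points one of \<epsilon>^2 T / L with L = ln (1 / \<epsilon>); their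
  product is the final exponent. All other factors are polynomial in \<open>T\<close> or exponential
  in \<open>m\<close> and are absorbed because \<epsilon>^2 T \<ge> d1^2 (ln T)^2.\<close>

lemma overcrowding_bound:
  assumes A: "AE x in \<mu>. \<bar>x\<bar> \<le> A" and A0: "A > 0" and mu1: "measure \<mu> UNIV = 1"
    and cont: "\<forall>\<omega>\<in>space M. continuous_on UNIV (\<lambda>t. F t \<omega>)"
    and C: "C \<ge> 1"
    and small: "\<And>m s \<eta>. \<eta> > 0 \<Longrightarrow> prob {\<omega>\<in>space M. \<forall>k<m. \<bar>F (s + real k * (1 / A)) \<omega>\<bar> \<le> \<eta>} \<le> (exp (1 / 2) * \<eta> * C ^ m) ^ m"
  shows "\<exists>c>0. \<exists>d1>0. \<exists>d2>0. \<forall>T\<ge>exp 8. \<forall>\<epsilon>\<in>{d1 * (ln T / sqrt T)..d2}.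
            prob {\<omega>\<in>space M. zero_count (\<lambda>t. F t \<omega>) T \<ge> ereal (A / pi * T + \<epsilon> * T)}
              \<le> exp (- c * (\<epsilon> / ln \<epsilon>) ^ 4 * T\<^sup>2)"
proof -
  define K where "K = A / pi + 1"
  \<comment> \<open>\<open>\<beta>\<close> is given by \<epsilon> R = \<beta> \<epsilon>^2 T. The
    first bound in \<open>\<gamma>\<close> fits \<open>m\<close> points into the interval, the
    second limits the covariance loss m ln C to a quarter of \<beta> \<epsilon>^2 T.\<close>
  define \<beta> where "\<beta> = 1 / (8 * K)"
  define \<gamma> where "\<gamma> = min (A / (64 * K\<^sup>2)) (\<beta> / (4 * (1 + ln C)))"
  define K0 where "K0 = sqrt 2 / (1 - exp (- (1 / (4 * A))))"
  define c' where "c' = min (1 / 8) (\<gamma> * \<beta> / 8)"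
  \<comment> \<open>One summand per task: growth factor, m \<ge> 1, number of starting points,
    prefactor of the growth failure, and the final factor 2.\<close>
  define d1 where "d1 = 1 + (A + 4) / \<beta> + 1 / \<gamma> + (5 * A + 3) / \<beta> + 11 * K0 + 1 / c'"
  define d2 where "d2 = 1 / (16 * K)"
  have K: "K \<ge> 1" using A0 by (simp add: K_def)
  have \<beta>: "\<beta> > 0" using K by (simp add: \<beta>_def)
  have lnC: "ln C \<ge> 0" using C by simp
  have \<gamma>: "\<gamma> > 0" "\<gamma> \<le> A / (64 * K\<^sup>2)" "\<gamma> * (1 + ln C) \<le> \<beta> / 4"
  proof -
    show "\<gamma> > 0" using A0 K \<beta> lnC by (simp add: \<gamma>_def)
    show "\<gamma> \<le> A / (64 * K\<^sup>2)" by (simp add: \<gamma>_def)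
    have "\<gamma> \<le> \<beta> / (4 * (1 + ln C))" by (simp add: \<gamma>_def)
    then have "\<gamma> * (1 + ln C) \<le> \<beta> / (4 * (1 + ln C)) * (1 + ln C)" using lnC by (intro mult_right_mono) auto
    also have "\<beta> / (4 * (1 + ln C)) * (1 + ln C) = \<beta> / 4"
    proof -
      have gen: "\<beta> / (4 * y) * y = \<beta> / 4" if "y \<noteq> 0" for y using that by simp
      have "1 + ln C \<noteq> 0" using lnC by linarith
      then show ?thesis by (rule gen)
    qed
    finally show "\<gamma> * (1 + ln C) \<le> \<beta> / 4" .
  qed
  have K0: "K0 \<ge> 0" using A0 by (simp add: K0_def)
  have c': "c' > 0" "c' \<le> 1 / 8" "c' \<le> \<gamma> * \<beta> / 8" using \<beta> \<gamma> by (auto simp: c'_def)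
  have pos: "(A + 4) / \<beta> \<ge> 0" "1 / \<gamma> \<ge> 0" "(5 * A + 3) / \<beta> \<ge> 0" "1 / c' \<ge> 0"
    using A0 \<beta> \<gamma> c' by auto
  have d1: "d1 \<ge> 1" "d1 \<ge> (A + 4) / \<beta>" "d1 \<ge> 1 / \<gamma>" "d1 \<ge> (5 * A + 3) / \<beta>" "d1 \<ge> 11 * K0" "d1 \<ge> 1 / c'"
    unfolding d1_def using pos K0 by linarith+
  have d1sq: "d1 \<le> d1\<^sup>2" using d1(1) by (simp add: power2_eq_square)
  have main: "prob {\<omega>\<in>space M. zero_count (\<lambda>t. F t \<omega>) T \<ge> ereal (A / pi * T + \<epsilon> * T)}
              \<le> exp (- (c' / 2) * (\<epsilon> / ln \<epsilon>) ^ 4 * T\<^sup>2)"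
    if T: "T \<ge> exp 8" and eps: "d1 * (ln T / sqrt T) \<le> \<epsilon>" "\<epsilon> \<le> d2" for T \<epsilon>
  proof -
    define t where "t = ln T"
    have T9: "T \<ge> 9" using T exp_ge_add_one_self[of "8 :: real"] by linarith
    have t8: "t \<ge> 8" unfolding t_def using T T9 by (subst ln_ge_iff) auto
    have At: "A * 8 \<le> A * t" using t8 A0 by simp
    have e0: "\<epsilon> > 0"
    proof -
      have "0 < d1 * (ln T / sqrt T)" using d1(1) t8 T9 by (simp add: t_def)
      then show ?thesis using eps by linarith
    qed
    have e2T: "d1\<^sup>2 * t\<^sup>2 \<le> \<epsilon>\<^sup>2 * T"
    proof -
      have "(d1 * (ln T / sqrt T))\<^sup>2 \<le> \<epsilon>\<^sup>2" using eps d1(1) t8 T9 by (intro power_mono) (auto simp: t_def)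
      then have "(d1 * (ln T / sqrt T))\<^sup>2 * T \<le> \<epsilon>\<^sup>2 * T" using T9 by (intro mult_right_mono) auto
      then show ?thesis using T9 by (simp add: t_def power_mult_distrib power_divide)
    qed
    define L where "L = ln (1 / \<epsilon>)"
    define R where "R = \<epsilon> * T / (8 * K)"
    define l where "l = \<epsilon> / (16 * K * ln (1 / \<epsilon>)) * R"
    define n where "n = nat \<lceil>(A / pi + \<epsilon>) * T\<rceil>"
    have xT: "(A / pi + \<epsilon>) * T > 0" using A0 e0 T9 by (simp add: add_pos_pos)
    have n: "(A / pi + \<epsilon>) * T \<le> real n" "real n < (A / pi + \<epsilon>) * T + 1" using xT unfolding n_def by linarith+
    have T0: "T > 0" using T9 by simp
    note ep = excess_potential[of A \<epsilon> T R l "real n", folded K_def, OF A0 e0 eps(2)[unfolded d2_def] T0 R_def l_def n(1)]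
    have L1: "L \<ge> 1" using ep(1) by (simp add: L_def)
    define Y where "Y = \<epsilon> ^ 4 * T\<^sup>2 / L"
    have d2le: "d2 \<le> 1" using K by (simp add: d2_def)
    have e1: "\<epsilon> \<le> 1" using eps(2) d2le by linarith
    have e2T1: "d1 * t\<^sup>2 \<le> \<epsilon>\<^sup>2 * T" using e2T d1sq by (meson mult_right_mono order.trans zero_le_power2)
    have tt: "8 * t \<le> t\<^sup>2" using t8 by (simp add: power2_eq_square)
    have e2Tt: "8 * d1 * t \<le> \<epsilon>\<^sup>2 * T"
    proof -
      have "d1 * (8 * t) \<le> d1 * t\<^sup>2" using tt d1(1) by (intro mult_left_mono) auto
      then show ?thesis using e2T1 by simp
    qed
    have Lt: "L \<le> t"
    proof -
      have "1 / T \<le> \<epsilon>"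
      proof -
        have "1 \<le> d1 * t\<^sup>2" using d1(1) tt t8 mult_mono[of 1 d1 1 "t\<^sup>2"] by simp
        also have "\<dots> \<le> \<epsilon>\<^sup>2 * T" by (rule e2T1)
        also have "\<dots> \<le> \<epsilon> * T" using e0 e1 T0 by (intro mult_right_mono) (auto simp: power2_eq_square mult_left_le)
        finally show ?thesis using T0 by (simp add: field_simps)
      qed
      then have "1 / \<epsilon> \<le> T" using T0 e0 by (simp add: field_simps)
      then show ?thesis unfolding L_def t_def using e0 T0 by (subst ln_le_cancel_iff) auto
    qed
    define m where "m = nat \<lfloor>\<gamma> * \<epsilon>\<^sup>2 * T / L\<rfloor>"
    have m_arg: "1 \<le> \<gamma> * \<epsilon>\<^sup>2 * T / L"
    proof -
      have "1 * t \<le> (\<gamma> * d1) * (8 * t)" using d1(3) \<gamma>(1) t8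
        by (intro mult_mono) (auto simp: field_simps)
      also have "\<dots> = \<gamma> * (8 * d1 * t)" by simp
      also have "\<dots> \<le> \<gamma> * (\<epsilon>\<^sup>2 * T)" using e2Tt \<gamma>(1) by (intro mult_left_mono) auto
      finally have "L \<le> \<gamma> * \<epsilon>\<^sup>2 * T" using Lt by (simp add: mult.assoc)
      then show ?thesis using L1 by simp
    qed
    have fl: "real m = of_int \<lfloor>\<gamma> * \<epsilon>\<^sup>2 * T / L\<rfloor>" "1 \<le> \<lfloor>\<gamma> * \<epsilon>\<^sup>2 * T / L\<rfloor>"
      using m_arg by (simp_all add: m_def le_floor_iff)
    have m: "real m \<le> \<gamma> * \<epsilon>\<^sup>2 * T / L" "\<gamma> * \<epsilon>\<^sup>2 * T / (2 * L) \<le> real m"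
    proof -
      show "real m \<le> \<gamma> * \<epsilon>\<^sup>2 * T / L" unfolding fl by linarith
      have "\<gamma> * \<epsilon>\<^sup>2 * T / L \<le> real m * 2" using fl by linarith
      then show "\<gamma> * \<epsilon>\<^sup>2 * T / (2 * L) \<le> real m"
        using L1 by (simp add: pos_divide_le_eq mult.assoc)
    qed
    have m1: "m \<ge> 1" using fl by linarith
    have m2l: "real m \<le> 2 * l * A"
    proof -
      have "2 * l * A = A / (64 * K\<^sup>2) * (\<epsilon>\<^sup>2 * T / L)"
        by (simp add: l_def R_def L_def power2_eq_square ac_simps)
      also have "\<dots> \<ge> \<gamma> * (\<epsilon>\<^sup>2 * T / L)" using \<gamma>(2) T0 L1 by (intro mult_right_mono) auto
      finally show ?thesis using m(1) by simp
    qed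
    have core: "prob {\<omega>\<in>space M. zero_count (\<lambda>t. F t \<omega>) T \<ge> ereal ((A / pi + \<epsilon>) * T)}
      \<le> 11 * T * (sqrt 2 * exp (- (T\<^sup>2 / 4)) / (1 - exp (- (1 / (4 * A)))))
        + (5 * A + 2) * T * (exp (1 / 2) * (T * exp (A + 2) * exp (- (\<epsilon> * R))) * C ^ m) ^ m"
      using T9 by (intro overcrowding_core[OF A A0 mu1 cont small _ ep(2-5) m2l n(2)]) auto
    \<comment> \<open>Of the exponent \<beta> \<epsilon>^2 T per point a quarter pays for the growth
      factor and a quarter for the covariance. The remaining half gives exp (- 2 X), and one
      \<open>X\<close> pays for the number of starting points.\<close>
    define X where "X = real m * (\<beta> * (\<epsilon>\<^sup>2 * T)) / 4"
    have bT: "(A + 4) * t \<le> \<beta> * (\<epsilon>\<^sup>2 * T) / 4" "(5 * A + 3) * t \<le> \<beta> * (\<epsilon>\<^sup>2 * T) / 4"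
    proof -
      have "(A + 4) \<le> \<beta> * d1" "5 * A + 3 \<le> \<beta> * d1" using d1(2,4) \<beta> by (auto simp: field_simps)
      moreover have "\<beta> * d1 * t \<le> \<beta> * (\<epsilon>\<^sup>2 * T) / 8"
        using mult_left_mono[OF e2Tt, of \<beta>] \<beta> by simp
      moreover have "0 \<le> \<beta> * (\<epsilon>\<^sup>2 * T)" using \<beta> T0 by simp
      ultimately show "(A + 4) * t \<le> \<beta> * (\<epsilon>\<^sup>2 * T) / 4" "(5 * A + 3) * t \<le> \<beta> * (\<epsilon>\<^sup>2 * T) / 4"
        using mult_right_mono[of "A + 4" "\<beta> * d1" t] mult_right_mono[of "5 * A + 3" "\<beta> * d1" t] t8
        by linarith+
    qed
    have term2: "(5 * A + 2) * T * (exp (1 / 2) * (T * exp (A + 2) * exp (- (\<epsilon> * R))) * C ^ m) ^ m \<le> exp (- X)"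
    proof -
      have eR: "\<epsilon> * R = \<beta> * (\<epsilon>\<^sup>2 * T)" by (simp add: R_def \<beta>_def power2_eq_square)
      have "exp (1 / 2) * (T * exp (A + 2) * exp (- (\<epsilon> * R))) * C ^ m
          = exp (1 / 2 + t + (A + 2) - \<epsilon> * R + real m * ln C)"
      proof -
        have "T = exp t" "C ^ m = exp (real m * ln C)" using T0 C by (simp_all add: t_def exp_of_nat_mult)
        then show ?thesis by (simp only: mult_exp_exp) (simp add: algebra_simps)
      qed
      also have "\<dots> \<le> exp (- (\<beta> * (\<epsilon>\<^sup>2 * T)) / 2)"
      proof -
        have "1 / 2 + t + (A + 2) \<le> (A + 4) * t" using t8 A0 At unfolding distrib_right by linarith
        moreover have "real m * ln C \<le> \<beta> * (\<epsilon>\<^sup>2 * T) / 4"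
        proof -
          have "real m \<le> \<gamma> * (\<epsilon>\<^sup>2 * T)"
          proof -
            have "\<gamma> * \<epsilon>\<^sup>2 * T / L \<le> \<gamma> * \<epsilon>\<^sup>2 * T / 1" using L1 \<gamma>(1) T0 by (intro divide_left_mono) auto
            then show ?thesis using m(1) by (simp add: mult.assoc)
          qed
          then have "real m * ln C \<le> \<gamma> * (\<epsilon>\<^sup>2 * T) * (1 + ln C)" using lnC by (intro mult_mono) auto
          also have "\<dots> = \<gamma> * (1 + ln C) * (\<epsilon>\<^sup>2 * T)" by simp
          also have "\<dots> \<le> \<beta> / 4 * (\<epsilon>\<^sup>2 * T)" using \<gamma>(3) T0 by (intro mult_right_mono) auto
          finally show ?thesis by simp
        qed
        ultimately show ?thesis using bT(1) unfolding eR by simp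
      qed
      finally have "(exp (1 / 2) * (T * exp (A + 2) * exp (- (\<epsilon> * R))) * C ^ m) ^ m \<le> exp (- (\<beta> * (\<epsilon>\<^sup>2 * T)) / 2) ^ m"
        using T0 C by (intro power_mono) auto
      also have "\<dots> = exp (- (2 * X))" by (simp add: X_def exp_of_nat_mult[symmetric])
      finally have 1: "(exp (1 / 2) * (T * exp (A + 2) * exp (- (\<epsilon> * R))) * C ^ m) ^ m \<le> exp (- (2 * X))" .
      have "(5 * A + 2) * T \<le> exp (5 * A + 2) * exp t"
        using A0 T0 exp_ge_add_one_self[of "5 * A + 2"] by (intro mult_mono) (auto simp: t_def)
      also have "\<dots> = exp (5 * A + 2 + t)" by (simp add: exp_add)
      also have "\<dots> \<le> exp X"
      proof -
        have "5 * A + 2 + t \<le> (5 * A + 3) * t" using t8 A0 At unfolding distrib_right by linarith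
        also have "\<dots> \<le> 1 * (\<beta> * (\<epsilon>\<^sup>2 * T)) / 4" using bT(2) by simp
        also have "\<dots> \<le> X" unfolding X_def using m1 \<beta> T0 by (intro divide_right_mono mult_right_mono) auto
        finally show ?thesis by simp
      qed
      finally have "(5 * A + 2) * T * (exp (1 / 2) * (T * exp (A + 2) * exp (- (\<epsilon> * R))) * C ^ m) ^ m \<le> exp X * exp (- (2 * X))"
        using 1 A0 T0 C by (intro mult_mono) auto
      then show ?thesis by (simp add: exp_add[symmetric])
    qed
    have Td1: "d1 \<le> T"
    proof -
      have "d1 * 1 \<le> d1 * t\<^sup>2" using d1(1) t8 by (intro mult_left_mono) (auto simp: power2_eq_square intro: order.trans[OF _ mult_mono[of 1 t 1 t]])
      also have "\<dots> \<le> \<epsilon>\<^sup>2 * T" by (rule e2T1)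
      also have "\<dots> \<le> 1 * T" using e0 e1 T0 by (intro mult_right_mono) (auto simp: power_le_one)
      finally show ?thesis by simp
    qed
    have term1: "11 * T * (sqrt 2 * exp (- (T\<^sup>2 / 4)) / (1 - exp (- (1 / (4 * A))))) \<le> exp (- (T\<^sup>2 / 8))"
    proof -
      have "11 * T * (sqrt 2 * exp (- (T\<^sup>2 / 4)) / (1 - exp (- (1 / (4 * A))))) = (11 * K0) * T * exp (- (T\<^sup>2 / 4))"
        by (simp add: K0_def)
      also have "\<dots> \<le> T * T * exp (- (T\<^sup>2 / 4))"
        using d1(5) Td1 T0 K0 by (intro mult_right_mono) auto
      also have "T * T \<le> exp (T\<^sup>2 / 8)"
      proof -
        have "exp t = T" using T0 by (simp add: t_def)
        then have "T * T = exp (t + t)" by (simp only: exp_add)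
        also have "t \<le> T - 1" unfolding t_def using T0 by (rule ln_le_minus_one)
        also have "exp (T - 1 + (T - 1)) \<le> exp (T\<^sup>2 / 8)"
        proof -
          have "16 \<le> T"
          proof -
            have "exp (8 :: real) = exp 1 ^ 8" using exp_of_nat_mult[of 8 "1 :: real"] by simp
            moreover have "(2 :: real) ^ 8 \<le> exp 1 ^ 8" using exp_ge_add_one_self[of "1 :: real"] by (intro power_mono) auto
            ultimately show ?thesis using T by simp
          qed
          then have "16 * T \<le> T * T" using T0 by (intro mult_right_mono) auto
          then show ?thesis by (simp add: power2_eq_square)
        qed
        finally show ?thesis by simp
      qed
      finally have "11 * T * (sqrt 2 * exp (- (T\<^sup>2 / 4)) / (1 - exp (- (1 / (4 * A))))) \<le> exp (T\<^sup>2 / 8) * exp (- (T\<^sup>2 / 4))"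
        by simp
      then show ?thesis by (simp add: exp_add[symmetric])
    qed
    have Y0: "Y \<ge> 0" using L1 T0 by (simp add: Y_def)
    have YT: "Y \<le> T\<^sup>2"
    proof -
      have "Y \<le> 1 * T\<^sup>2 / 1" unfolding Y_def using L1 e0 e1 by (intro frac_le mult_right_mono) (auto simp: power_le_one)
      then show ?thesis by simp
    qed
    have XY: "c' * Y \<le> X"
    proof -
      have "c' * Y \<le> \<gamma> * \<beta> / 8 * Y" using c'(3) Y0 by (intro mult_right_mono) auto
      also have "\<dots> = \<gamma> * \<epsilon>\<^sup>2 * T / (2 * L) * (\<beta> * (\<epsilon>\<^sup>2 * T)) / 4"
        by (simp add: Y_def power2_eq_square power4_eq_xxxx)
      also have "\<dots> \<le> X" unfolding X_def using m(2) \<beta> T0 by (intro divide_right_mono mult_right_mono) auto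
      finally show ?thesis .
    qed
    have XT: "c' * Y \<le> T\<^sup>2 / 8" using mult_mono[OF c'(2) YT] Y0 c' by simp
    \<comment> \<open>Two error terms of the same size are added; the factor 2 is absorbed by
      halving the constant, for which the exponent must be bounded below.\<close>
    have two: "(2 :: real) \<le> exp (c' * Y / 2)"
    proof -
      have "\<epsilon> ^ 4 * T\<^sup>2 = (\<epsilon>\<^sup>2 * T)\<^sup>2" by (simp add: power_mult_distrib)
      also have "\<dots> \<ge> (8 * d1 * t)\<^sup>2" using e2Tt d1(1) t8 by (intro power_mono) auto
      finally have "(8 * d1 * t)\<^sup>2 \<le> \<epsilon> ^ 4 * T\<^sup>2" .
      moreover have "(8 * d1 * t)\<^sup>2 = 64 * d1\<^sup>2 * t * t" by (simp add: power2_eq_square)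
      moreover have "64 * d1\<^sup>2 * t * L \<le> 64 * d1\<^sup>2 * t * t" using Lt t8 by (intro mult_left_mono) auto
      ultimately have "64 * d1\<^sup>2 * t * L \<le> \<epsilon> ^ 4 * T\<^sup>2" by linarith
      then have "64 * d1\<^sup>2 * t \<le> Y" using L1 unfolding Y_def by (subst pos_le_divide_eq) auto
      moreover have "64 * d1 * 1 \<le> 64 * d1\<^sup>2 * t" using d1sq t8 d1(1) by (intro mult_mono) auto
      ultimately have "d1 * 2 \<le> Y" using d1(1) by simp
      then have "c' * (d1 * 2) \<le> c' * Y" using c' by simp
      moreover have "1 \<le> c' * d1" using d1(6) c'(1) by (simp add: field_simps)
      ultimately have "1 \<le> c' * Y / 2" by simp
      then show ?thesis using exp_ge_add_one_self[of "c' * Y / 2"] by linarith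
    qed
    have "prob {\<omega>\<in>space M. zero_count (\<lambda>t. F t \<omega>) T \<ge> ereal ((A / pi + \<epsilon>) * T)} \<le> exp (- (T\<^sup>2 / 8)) + exp (- X)"
      using core term1 term2 by linarith
    also have "\<dots> \<le> exp (- (c' * Y)) + exp (- (c' * Y))" using XY XT by (intro add_mono) auto
    also have "\<dots> = 2 * exp (- (c' * Y))" by simp
    also have "\<dots> \<le> exp (c' * Y / 2) * exp (- (c' * Y))" using two by (intro mult_right_mono) auto
    also have "\<dots> = exp (- (c' / 2 * Y))" by (simp add: exp_add[symmetric])
    \<comment> \<open>Since L \<ge> 1, passing from 1 / L to 1 / L^4 only weakens the bound; the
      even power removes the sign of \<open>ln \<epsilon>\<close>.\<close>
    also have "\<dots> \<le> exp (- (c' / 2) * (\<epsilon> / ln \<epsilon>) ^ 4 * T\<^sup>2)"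
    proof -
      have "ln \<epsilon> = - L" using e0 by (simp add: L_def ln_div)
      then have "(\<epsilon> / ln \<epsilon>) ^ 4 * T\<^sup>2 = \<epsilon> ^ 4 * T\<^sup>2 / L ^ 4" by (simp add: power_divide)
      also have "\<dots> \<le> Y" unfolding Y_def using L1 by (intro divide_left_mono self_le_power) auto
      finally have "c' / 2 * ((\<epsilon> / ln \<epsilon>) ^ 4 * T\<^sup>2) \<le> c' / 2 * Y" using c' by (intro mult_left_mono) auto
      then show ?thesis by (simp add: mult.assoc)
    qed
    finally show ?thesis by (simp add: distrib_right)
  qed
  show ?thesis
  proof (rule exI[of _ "c' / 2"], intro conjI, goal_cases)
    case 2
    show ?case
    proof (rule exI[of _ d1], intro conjI, goal_cases)
      case 2
      show ?case
      proof (rule exI[of _ d2], intro conjI allI ballI impI, goal_cases)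
        case (2 T \<epsilon>)
        then show ?case using main[of T \<epsilon>] unfolding atLeastAtMost_iff by blast
      qed (use K in \<open>simp add: d2_def\<close>)
    qed (use d1 in simp)
  qed (use c' in simp)
qed

end

subsection \<open>Comparison of Gaussian laws\<close>

text \<open>Levy's uniqueness theorem after normalisation; the total masses agree by taking u =
  \<theta> = 0. The phase \<open>\<theta>\<close> lets real cosines carry both parts of the
  characteristic function, so that they can later be shifted to nonnegative densities.\<close>

lemma finite_measure_eqI_cos:
  fixes K1 K2 :: "real measure"
  assumes fin: "finite_measure K1" "finite_measure K2" and sets: "sets K1 = sets borel" "sets K2 = sets borel"
    and eq: "\<And>u \<theta>. (LINT x|K1. cos (u * x + \<theta>)) = (LINT x|K2. cos (u * x + \<theta>))"
  shows "K1 = K2"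
proof -
  interpret K1: finite_measure K1 by fact
  interpret K2: finite_measure K2 by fact
  note [measurable_cong] = sets
  have sp: "space K1 = UNIV" "space K2 = UNIV" using sets[THEN sets_eq_imp_space_eq] by auto
  define m where "m = measure K1 UNIV"
  have m2: "measure K2 UNIV = m" using eq[of 0 0] by (simp add: m_def sp)
  have m0: "m \<ge> 0" by (simp add: m_def)
  show ?thesis
  proof (cases "m = 0")
    case True
    have "emeasure K1 B = emeasure K2 B" for B
      using emeasure_space[of K1 B] emeasure_space[of K2 B] True m2
      by (simp add: sp m_def K1.emeasure_eq_measure K2.emeasure_eq_measure measure_le_0_iff)
    then show ?thesis by (intro measure_eqI) (simp_all add: sets)
  next
    case False
    with m0 have m: "m > 0" by simp
    define D where "D = (\<lambda>K :: real measure. density K (\<lambda>_. ennreal (1 / m)))"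
    have rd: "real_distribution (D K)" if "finite_measure K" "sets K = sets borel" "measure K UNIV = m" for K
    proof -
      interpret K: finite_measure K by fact
      have "space K = UNIV" using sets_eq_imp_space_eq[OF that(2)] by simp
      then have "emeasure (D K) (space (D K)) = ennreal (1 / m) * ennreal m"
        unfolding D_def using that(2,3) by (simp add: emeasure_density_const K.emeasure_eq_measure)
      also have "\<dots> = 1" using m by (simp add: ennreal_mult[symmetric])
      finally have "prob_space (D K)" by (rule prob_spaceI)
      then show ?thesis
        using that(2) \<open>space K = UNIV\<close> by (simp add: real_distribution_def real_distribution_axioms_def D_def)
    qed
    have ch: "char (D K) t = complex_of_real ((1 / m) * (LINT x|K. cos (t * x + 0))) + \<i> * complex_of_real ((1 / m) * (LINT x|K. cos (t * x + (- (pi / 2)))))"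
      if "finite_measure K" "sets K = sets borel" "measure K UNIV = m" for K t
    proof -
      interpret DK: real_distribution "D K" by (rule rd[OF that])
      have [measurable_cong]: "sets K = sets borel" by fact
      have c: "(LINT x|D K. g x) = (1 / m) * (LINT x|K. g x)" if "g \<in> borel_measurable borel" for g :: "real \<Rightarrow> real"
        unfolding D_def using m that by (subst integral_density) auto
      have "integrable (D K) (\<lambda>x. iexp (t * x))" by (intro DK.integrable_const_bound[of _ 1]) auto
      then have "Re (char (D K) t) = (LINT x|D K. cos (t * x))" "Im (char (D K) t) = (LINT x|D K. sin (t * x))"
        unfolding char_def by (simp_all add: integral_Re[symmetric] integral_Im[symmetric] Re_exp Im_exp)
      moreover have "cos (t * x + (- (pi / 2))) = sin (t * x)" for x
        by (simp add: cos_diff)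
      ultimately show ?thesis by (simp add: complex_eq_iff c)
    qed
    have "char (D K1) t = char (D K2) t" for t
      unfolding ch[OF fin(1) sets(1) m_def[symmetric]] ch[OF fin(2) sets(2) m2] eq ..
    then have "D K1 = D K2"
      by (intro Levy_uniqueness rd ext fin sets m_def[symmetric] m2)
    then have "emeasure (D K1) B = emeasure (D K2) B" for B by simp
    then have "emeasure K1 B = emeasure K2 B" if "B \<in> sets borel" for B
      using that sets m unfolding D_def
      by (metis emeasure_density_const ennreal_mult_cancel_left ennreal_neq_top ennreal_eq_0_iff divide_pos_pos zero_less_one linorder_not_le)
    then show ?thesis by (intro measure_eqI) (auto simp: sets)
  qed
qed

text \<open>Weighting by w (1 + cos), which is nonnegative, and projecting to coordinate
  \<open>i\<close> gives a measure on the line. The product formula for cosines expresses its cosine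
  integrals by the assumed ones, so the two projections coincide and may be tested against
  \<open>indicator B\<close>.\<close>

lemma cos_integral_eq_imp_indicator:
  fixes N1 N2 :: "('i \<Rightarrow> real) measure"
  assumes fin: "finite_measure N1" "finite_measure N2"
    and sets: "sets N1 = sets (\<Pi>\<^sub>M i\<in>I. borel)" "sets N2 = sets (\<Pi>\<^sub>M i\<in>I. borel)"
    and I: "finite I" "i \<in> I" and B: "B \<in> sets borel"
    and w: "w \<in> borel_measurable (\<Pi>\<^sub>M i\<in>I. borel)" "\<And>x. 0 \<le> w x" "\<And>x. w x \<le> (1 :: real)"
    and eq: "\<And>a \<theta>. (LINT x|N1. w x * cos ((\<Sum>k\<in>I. a k * x k) + \<theta>)) = (LINT x|N2. w x * cos ((\<Sum>k\<in>I. a k * x k) + \<theta>))"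
  shows "(LINT x|N1. (w x * indicator B (x i)) * cos ((\<Sum>k\<in>I. a k * x k) + \<theta>))
       = (LINT x|N2. (w x * indicator B (x i)) * cos ((\<Sum>k\<in>I. a k * x k) + \<theta>))"
proof -
  define e where "e = (\<lambda>u::real. \<lambda>k. if k = i then u else 0)"
  have e: "(\<Sum>k\<in>I. (c * a k + e u k) * x k) = c * (\<Sum>k\<in>I. a k * x k) + u * x i" for c a u and x :: "'i \<Rightarrow> real"
    using I by (simp add: e_def distrib_right sum.distrib sum_distrib_left if_distrib[of "\<lambda>z. z * _"] sum.delta' mult.assoc cong: if_cong)
  define K where "K = (\<lambda>N \<theta>. distr (density N (\<lambda>x. ennreal (w x * (1 + cos ((\<Sum>k\<in>I. a k * x k) + \<theta>))))) borel (\<lambda>x. x i))"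
  note w(1)[measurable]
  have cp: "0 \<le> 1 + cos y" for y :: real using cos_ge_minus_one[of y] by linarith
  have nonneg: "0 \<le> w x * (1 + cos y)" for x y
    using cos_ge_minus_one[of y] by (intro mult_nonneg_nonneg w(2)) linarith
  have fm: "finite_measure (K N \<theta>)" and dens: "(LINT z|K N \<theta>. g z) = (LINT x|N. w x * (1 + cos ((\<Sum>k\<in>I. a k * x k) + \<theta>)) * g (x i))"
    and intg: "integrable N (\<lambda>x. w x * cos ((\<Sum>k\<in>I. b k * x k) + \<theta>))"
    if N: "finite_measure N" "sets N = sets (\<Pi>\<^sub>M i\<in>I. borel)" and g: "g \<in> borel_measurable borel" for N \<theta> b and g :: "real \<Rightarrow> real"
  proof -
    interpret N: finite_measure N by fact
    note [measurable_cong] = N(2)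
    have [measurable]: "(\<lambda>x. x k) \<in> borel_measurable N" if "k \<in> I" for k
      unfolding measurable_cong_sets[OF N(2) refl] by (rule measurable_component_singleton[OF that])
    have [measurable]: "(\<lambda>x. x i) \<in> borel_measurable N" using I by measurable
    have [measurable]: "(\<lambda>x. \<Sum>k\<in>I. b k * x k) \<in> borel_measurable N" for b
      by (intro borel_measurable_sum borel_measurable_times) auto
    have le2: "w x * (1 + cos y) \<le> 2" for x y
      using mult_mono[of "w x" 1 "1 + cos y" 2] w(2,3)[of x] cp[of y] by simp
    have "integrable N (\<lambda>x. w x * (1 + cos ((\<Sum>k\<in>I. a k * x k) + \<theta>)))"
      by (intro N.integrable_const_bound[of _ 2]) (auto simp: nonneg le2)
    then have "(\<integral>\<^sup>+x. ennreal (w x * (1 + cos ((\<Sum>k\<in>I. a k * x k) + \<theta>))) \<partial>N) < \<infinity>"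
      by (simp add: integrable_iff_bounded nonneg)
    then have "finite_measure (density N (\<lambda>x. ennreal (w x * (1 + cos ((\<Sum>k\<in>I. a k * x k) + \<theta>)))))"
      by (intro finite_measureI) (simp add: emeasure_density)
    then show "finite_measure (K N \<theta>)" unfolding K_def by (rule finite_measure.finite_measure_distr) simp
    show "(LINT z|K N \<theta>. g z) = (LINT x|N. w x * (1 + cos ((\<Sum>k\<in>I. a k * x k) + \<theta>)) * g (x i))"
      unfolding K_def using g by (subst integral_distr) (auto simp: integral_density nonneg)
    have "\<bar>w x * cos y\<bar> \<le> 1" for x y
      using w(2,3)[of x] abs_cos_le_one[of y] mult_mono[of "\<bar>w x\<bar>" 1 "\<bar>cos y\<bar>" 1] by (simp add: abs_mult)
    then show "integrable N (\<lambda>x. w x * cos ((\<Sum>k\<in>I. b k * x k) + \<theta>))"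
      by (intro N.integrable_const_bound[of _ 1]) auto
  qed
  have expand: "(LINT z|K N \<theta>. cos (u * z + \<phi>))
      = (LINT x|N. w x * cos ((\<Sum>k\<in>I. (0 * a k + e u k) * x k) + \<phi>))
        + (LINT x|N. w x * cos ((\<Sum>k\<in>I. (1 * a k + e u k) * x k) + (\<theta> + \<phi>))) / 2
        + (LINT x|N. w x * cos ((\<Sum>k\<in>I. (1 * a k + e (- u) k) * x k) + (\<theta> - \<phi>))) / 2"
    if N: "finite_measure N" "sets N = sets (\<Pi>\<^sub>M i\<in>I. borel)" for N \<theta> u \<phi>
  proof -
    have pr: "w x * (1 + cos (s + \<theta>)) * cos (u * z + \<phi>) = w x * cos (u * z + \<phi>)
        + w x * cos (s + u * z + (\<theta> + \<phi>)) / 2 + w x * cos (s - u * z + (\<theta> - \<phi>)) / 2" for x s z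
    proof -
      have "cos (s + \<theta>) * cos (u * z + \<phi>) = (cos ((s + \<theta>) - (u * z + \<phi>)) + cos ((s + \<theta>) + (u * z + \<phi>))) / 2"
        by (rule cos_times_cos)
      moreover have "(s + \<theta>) - (u * z + \<phi>) = s - u * z + (\<theta> - \<phi>)" "(s + \<theta>) + (u * z + \<phi>) = s + u * z + (\<theta> + \<phi>)" by simp_all
      ultimately have "cos (s + \<theta>) * cos (u * z + \<phi>) = (cos (s - u * z + (\<theta> - \<phi>)) + cos (s + u * z + (\<theta> + \<phi>))) / 2" by simp
      then show ?thesis by (simp add: algebra_simps add_divide_distrib)
    qed
    note i = intg[OF N borel_measurable_const]
    have sum3: "(LINT x|N. f x + g x / 2 + k x / 2) = (LINT x|N. f x) + (LINT x|N. g x) / 2 + (LINT x|N. k x) / 2"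
      if "integrable N f" "integrable N g" "integrable N k" for f g k :: "('i \<Rightarrow> real) \<Rightarrow> real"
      using that by simp
    have "(LINT z|K N \<theta>. cos (u * z + \<phi>)) = (LINT x|N. w x * cos ((\<Sum>k\<in>I. (0 * a k + e u k) * x k) + \<phi>)
        + w x * cos ((\<Sum>k\<in>I. (1 * a k + e u k) * x k) + (\<theta> + \<phi>)) / 2
        + w x * cos ((\<Sum>k\<in>I. (1 * a k + e (- u) k) * x k) + (\<theta> - \<phi>)) / 2)"
      unfolding e by (subst dens[OF N]) (auto simp: pr)
    also have "\<dots> = (LINT x|N. w x * cos ((\<Sum>k\<in>I. (0 * a k + e u k) * x k) + \<phi>))
        + (LINT x|N. w x * cos ((\<Sum>k\<in>I. (1 * a k + e u k) * x k) + (\<theta> + \<phi>))) / 2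
        + (LINT x|N. w x * cos ((\<Sum>k\<in>I. (1 * a k + e (- u) k) * x k) + (\<theta> - \<phi>))) / 2"
      by (intro sum3 i)
    finally show ?thesis .
  qed
  have KK: "K N1 \<theta> = K N2 \<theta>" for \<theta>
    using fin sets by (intro finite_measure_eqI_cos fm[of _ "\<lambda>_. 0"]) (simp_all only: expand eq, simp_all add: K_def)
  have ind: "(LINT x|N1. w x * (1 + cos ((\<Sum>k\<in>I. a k * x k) + \<theta>)) * indicator B (x i))
      = (LINT x|N2. w x * (1 + cos ((\<Sum>k\<in>I. a k * x k) + \<theta>)) * indicator B (x i))" for \<theta>
    using dens[OF fin(1) sets(1), of "indicator B" \<theta>] dens[OF fin(2) sets(2), of "indicator B" \<theta>] B KK[of \<theta>] by simp
  \<comment> \<open>The shift of the phase by pi flips the cosine, so the difference removes the 1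
    that was added for positivity.\<close>
  have diff: "2 * (LINT x|N. (w x * indicator B (x i)) * cos ((\<Sum>k\<in>I. a k * x k) + \<theta>))
      = (LINT x|N. w x * (1 + cos ((\<Sum>k\<in>I. a k * x k) + \<theta>)) * indicator B (x i))
        - (LINT x|N. w x * (1 + cos ((\<Sum>k\<in>I. a k * x k) + (\<theta> + pi))) * indicator B (x i))"
    if N: "finite_measure N" "sets N = sets (\<Pi>\<^sub>M i\<in>I. borel)" for N
  proof -
    interpret N: finite_measure N by fact
    note [measurable_cong] = N(2)
    have [measurable]: "(\<lambda>x. x k) \<in> borel_measurable N" if "k \<in> I" for k
      unfolding measurable_cong_sets[OF N(2) refl] by (rule measurable_component_singleton[OF that])
    have [measurable]: "(\<lambda>x. x i) \<in> borel_measurable N" using I by measurable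
    have [measurable]: "(\<lambda>x. \<Sum>k\<in>I. b k * x k) \<in> borel_measurable N" for b
      by (intro borel_measurable_sum borel_measurable_times) auto
    note B[measurable]
    have le2: "w x * (1 + cos y) \<le> 2" for x y
      using mult_mono[of "w x" 1 "1 + cos y" 2] w(2,3)[of x] cp[of y] by simp
    have int: "integrable N (\<lambda>x. w x * (1 + cos ((\<Sum>k\<in>I. a k * x k) + \<theta>)) * indicator B (x i))" for \<theta>
      by (intro N.integrable_const_bound[of _ 2]) (auto simp: nonneg le2 indicator_def)
    have flip: "cos (y + (\<theta> + pi)) = - cos (y + \<theta>)" for y
      by (simp only: add.assoc[symmetric] cos_periodic_pi)
    have "(v * b) * c * 2 = v * (1 + c) * b - v * (1 + - c) * b" for v b c :: real
      by (simp add: algebra_simps)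
    then have "(LINT x|N. ((w x * indicator B (x i)) * cos ((\<Sum>k\<in>I. a k * x k) + \<theta>)) * 2)
      = (LINT x|N. w x * (1 + cos ((\<Sum>k\<in>I. a k * x k) + \<theta>)) * indicator B (x i)
        - w x * (1 + cos ((\<Sum>k\<in>I. a k * x k) + (\<theta> + pi))) * indicator B (x i))"
      unfolding flip by (simp only:)
    also have "\<dots> = (LINT x|N. w x * (1 + cos ((\<Sum>k\<in>I. a k * x k) + \<theta>)) * indicator B (x i))
        - (LINT x|N. w x * (1 + cos ((\<Sum>k\<in>I. a k * x k) + (\<theta> + pi))) * indicator B (x i))"
      by (rule Bochner_Integration.integral_diff[OF int int])
    finally show ?thesis by (simp only: integral_mult_left_zero mult.commute[of 2])
  qed
  show ?thesis using diff[OF fin(1) sets(1)] diff[OF fin(2) sets(2)] ind by simp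
qed

text \<open>The Cramer--Wold theorem, by one-dimensional uniqueness applied to one coordinate at a time.\<close>
lemma finite_measure_PiM_eqI_cos:
  fixes N1 N2 :: "('i \<Rightarrow> real) measure"
  assumes fin: "finite_measure N1" "finite_measure N2"
    and sets: "sets N1 = sets (\<Pi>\<^sub>M i\<in>I. borel)" "sets N2 = sets (\<Pi>\<^sub>M i\<in>I. borel)"
    and I: "finite I"
    and eq: "\<And>a \<theta>. (LINT x|N1. cos ((\<Sum>k\<in>I. a k * x k) + \<theta>)) = (LINT x|N2. cos ((\<Sum>k\<in>I. a k * x k) + \<theta>))"
  shows "N1 = N2"
proof (rule measure_eqI_PiM_finite[OF I sets])
  interpret N1: finite_measure N1 by fact
  interpret N2: finite_measure N2 by fact
  fix A assume A: "\<And>i. i \<in> I \<Longrightarrow> A i \<in> sets (borel :: real measure)"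
  have step: "(LINT x|N1. (\<Prod>i\<in>J. indicator (A i) (x i)) * cos ((\<Sum>k\<in>I. a k * x k) + \<theta>))
      = (LINT x|N2. (\<Prod>i\<in>J. indicator (A i) (x i)) * cos ((\<Sum>k\<in>I. a k * x k) + \<theta>))" if "J \<subseteq> I" for J a \<theta>
    using finite_subset[OF that I] that
  proof (induction J arbitrary: a \<theta> rule: finite_induct)
    case empty
    then show ?case using eq by simp
  next
    case (insert j J)
    have "(LINT x|N1. ((\<Prod>i\<in>J. indicator (A i) (x i)) * indicator (A j) (x j)) * cos ((\<Sum>k\<in>I. a k * x k) + \<theta>))
      = (LINT x|N2. ((\<Prod>i\<in>J. indicator (A i) (x i)) * indicator (A j) (x j)) * cos ((\<Sum>k\<in>I. a k * x k) + \<theta>))"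
    proof (rule cos_integral_eq_imp_indicator[OF fin sets I])
      show "(\<lambda>x. \<Prod>i\<in>J. indicator (A i) (x i) :: real) \<in> borel_measurable (\<Pi>\<^sub>M i\<in>I. borel)"
        using insert.prems A by (intro borel_measurable_prod) (auto intro!: measurable_compose[OF measurable_component_singleton] borel_measurable_indicator)
    qed (use insert A in \<open>auto intro!: prod_nonneg prod_le_1\<close>)
    then show ?case using insert.hyps by (simp add: mult.commute)
  qed
  \<comment> \<open>With zero coefficients and zero phase only the indicator of the box is
    left.\<close>
  have meas: "emeasure N (Pi\<^sub>E I A) = ennreal (LINT x|N. (\<Prod>i\<in>I. indicator (A i) (x i)) * cos ((\<Sum>k\<in>I. 0 * x k) + 0))"
    if N: "finite_measure N" "sets N = sets (\<Pi>\<^sub>M i\<in>I. borel)" for N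
  proof -
    interpret N: finite_measure N by fact
    have "Pi\<^sub>E I A \<in> sets N" unfolding N(2) using A I by (intro sets_PiM_I_finite) auto
    moreover have "(\<Prod>i\<in>I. indicator (A i) (x i)) = (indicator (Pi\<^sub>E I A) x :: real)" if "x \<in> space N" for x
    proof -
      have "x \<in> extensional I" using that sets_eq_imp_space_eq[OF N(2)] by (auto simp: space_PiM PiE_def)
      then show ?thesis using I by (auto simp: indicator_def PiE_def prod_zero_iff intro!: prod.neutral)
    qed
    then have "(LINT x|N. (\<Prod>i\<in>I. indicator (A i) (x i)) * cos ((\<Sum>k\<in>I. 0 * x k) + 0)) = (LINT x|N. indicator (Pi\<^sub>E I A) x)"
      by (intro Bochner_Integration.integral_cong) auto
    ultimately show ?thesis by (simp add: N.emeasure_eq_measure)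
  qed
  show "emeasure N1 (Pi\<^sub>E I A) = emeasure N2 (Pi\<^sub>E I A)"
    unfolding meas[OF fin(1) sets(1)] meas[OF fin(2) sets(2)] using step[OF subset_refl, of "\<lambda>_. 0" 0] by (simp only:)
next
  interpret N1: finite_measure N1 by fact
  show "range (\<lambda>_::nat. Pi\<^sub>E I (\<lambda>_. UNIV :: real set)) \<subseteq> prod_algebra I (\<lambda>_. borel)"
    using I by (auto intro!: prod_algebraI_finite)
  show "(\<Union>i::nat. Pi\<^sub>E I (\<lambda>_. UNIV :: real set)) = space (\<Pi>\<^sub>M i\<in>I. borel)"
    by (simp add: space_PiM)
  show "emeasure N1 (Pi\<^sub>E I (\<lambda>_. UNIV)) \<noteq> \<infinity>" by simp
qed

text \<open>Cholesky factorization by one elimination step per index, applied to the Schur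
  complement \<open>S'\<close>. The matrix may be singular: a vanishing pivot forces its column to
  vanish, and with x / 0 = 0 the formulas remain correct.\<close>

lemma gram_factorization:
  fixes S :: "'i \<Rightarrow> 'i \<Rightarrow> real"
  assumes "finite I" "\<And>j k. j \<in> I \<Longrightarrow> k \<in> I \<Longrightarrow> S j k = S k j"
    and "\<And>c. 0 \<le> (\<Sum>j\<in>I. \<Sum>k\<in>I. c j * c k * S j k)"
  shows "\<exists>L :: 'i \<Rightarrow> 'i \<Rightarrow> real. \<forall>j\<in>I. \<forall>k\<in>I. S j k = (\<Sum>i\<in>I. L j i * L k i)"
  using assms
proof (induction I arbitrary: S rule: finite_induct)
  case empty
  then show ?case by simp
next
  case (insert x I)
  have sym: "S j k = S k j" if "j \<in> insert x I" "k \<in> insert x I" for j k using insert.prems(1) that by blast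
  have form: "(\<Sum>j\<in>insert x I. \<Sum>k\<in>insert x I. c j * c k * S j k)
      = (c x)\<^sup>2 * S x x + 2 * c x * (\<Sum>j\<in>I. c j * S j x) + (\<Sum>j\<in>I. \<Sum>k\<in>I. c j * c k * S j k)" for c
  proof -
    have "(\<Sum>k\<in>I. c x * c k * S x k) = c x * (\<Sum>j\<in>I. c j * S j x)"
      unfolding sum_distrib_left using sym by (intro sum.cong) (auto simp: ac_simps)
    moreover have "(\<Sum>j\<in>I. c j * c x * S j x) = c x * (\<Sum>j\<in>I. c j * S j x)"
      unfolding sum_distrib_left by (intro sum.cong) (auto simp: ac_simps)
    ultimately show ?thesis
      using insert.hyps by (simp add: sum.distrib power2_eq_square)
  qed
  have xx: "0 \<le> S x x"
    using insert.prems(2)[of "\<lambda>j. if j = x then 1 else 0"] insert.hyps unfolding form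
    by (simp add: sum.neutral if_distrib cong: if_cong)
  define S' where "S' = (\<lambda>j k. S j k - S j x * S k x / S x x)"
  \<comment> \<open>With a zero pivot the form is affine in the coefficient \<open>t\<close> of
    \<open>x\<close>, and an affine function bounded below has slope 0; the value of
    \<open>t\<close> chosen below would make it equal to - 1.\<close>
  have zero: "S j x = 0" if "S x x = 0" "j \<in> I" for j
  proof (rule ccontr)
    assume nz: "S j x \<noteq> 0"
    define c where "c = (\<lambda>t k. if k = x then t else if k = j then 1 else (0::real))"
    have jx: "j \<noteq> x" using that insert.hyps by auto
    have e1: "(\<Sum>i\<in>I. c t i * S i x) = S j x" for t
      using that insert.hyps jx by (subst sum.remove[of _ j]) (auto simp: c_def intro!: sum.neutral split: if_splits)
    have e2: "(\<Sum>i\<in>I. \<Sum>k\<in>I. c t i * c t k * S i k) = (\<Sum>i\<in>I. \<Sum>k\<in>I. c 0 i * c 0 k * S i k)" for t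
      using insert.hyps by (intro sum.cong refl) (auto simp: c_def)
    have "c t x = t" for t by (simp add: c_def)
    then have "0 \<le> 2 * t * S j x + (\<Sum>i\<in>I. \<Sum>k\<in>I. c 0 i * c 0 k * S i k)" for t
      using insert.prems(2)[of "c t"] that(1) unfolding form e1 by (subst (asm) e2) simp
    moreover define Z where "Z = (\<Sum>i\<in>I. \<Sum>k\<in>I. c 0 i * c 0 k * S i k)"
    ultimately have "0 \<le> 2 * (- (Z + 1) / (2 * S j x)) * S j x + Z" by blast
    moreover have "2 * (- (Z + 1) / (2 * S j x)) * S j x = - (Z + 1)" using nz by simp
    ultimately show False by linarith
  qed
  have "\<exists>L. \<forall>j\<in>I. \<forall>k\<in>I. S' j k = (\<Sum>i\<in>I. L j i * L k i)"
  proof (rule insert.IH)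
    show "S' j k = S' k j" if "j \<in> I" "k \<in> I" for j k using sym that by (simp add: S'_def)
    fix c :: "'i \<Rightarrow> real"
    define b where "b = (\<Sum>j\<in>I. c j * S j x)"
    have "(\<Sum>j\<in>I. \<Sum>k\<in>I. c j * c k * S' j k) = (\<Sum>j\<in>I. \<Sum>k\<in>I. c j * c k * S j k) - b\<^sup>2 / S x x"
      unfolding S'_def b_def power2_eq_square sum_product
      by (simp add: sum_subtractf right_diff_distrib sum_divide_distrib ac_simps)
    moreover have "0 \<le> (\<Sum>j\<in>I. \<Sum>k\<in>I. c j * c k * S j k) - b\<^sup>2 / S x x"
    proof -
      \<comment> \<open>The coefficient at \<open>x\<close> that minimises the form; the minimum is
        the form of the Schur complement.\<close>
      define c' where "c' = c(x := - b / S x x)"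
      have "(\<Sum>j\<in>I. c' j * S j x) = b" "(\<Sum>j\<in>I. \<Sum>k\<in>I. c' j * c' k * S j k) = (\<Sum>j\<in>I. \<Sum>k\<in>I. c j * c k * S j k)"
        unfolding b_def using insert.hyps by (auto simp: c'_def intro!: sum.cong)
      then have "0 \<le> (- b / S x x)\<^sup>2 * S x x + 2 * (- b / S x x) * b + (\<Sum>j\<in>I. \<Sum>k\<in>I. c j * c k * S j k)"
        using insert.prems(2)[of c'] unfolding form by (simp add: c'_def)
      then show ?thesis by (cases "S x x = 0") (simp_all add: power2_eq_square field_simps)
    qed
    ultimately show "0 \<le> (\<Sum>j\<in>I. \<Sum>k\<in>I. c j * c k * S' j k)" by simp
  qed
  then obtain L where L: "\<And>j k. j \<in> I \<Longrightarrow> k \<in> I \<Longrightarrow> S' j k = (\<Sum>i\<in>I. L j i * L k i)" by blast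
  define L' where "L' = (\<lambda>j i. if i = x then S j x / sqrt (S x x) else if j = x then 0 else L j i)"
  have sq: "a / sqrt (S x x) * (b / sqrt (S x x)) = a * b / S x x" for a b
    using xx by simp
  have LI: "(\<Sum>i\<in>I. L' j i * L' k i) = (if j = x \<or> k = x then 0 else (\<Sum>i\<in>I. L j i * L k i))" for j k
    using insert.hyps by (auto simp: L'_def intro!: sum.neutral sum.cong)
  have "S j k = (\<Sum>i\<in>insert x I. L' j i * L' k i)" if jk: "j \<in> insert x I" "k \<in> insert x I" for j k
  proof -
    have "(\<Sum>i\<in>insert x I. L' j i * L' k i) = L' j x * L' k x + (\<Sum>i\<in>I. L' j i * L' k i)"
      using insert.hyps by simp
    also have "L' j x * L' k x = S j x * S k x / S x x"
      by (simp only: L'_def refl if_True sq)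
    also have "(\<Sum>i\<in>I. L' j i * L' k i) = (if j = x \<or> k = x then 0 else S' j k)"
      unfolding LI using jk L[of j k] by auto
    also have "S j x * S k x / S x x + (if j = x \<or> k = x then 0 else S' j k) = S j k"
    proof (cases "j = x \<or> k = x")
      case True
      then show ?thesis using sym[of x k] zero jk by (cases "S x x = 0") auto
    next
      case False
      then show ?thesis by (simp add: S'_def)
    qed
    finally show ?thesis by simp
  qed
  then show ?case by blast
qed

section \<open>The cost of shrinking coordinates of a standard Gaussian vector\<close>

lemma product_std_normal: "product_prob_space (\<lambda>_. std_normal_distribution)"
proof -
  interpret S: prob_space std_normal_distribution by (rule prob_space_normal_density) simp
  show ?thesis ..
qed

text \<open>The law of s X has density (1 / s) \<phi>(x / s), where \<phi> is the standard normal
  density, and for s \<le> 1 this is at most (1 / s) \<phi>(x).\<close>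

lemma std_normal_scale_nn_integral:
  fixes s :: real
  assumes s: "0 < s" "s \<le> 1" and g: "g \<in> borel_measurable borel"
  shows "(\<integral>\<^sup>+x. g (s * x) \<partial>std_normal_distribution) \<le> ennreal (1 / s) * (\<integral>\<^sup>+x. g x \<partial>std_normal_distribution)"
proof -
  note g[measurable]
  have "(\<integral>\<^sup>+x. g x \<partial>std_normal_distribution) = (\<integral>\<^sup>+x. ennreal (std_normal_density x) * g x \<partial>lborel)"
    by (intro nn_integral_density) auto
  also have "\<dots> = ennreal s * (\<integral>\<^sup>+x. ennreal (std_normal_density (0 + s * x)) * g (0 + s * x) \<partial>lborel)"
    using s by (subst nn_integral_real_affine[where c = s and t = 0]) auto
  also have "\<dots> \<ge> ennreal s * (\<integral>\<^sup>+x. ennreal (std_normal_density x) * g (s * x) \<partial>lborel)"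
  proof (intro mult_left_mono nn_integral_mono)
    fix x :: real
    have "(s * x)\<^sup>2 \<le> 1 * x\<^sup>2" unfolding power_mult_distrib using s by (intro mult_right_mono) (auto simp: power_le_one)
    then have "std_normal_density x \<le> std_normal_density (0 + s * x)"
      by (simp add: std_normal_density_def divide_right_mono)
    then show "ennreal (std_normal_density x) * g (s * x) \<le> ennreal (std_normal_density (0 + s * x)) * g (0 + s * x)"
      by (auto intro!: mult_right_mono ennreal_leI)
  qed auto
  also have "(\<integral>\<^sup>+x. ennreal (std_normal_density x) * g (s * x) \<partial>lborel) = (\<integral>\<^sup>+x. g (s * x) \<partial>std_normal_distribution)"
    by (intro nn_integral_density[symmetric]) auto
  finally have "ennreal (1 / s) * (ennreal s * (\<integral>\<^sup>+x. g (s * x) \<partial>std_normal_distribution)) \<le> ennreal (1 / s) * (\<integral>\<^sup>+x. g x \<partial>std_normal_distribution)"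
    by (intro mult_left_mono) auto
  moreover have "ennreal (1 / s) * ennreal s = 1" using s by (simp add: ennreal_mult[symmetric])
  ultimately show ?thesis by (simp add: mult.assoc[symmetric])
qed

lemma PiM_std_normal_scale:
  fixes s :: "'i \<Rightarrow> real"
  assumes "finite J" "\<And>i. i \<in> J \<Longrightarrow> 0 < s i \<and> s i \<le> 1" "g \<in> borel_measurable (\<Pi>\<^sub>M i\<in>J. borel :: real measure)"
  shows "(\<integral>\<^sup>+u. g (\<lambda>i\<in>J. s i * u i) \<partial>(\<Pi>\<^sub>M i\<in>J. std_normal_distribution))
       \<le> ennreal (\<Prod>i\<in>J. 1 / s i) * (\<integral>\<^sup>+u. g u \<partial>(\<Pi>\<^sub>M i\<in>J. std_normal_distribution))"
  using assms
proof (induction J arbitrary: g rule: finite_induct)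
  case empty
  have *: "(\<lambda>i\<in>{}. s i * u i) = u" if "u \<in> space (\<Pi>\<^sub>M i\<in>{}. std_normal_distribution)" for u :: "'i \<Rightarrow> real"
    using that by (auto simp: space_PiM)
  have "(\<integral>\<^sup>+u. g (\<lambda>i\<in>{}. s i * u i) \<partial>(\<Pi>\<^sub>M i\<in>{}. std_normal_distribution))
      = (\<integral>\<^sup>+u. g u \<partial>(\<Pi>\<^sub>M i\<in>{}. std_normal_distribution))"
    by (rule nn_integral_cong) (subst *, assumption, rule refl)
  then show ?case by (simp only: prod.empty ennreal_1 mult_1 order.refl)
next
  case (insert i J)
  interpret product_prob_space "\<lambda>_::'i. std_normal_distribution" UNIV by (rule product_std_normal)
  interpret S: prob_space std_normal_distribution by (rule prob_space_normal_density) simp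
  let ?P = "\<lambda>J. \<Pi>\<^sub>M i\<in>J. std_normal_distribution"
  have sets: "sets (?P J) = sets (\<Pi>\<^sub>M i\<in>J. borel)" for J by (intro sets_PiM_cong) auto
  note g[measurable] = insert.prems(2)
  have gP: "g \<in> borel_measurable (?P (insert i J))"
    using g by (simp add: measurable_cong_sets[OF sets refl])
  have upd: "(\<lambda>p. (fst p)(i := snd p)) \<in> measurable ((\<Pi>\<^sub>M i\<in>J. borel) \<Otimes>\<^sub>M borel) (\<Pi>\<^sub>M i\<in>insert i J. borel :: real measure)"
    using measurable_add_dim[of i J "\<lambda>_. borel"] by (simp add: split_beta')
  define G where "G = (\<lambda>v. \<integral>\<^sup>+y. g (v(i := y)) \<partial>std_normal_distribution)"
  have G: "G \<in> borel_measurable (\<Pi>\<^sub>M i\<in>J. borel)"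
  proof -
    have "(\<lambda>p. g ((fst p)(i := snd p))) \<in> borel_measurable ((\<Pi>\<^sub>M i\<in>J. borel) \<Otimes>\<^sub>M std_normal_distribution)"
      using measurable_compose[OF upd g] by (simp add: measurable_cong_sets[OF sets_pair_measure_cong[OF refl, of std_normal_distribution borel] refl])
    then show ?thesis unfolding G_def by (intro sigma_finite_measure.borel_measurable_nn_integral[OF prob_space_imp_sigma_finite[OF prob_space_normal_density[of 1 0, OF zero_less_one]]]) (simp add: split_beta')
  qed
  have r: "(\<lambda>k\<in>insert i J. s k * (u(i := y)) k) = (\<lambda>k\<in>J. s k * u k)(i := s i * y)" for u y
    using insert.hyps by (auto simp: fun_eq_iff)
  have sc: "(\<lambda>u. \<lambda>k\<in>J. s k * u k) \<in> measurable (\<Pi>\<^sub>M i\<in>J. borel) (\<Pi>\<^sub>M i\<in>J. borel)" for J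
    by (intro measurable_restrict borel_measurable_times borel_measurable_const measurable_component_singleton)
  have "(\<integral>\<^sup>+u. g (\<lambda>k\<in>insert i J. s k * u k) \<partial>?P (insert i J))
      = (\<integral>\<^sup>+u. \<integral>\<^sup>+y. g (\<lambda>k\<in>insert i J. s k * (u(i := y)) k) \<partial>std_normal_distribution \<partial>?P J)"
    using insert.hyps measurable_compose[OF sc g]
    by (intro product_nn_integral_insert) (auto simp: measurable_cong_sets[OF sets refl])
  also have "\<dots> = (\<integral>\<^sup>+u. \<integral>\<^sup>+y. g ((\<lambda>k\<in>J. s k * u k)(i := s i * y)) \<partial>std_normal_distribution \<partial>?P J)"
    unfolding r ..
  also have "\<dots> \<le> (\<integral>\<^sup>+u. ennreal (1 / s i) * G (\<lambda>k\<in>J. s k * u k) \<partial>?P J)"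
    unfolding G_def
  proof (intro nn_integral_mono std_normal_scale_nn_integral)
    show "0 < s i" "s i \<le> 1" using insert.prems by auto
    fix u :: "'i \<Rightarrow> real"
    have "(\<lambda>k\<in>J. s k * u k) \<in> space (\<Pi>\<^sub>M i\<in>J. borel :: real measure)" by (simp add: space_PiM)
    from measurable_compose[OF measurable_Pair1'[OF this] measurable_compose[OF upd g]]
    show "(\<lambda>y. g ((\<lambda>k\<in>J. s k * u k)(i := y))) \<in> borel_measurable borel" by simp
  qed
  also have "\<dots> = ennreal (1 / s i) * (\<integral>\<^sup>+u. G (\<lambda>k\<in>J. s k * u k) \<partial>?P J)"
    using measurable_compose[OF sc G] by (intro nn_integral_cmult) (simp add: measurable_cong_sets[OF sets refl])
  also have "\<dots> \<le> ennreal (1 / s i) * (ennreal (\<Prod>i\<in>J. 1 / s i) * (\<integral>\<^sup>+u. G u \<partial>?P J))"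
    using insert.prems by (intro mult_left_mono insert.IH G) auto
  also have "(\<integral>\<^sup>+u. G u \<partial>?P J) = (\<integral>\<^sup>+u. g u \<partial>?P (insert i J))"
    unfolding G_def using insert.hyps gP by (intro product_nn_integral_insert[symmetric]) auto
  also have "ennreal (1 / s i) * (ennreal (\<Prod>i\<in>J. 1 / s i) * (\<integral>\<^sup>+u. g u \<partial>?P (insert i J)))
      = ennreal (\<Prod>i\<in>insert i J. 1 / s i) * (\<integral>\<^sup>+u. g u \<partial>?P (insert i J))"
  proof -
    have "ennreal (1 / s i * (\<Prod>i\<in>J. 1 / s i)) = ennreal (1 / s i) * ennreal (\<Prod>i\<in>J. 1 / s i)"
      using insert.prems by (intro ennreal_mult prod_nonneg) (auto intro: less_imp_le)
    then show ?thesis unfolding prod.insert[OF insert.hyps] by (simp only: mult.assoc)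
  qed
  finally show ?case .
qed

subsection \<open>Measurability of the zero count\<close>

lemma finite_set_separated:
  fixes S :: "real set"
  assumes "finite S"
  obtains d where "d > 0" "\<And>a b. a \<in> S \<Longrightarrow> b \<in> S \<Longrightarrow> a \<noteq> b \<Longrightarrow> d \<le> \<bar>a - b\<bar>"
proof -
  define D where "D = insert 1 ((\<lambda>(a, b). \<bar>a - b\<bar>) ` {(a, b) \<in> S \<times> S. a \<noteq> b})"
  have D: "finite D" "D \<noteq> {}"
    using finite_subset[of "{(a, b) \<in> S \<times> S. a \<noteq> b}" "S \<times> S"] assms by (auto simp: D_def)
  show thesis
  proof (rule that[of "Min D"])
    show "Min D > 0" using D by (auto simp: D_def)
    show "Min D \<le> \<bar>a - b\<bar>" if "a \<in> S" "b \<in> S" "a \<noteq> b" for a b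
      using D that by (intro Min_le) (auto simp: D_def intro!: image_eqI[of _ _ "(a, b)"])
  qed
qed

text \<open>By compactness a zero exists iff |F| takes arbitrarily small values, which can be tested
  at countably many points. Rationals are clamped into the interval rather than intersected with it,
  so that an interval consisting of one irrational point is covered too.\<close>

lemma zero_in_interval_measurable:
  assumes F: "\<And>t. F t \<in> borel_measurable M"
    and cont: "\<And>\<omega>. \<omega> \<in> space M \<Longrightarrow> continuous_on UNIV (\<lambda>t::real. F t \<omega> :: real)"
  shows "{\<omega>\<in>space M. \<exists>t\<in>{u..v}. F t \<omega> = 0} \<in> sets M"
proof (cases "u \<le> v")
  case True
  define c where "c = (\<lambda>q. max u (min v q))"
  have c: "c q \<in> {u..v}" for q using True by (auto simp: c_def)
  have "{\<omega>\<in>space M. \<exists>t\<in>{u..v}. F t \<omega> = 0} = {\<omega>\<in>space M. \<forall>k::nat. \<exists>q\<in>\<rat>. \<bar>F (c q) \<omega>\<bar> < 1 / Suc k}"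
  proof (intro Collect_cong conj_cong refl iffI)
    fix \<omega> assume \<omega>: "\<omega> \<in> space M"
    have cF: "continuous_on UNIV (\<lambda>q. \<bar>F (c q) \<omega>\<bar>)"
      unfolding c_def by (intro continuous_intros continuous_on_compose2[OF cont[OF \<omega>]]) auto
    {
      assume "\<exists>t\<in>{u..v}. F t \<omega> = 0"
      then obtain t where t: "t \<in> {u..v}" "F t \<omega> = 0" by blast
      show "\<forall>k::nat. \<exists>q\<in>\<rat>. \<bar>F (c q) \<omega>\<bar> < 1 / Suc k"
      proof
        fix k :: nat
        have "open {q. \<bar>F (c q) \<omega>\<bar> < 1 / Suc k}" using cF by (intro open_Collect_less) auto
        moreover have "t \<in> {q. \<bar>F (c q) \<omega>\<bar> < 1 / Suc k}" using t by (simp add: c_def)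
        ultimately have "\<rat> \<inter> {q. \<bar>F (c q) \<omega>\<bar> < 1 / Suc k} \<noteq> {}"
          using Rats_closure_real open_Int_closure_eq_empty[of "{q. \<bar>F (c q) \<omega>\<bar> < 1 / Suc k}" \<rat>] by auto
        then show "\<exists>q\<in>\<rat>. \<bar>F (c q) \<omega>\<bar> < 1 / Suc k" by blast
      qed
    }
    {
      assume q: "\<forall>k::nat. \<exists>q\<in>\<rat>. \<bar>F (c q) \<omega>\<bar> < 1 / Suc k"
      have "continuous_on {u..v} (\<lambda>t. \<bar>F t \<omega>\<bar>)"
        by (intro continuous_intros continuous_on_subset[OF cont[OF \<omega>]]) auto
      then obtain t where t: "t \<in> {u..v}" "\<And>r. r \<in> {u..v} \<Longrightarrow> \<bar>F t \<omega>\<bar> \<le> \<bar>F r \<omega>\<bar>"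
        using continuous_attains_inf[of "{u..v}" "\<lambda>t. \<bar>F t \<omega>\<bar>"] True by auto
      have "F t \<omega> = 0"
      proof (rule ccontr)
        assume "F t \<omega> \<noteq> 0"
        then obtain k where "inverse (real (Suc k)) < \<bar>F t \<omega>\<bar>" using reals_Archimedean[of "\<bar>F t \<omega>\<bar>"] by auto
        moreover obtain r where "\<bar>F (c r) \<omega>\<bar> < 1 / Suc k" using q by blast
        ultimately show False using t(2)[OF c[of r]] by (simp add: inverse_eq_divide)
      qed
      then show "\<exists>t\<in>{u..v}. F t \<omega> = 0" using t by blast
    }
  qed
  also have "\<dots> \<in> sets M"
  proof -
    have [measurable]: "F t \<in> borel_measurable M" for t by (rule F)
    have "countable (\<rat> :: real set)" by (rule countable_rat)
    then show ?thesis by measurable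
  qed
  finally show ?thesis .
qed simp

lemma zero_count_ge_iff:
  "zero_count f T \<ge> ereal x \<longleftrightarrow> (\<exists>S. finite S \<and> card S = nat \<lceil>x\<rceil> \<and> S \<subseteq> {0..T} \<and> (\<forall>a\<in>S. f a = 0))"
  (is "?l \<longleftrightarrow> ?r")
proof
  assume ?l
  show ?r
  proof (cases "x \<le> 0")
    case True
    then show ?thesis by (intro exI[of _ "{}"]) auto
  next
    case False
    then have "real (nat \<lceil>x\<rceil>) < x + 1" by linarith
    from zero_count_ge_imp_zeros[OF \<open>?l\<close> this] show ?thesis by metis
  qed
next
  assume ?r
  then obtain S where S: "finite S" "card S = nat \<lceil>x\<rceil>" "S \<subseteq> {t\<in>{0..T}. f t = 0}" by blast
  show ?l
  proof (cases "finite {t\<in>{0..T}. f t = 0}")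
    case True
    have "x \<le> real (nat \<lceil>x\<rceil>)" by linarith
    also have "\<dots> \<le> real (card {t\<in>{0..T}. f t = 0})" using card_mono[OF True S(3)] S(2) by simp
    finally show ?thesis using True by (simp add: zero_count_def Let_def)
  qed (simp add: zero_count_def Let_def)
qed

text \<open>Having at least n zeros means that n disjoint closed rational intervals each contain
  one, and there are countably many such families. Clipping confines the zeros to [0, T]. Lower
  bounds by inclusion of events rely on this, since a non-measurable event would have measure
  0.\<close>

lemma zero_count_measurable:
  assumes F: "\<And>t. F t \<in> borel_measurable M"
    and cont: "\<And>\<omega>. \<omega> \<in> space M \<Longrightarrow> continuous_on UNIV (\<lambda>t::real. F t \<omega> :: real)"
  shows "{\<omega>\<in>space M. zero_count (\<lambda>t. F t \<omega>) T \<ge> ereal x} \<in> sets M"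
proof -
  define n where "n = nat \<lceil>x\<rceil>"
  define R where "R = {C. finite C \<and> C \<subseteq> (\<rat> :: real set) \<times> (\<rat> :: real set)}"
  define R' where "R' = {C\<in>R. card C = n \<and> pairwise (\<lambda>p q. disjnt {fst p..snd p} {fst q..snd q}) C}"
  have "countable R'"
    unfolding R'_def R_def by (rule countable_subset[OF _ countable_Collect_finite_subset[of "\<rat> \<times> \<rat>"]]) (auto simp: countable_rat)
  have eq: "{\<omega>\<in>space M. zero_count (\<lambda>t. F t \<omega>) T \<ge> ereal x}
      = (\<Union>C\<in>R'. {\<omega>\<in>space M. \<forall>p\<in>C. \<omega> \<in> {\<omega>\<in>space M. \<exists>t\<in>{max 0 (fst p)..min T (snd p)}. F t \<omega> = 0}})"
  proof (intro set_eqI iffI)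
    fix \<omega> assume "\<omega> \<in> {\<omega>\<in>space M. zero_count (\<lambda>t. F t \<omega>) T \<ge> ereal x}"
    then obtain S where \<omega>: "\<omega> \<in> space M" and S: "finite S" "card S = n" "S \<subseteq> {0..T}" "\<And>a. a \<in> S \<Longrightarrow> F a \<omega> = 0"
      unfolding zero_count_ge_iff n_def by blast
    obtain d where d: "d > 0" "\<And>a b. a \<in> S \<Longrightarrow> b \<in> S \<Longrightarrow> a \<noteq> b \<Longrightarrow> d \<le> \<bar>a - b\<bar>"
      using finite_set_separated[OF S(1)] by metis
    have "\<exists>p q. p \<in> \<rat> \<and> q \<in> \<rat> \<and> a - d / 2 < p \<and> p < a \<and> a < q \<and> q < a + d / 2" for a
      using Rats_dense_in_real[of "a - d / 2" a] Rats_dense_in_real[of a "a + d / 2"] d(1) by auto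
    then obtain p q where pq: "\<And>a. p a \<in> \<rat> \<and> q a \<in> \<rat> \<and> a - d / 2 < p a \<and> p a < a \<and> a < q a \<and> q a < a + d / 2"
      by metis
    have dis: "disjnt {p a..q a} {p b..q b}" if "a \<in> S" "b \<in> S" "a \<noteq> b" for a b
      using d(2)[OF that] pq[of a] pq[of b] by (auto simp: disjnt_def abs_if split: if_splits)
    define C where "C = (\<lambda>a. (p a, q a)) ` S"
    have inj: "inj_on (\<lambda>a. (p a, q a)) S"
    proof (rule inj_onI, rule ccontr)
      fix a b assume "a \<in> S" "b \<in> S" "(p a, q a) = (p b, q b)" "a \<noteq> b"
      then have "disjnt {p a..q a} {p a..q a}" using dis[of a b] by simp
      then show False using pq[of a] by (auto simp: disjnt_def)
    qed
    have "pairwise (\<lambda>r r'. disjnt {fst r..snd r} {fst r'..snd r'}) C"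
    proof (rule pairwiseI)
      fix r r' assume "r \<in> C" "r' \<in> C" "r \<noteq> r'"
      then obtain a b where "a \<in> S" "b \<in> S" "a \<noteq> b" "r = (p a, q a)" "r' = (p b, q b)" by (auto simp: C_def)
      then show "disjnt {fst r..snd r} {fst r'..snd r'}" using dis[of a b] by simp
    qed
    then have "C \<in> R'"
      unfolding R'_def R_def using S pq by (auto simp: C_def card_image[OF inj])
    moreover have "\<forall>r\<in>C. \<exists>t\<in>{max 0 (fst r)..min T (snd r)}. F t \<omega> = 0"
      unfolding C_def using S pq by (force intro: less_imp_le)
    ultimately show "\<omega> \<in> (\<Union>C\<in>R'. {\<omega>\<in>space M. \<forall>p\<in>C. \<omega> \<in> {\<omega>\<in>space M. \<exists>t\<in>{max 0 (fst p)..min T (snd p)}. F t \<omega> = 0}})"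
      using \<omega> by blast
  next
    fix \<omega> assume "\<omega> \<in> (\<Union>C\<in>R'. {\<omega>\<in>space M. \<forall>p\<in>C. \<omega> \<in> {\<omega>\<in>space M. \<exists>t\<in>{max 0 (fst p)..min T (snd p)}. F t \<omega> = 0}})"
    then obtain C where C: "C \<in> R'" and \<omega>: "\<omega> \<in> space M"
      and "\<forall>p\<in>C. \<exists>t. t \<in> {max 0 (fst p)..min T (snd p)} \<and> F t \<omega> = 0" by blast
    then obtain t where t: "\<And>p. p \<in> C \<Longrightarrow> t p \<in> {max 0 (fst p)..min T (snd p)} \<and> F (t p) \<omega> = 0" by metis
    have "inj_on t C"
    proof (rule inj_onI, rule ccontr)
      fix p q assume "p \<in> C" "q \<in> C" "t p = t q" "p \<noteq> q"
      then show False using C t[of p] t[of q] by (auto simp: R'_def pairwise_def disjnt_iff)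
    qed
    then have "card (t ` C) = n" "finite (t ` C)" using C by (auto simp: card_image R'_def R_def)
    moreover have "t ` C \<subseteq> {0..T}" "\<forall>a\<in>t ` C. F a \<omega> = 0" using t by fastforce+
    ultimately show "\<omega> \<in> {\<omega>\<in>space M. zero_count (\<lambda>t. F t \<omega>) T \<ge> ereal x}"
      using \<omega> unfolding zero_count_ge_iff n_def by blast
  qed
  show ?thesis
    unfolding eq
  proof (intro sets.countable_UN'' \<open>countable R'\<close>)
    fix C assume "C \<in> R'"
    then have "finite C" by (simp add: R'_def R_def)
    then show "{\<omega>\<in>space M. \<forall>p\<in>C. \<omega> \<in> {\<omega>\<in>space M. \<exists>t\<in>{max 0 (fst p)..min T (snd p)}. F t \<omega> = 0}} \<in> sets M"
      using zero_in_interval_measurable[OF F cont]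
      by (intro sets.sets_Collect_finite_All) (auto simp: conj_absorb)
  qed
qed

section \<open>Linear functionals of a standard Gaussian vector\<close>

lemma cos_integral_of_cf:
  fixes Z :: "'a \<Rightarrow> real"
  assumes M: "finite_measure M" and Z: "Z \<in> borel_measurable M" and cf: "(CLINT \<omega>|M. iexp (Z \<omega>)) = complex_of_real r"
  shows "(LINT \<omega>|M. cos (Z \<omega> + \<theta>)) = r * cos \<theta>"
proof -
  interpret finite_measure M by fact
  note Z[measurable]
  have "integrable M (\<lambda>\<omega>. iexp (Z \<omega>))" by (intro integrable_const_bound[of _ 1]) auto
  then have "(LINT \<omega>|M. Re (iexp (Z \<omega>))) = r" "(LINT \<omega>|M. Im (iexp (Z \<omega>))) = 0"
    using cf by simp_all
  then have c: "(LINT \<omega>|M. cos (Z \<omega>)) = r" and s: "(LINT \<omega>|M. sin (Z \<omega>)) = 0"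
    by (simp_all add: Re_exp Im_exp)
  have i: "integrable M (\<lambda>\<omega>. cos (Z \<omega>))" "integrable M (\<lambda>\<omega>. sin (Z \<omega>))"
    by (intro integrable_const_bound[of _ 1]; simp)+
  show ?thesis unfolding cos_add using i by (simp add: c s)
qed

lemma std_gaussian_cf:
  fixes b :: "'j \<Rightarrow> real"
  assumes J: "finite J"
  shows "(CLINT u|(\<Pi>\<^sub>M i\<in>J. std_normal_distribution). iexp (\<Sum>i\<in>J. b i * u i)) = complex_of_real (exp (- (\<Sum>i\<in>J. (b i)\<^sup>2) / 2))"
proof -
  interpret PS: product_prob_space "\<lambda>_::'j. std_normal_distribution" UNIV by (rule product_std_normal)
  have "(CLINT u|(\<Pi>\<^sub>M i\<in>J. std_normal_distribution). iexp (\<Sum>i\<in>J. b i * u i))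
      = (CLINT u|(\<Pi>\<^sub>M i\<in>J. std_normal_distribution). (\<Prod>i\<in>J. iexp (b i * u i)))"
    using J by (simp add: exp_sum[symmetric] sum_distrib_left)
  also have "\<dots> = (\<Prod>i\<in>J. char std_normal_distribution (b i))"
    unfolding char_def
    by (rule PS.product_integral_prod[OF J])
      (auto intro!: finite_measure.integrable_const_bound[OF prob_space.finite_measure[OF prob_space_normal_density[of 1 0, OF zero_less_one]], of _ 1] simp flip: of_real_mult)
  also have "\<dots> = complex_of_real (exp (- (\<Sum>i\<in>J. (b i)\<^sup>2) / 2))"
    using J by (simp add: char_std_normal_distribution exp_sum[symmetric] sum_negf[symmetric] sum_divide_distrib flip: of_real_prod)
  finally show ?thesis .
qed

context
  fixes J :: "'j set" and P :: "('j \<Rightarrow> real) measure"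
  defines "P \<equiv> \<Pi>\<^sub>M i\<in>J. std_normal_distribution"
  assumes J: "finite J"
begin

lemma prob_space_std_gaussian: "prob_space P"
proof -
  interpret PS: product_prob_space "\<lambda>_::'j. std_normal_distribution" J by (rule product_std_normal)
  show ?thesis unfolding P_def by (rule PS.prob_space_axioms)
qed

lemma sets_std_gaussian: "sets P = sets (\<Pi>\<^sub>M i\<in>J. borel)"
  unfolding P_def by (intro sets_PiM_cong) auto

lemma measurable_linear_std_gaussian: "(\<lambda>u. \<Sum>i\<in>J. b i * u i) \<in> borel_measurable P"
proof -
  have "(\<lambda>u. u i) \<in> borel_measurable P" if "i \<in> J" for i
    unfolding measurable_cong_sets[OF sets_std_gaussian refl] by (rule measurable_component_singleton[OF that])
  then show ?thesis by (intro borel_measurable_sum borel_measurable_times) auto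
qed

lemma chebyshev_std_gaussian:
  assumes r: "r > 0"
  shows "measure P {u\<in>space P. \<bar>\<Sum>i\<in>J. b i * u i\<bar> \<ge> r} \<le> (\<Sum>i\<in>J. (b i)\<^sup>2) / r\<^sup>2"
proof -
  let ?S = std_normal_distribution
  let ?Z = "\<lambda>u. \<Sum>i\<in>J. b i * u i"
  define v where "v = (\<Sum>i\<in>J. (b i)\<^sup>2)"
  have v: "v \<ge> 0" by (simp add: v_def sum_nonneg)
  interpret P: prob_space P by (rule prob_space_std_gaussian)
  interpret S: prob_space ?S by (rule prob_space_normal_density) simp
  note measurable_linear_std_gaussian[measurable]
  \<comment> \<open>The variance is read off from the law: the functional is distributed like sqrt v
    times a standard normal variable.\<close>
  have d: "distr P borel ?Z = distr ?S borel (\<lambda>x. sqrt v * x)"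
  proof (rule finite_measure_eqI_cos)
    show "finite_measure (distr P borel ?Z)" "finite_measure (distr ?S borel (\<lambda>x. sqrt v * x))"
      by (auto intro!: P.finite_measure_distr S.finite_measure_distr)
    fix u \<theta> :: real
    have "(CLINT w|P. iexp (u * ?Z w)) = complex_of_real (exp (- (u\<^sup>2 * v) / 2))"
      using std_gaussian_cf[OF J, of "\<lambda>i. u * b i"] by (simp add: P_def v_def sum_distrib_left power_mult_distrib mult.assoc)
    from cos_integral_of_cf[OF P.finite_measure_axioms _ this]
    have 1: "(LINT w|P. cos (u * ?Z w + \<theta>)) = exp (- (u\<^sup>2 * v) / 2) * cos \<theta>" by simp
    have "(CLINT x|?S. iexp ((u * sqrt v) * x)) = complex_of_real (exp (- (u\<^sup>2 * v) / 2))"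
      using char_std_normal_distribution[THEN fun_cong, of "u * sqrt v"] v by (simp add: char_def power_mult_distrib)
    from cos_integral_of_cf[OF S.finite_measure_axioms _ this[unfolded of_real_mult[symmetric]]]
    have 2: "(LINT x|?S. cos (u * (sqrt v * x) + \<theta>)) = exp (- (u\<^sup>2 * v) / 2) * cos \<theta>" by (simp add: mult.assoc)
    show "(LINT x|distr P borel ?Z. cos (u * x + \<theta>)) = (LINT x|distr ?S borel (\<lambda>x. sqrt v * x). cos (u * x + \<theta>))"
      using 1 2 by (simp add: integral_distr)
  qed auto
  have i1: "integrable ?S (\<lambda>x. x\<^sup>2)"
    using integrable_std_normal_distribution_moment[of 2] by simp
  have e1: "(LINT x|?S. x\<^sup>2) = 1"
    using std_normal_distribution_even_moments(1)[of 1] by simp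
  have "integrable (distr P borel ?Z) (\<lambda>x. x\<^sup>2)"
    unfolding d using i1 by (subst integrable_distr_eq) (auto simp: power_mult_distrib)
  then have int: "integrable P (\<lambda>u. (?Z u)\<^sup>2)" by (subst (asm) integrable_distr_eq) auto
  have "(LINT u|P. (?Z u)\<^sup>2) = (LINT x|distr P borel ?Z. x\<^sup>2)" by (subst integral_distr) auto
  also have "\<dots> = (LINT x|?S. v * x\<^sup>2)"
    unfolding d using v by (subst integral_distr) (auto simp: power_mult_distrib)
  also have "\<dots> = v" using i1 e1 by simp
  finally have var: "(LINT u|P. (?Z u)\<^sup>2) = v" .
  have "measure P {u\<in>space P. (?Z u)\<^sup>2 \<ge> r\<^sup>2} \<le> (LINT u|P. (?Z u)\<^sup>2) / r\<^sup>2"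
    using r by (intro integral_Markov_inequality_measure[OF int, where A = "space P"]) auto
  also have "{u\<in>space P. (?Z u)\<^sup>2 \<ge> r\<^sup>2} = {u\<in>space P. \<bar>?Z u\<bar> \<ge> r}"
    using r by (auto simp: abs_le_square_iff[symmetric])
  finally show ?thesis by (simp add: var v_def)
qed

lemma small_ball_std_gaussian:
  assumes r: "r > 0" and v: "(\<Sum>i\<in>J. (b i)\<^sup>2) > 0"
  shows "measure P {u\<in>space P. \<bar>\<Sum>i\<in>J. b i * u i\<bar> \<le> r} \<le> exp (1 / 2) * r / sqrt (\<Sum>i\<in>J. (b i)\<^sup>2)"
proof -
  have "measure P {u\<in>space P. \<forall>k\<in>{()}. \<bar>\<Sum>i\<in>J. b i * u i\<bar> \<le> r} \<le> (exp (1 / 2) * r / sqrt (\<Sum>i\<in>J. (b i)\<^sup>2)) ^ card {()}"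
  proof (rule gaussian_small_ball[OF prob_space_std_gaussian, where Q = "\<lambda>a. (a ())\<^sup>2 * (\<Sum>i\<in>J. (b i)\<^sup>2)"])
    show "has_gaussian_cf P {()} (\<lambda>_ u. \<Sum>i\<in>J. b i * u i) (\<lambda>a. (a ())\<^sup>2 * (\<Sum>i\<in>J. (b i)\<^sup>2))"
      unfolding has_gaussian_cf_def
    proof
      fix a :: "unit \<Rightarrow> real"
      show "(CLINT u|P. iexp (\<Sum>k\<in>{()}. a k * (\<Sum>i\<in>J. b i * u i))) = complex_of_real (exp (- ((a ())\<^sup>2 * (\<Sum>i\<in>J. (b i)\<^sup>2)) / 2))"
        using std_gaussian_cf[OF J, of "\<lambda>i. a () * b i"]
        by (simp add: P_def sum_distrib_left power_mult_distrib mult.assoc)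
    qed
  qed (use assms measurable_linear_std_gaussian in auto)
  then show ?thesis by simp
qed

text \<open>If |X| > r and |X + Y| < r, then X and Y have opposite signs. The first condition fails
  rarely by the small ball bound, the second by Chebyshev's inequality when the variance of X + Y is
  small.\<close>

lemma sign_change_std_gaussian:
  assumes r: "r > 0" and v: "(\<Sum>i\<in>J. (b i)\<^sup>2) > 0"
  shows "measure P {u\<in>space P. \<not> (\<Sum>i\<in>J. b i * u i) * (\<Sum>i\<in>J. c i * u i) < 0}
    \<le> exp (1 / 2) * r / sqrt (\<Sum>i\<in>J. (b i)\<^sup>2) + (\<Sum>i\<in>J. (b i + c i)\<^sup>2) / r\<^sup>2"
proof -
  interpret P: prob_space P by (rule prob_space_std_gaussian)
  note measurable_linear_std_gaussian[measurable]
  have sgn: "x * y < 0" if "\<bar>x\<bar> > r" "\<bar>x + y\<bar> < r" for x y :: real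
    using that r by (cases "x > 0") (auto simp: mult_less_0_iff)
  have "{u\<in>space P. \<not> (\<Sum>i\<in>J. b i * u i) * (\<Sum>i\<in>J. c i * u i) < 0}
      \<subseteq> {u\<in>space P. \<bar>\<Sum>i\<in>J. b i * u i\<bar> \<le> r} \<union> {u\<in>space P. \<bar>\<Sum>i\<in>J. (b i + c i) * u i\<bar> \<ge> r}"
  proof
    fix u assume "u \<in> {u\<in>space P. \<not> (\<Sum>i\<in>J. b i * u i) * (\<Sum>i\<in>J. c i * u i) < 0}"
    then show "u \<in> {u\<in>space P. \<bar>\<Sum>i\<in>J. b i * u i\<bar> \<le> r} \<union> {u\<in>space P. \<bar>\<Sum>i\<in>J. (b i + c i) * u i\<bar> \<ge> r}"
      using sgn[of "\<Sum>i\<in>J. b i * u i" "\<Sum>i\<in>J. c i * u i"]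
      by (simp add: distrib_right sum.distrib) (meson not_le)
  qed
  then have "measure P {u\<in>space P. \<not> (\<Sum>i\<in>J. b i * u i) * (\<Sum>i\<in>J. c i * u i) < 0}
      \<le> measure P ({u\<in>space P. \<bar>\<Sum>i\<in>J. b i * u i\<bar> \<le> r} \<union> {u\<in>space P. \<bar>\<Sum>i\<in>J. (b i + c i) * u i\<bar> \<ge> r})"
    by (intro P.finite_measure_mono) auto
  also have "\<dots> \<le> measure P {u\<in>space P. \<bar>\<Sum>i\<in>J. b i * u i\<bar> \<le> r} + measure P {u\<in>space P. \<bar>\<Sum>i\<in>J. (b i + c i) * u i\<bar> \<ge> r}"
    by (intro measure_Un_le) auto
  also have "\<dots> \<le> exp (1 / 2) * r / sqrt (\<Sum>i\<in>J. (b i)\<^sup>2) + (\<Sum>i\<in>J. (b i + c i)\<^sup>2) / r\<^sup>2"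
    by (intro add_mono small_ball_std_gaussian chebyshev_std_gaussian r v)
  finally show ?thesis .
qed

lemma scale_std_gaussian:
  assumes s: "\<And>i. i \<in> J \<Longrightarrow> 0 < s i \<and> s i \<le> 1" and B: "B \<in> sets P"
  shows "measure P {u\<in>space P. (\<lambda>i\<in>J. s i * u i) \<in> B} \<le> (\<Prod>i\<in>J. 1 / s i) * measure P B"
proof -
  interpret P: prob_space P by (rule prob_space_std_gaussian)
  have B': "B \<in> sets (\<Pi>\<^sub>M i\<in>J. borel)" using B sets_std_gaussian by simp
  have sc: "(\<lambda>u. \<lambda>i\<in>J. s i * u i) \<in> measurable P P"
    unfolding measurable_cong_sets[OF sets_std_gaussian sets_std_gaussian]
    by (intro measurable_restrict borel_measurable_times borel_measurable_const measurable_component_singleton)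
  have pre: "{u\<in>space P. (\<lambda>i\<in>J. s i * u i) \<in> B} \<in> sets P"
    using measurable_sets[OF sc B] by (simp add: vimage_def Int_def conj_commute)
  have "emeasure P {u\<in>space P. (\<lambda>i\<in>J. s i * u i) \<in> B} = (\<integral>\<^sup>+u. indicator {u\<in>space P. (\<lambda>i\<in>J. s i * u i) \<in> B} u \<partial>P)"
    using pre by simp
  also have "\<dots> = (\<integral>\<^sup>+u. indicator B (\<lambda>i\<in>J. s i * u i) \<partial>P)"
    by (intro nn_integral_cong) (auto simp: indicator_def)
  also have "\<dots> \<le> ennreal (\<Prod>i\<in>J. 1 / s i) * (\<integral>\<^sup>+u. indicator B u \<partial>P)"
    unfolding P_def using B' s by (intro PiM_std_normal_scale J) auto
  also have "\<dots> = ennreal (\<Prod>i\<in>J. 1 / s i) * emeasure P B" using B by simp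
  finally show ?thesis
    using s by (simp add: P.emeasure_eq_measure ennreal_mult[symmetric] prod_nonneg less_imp_le)
qed

end

lemma std_normal_interval_pos:
  fixes a b :: real
  assumes "a < b" "{a<..<b} \<subseteq> A" "A \<in> sets borel"
  shows "0 < measure std_normal_distribution A"
proof -
  interpret S: prob_space std_normal_distribution by (rule prob_space_normal_density) simp
  have "emeasure std_normal_distribution A \<noteq> 0"
  proof
    assume "emeasure std_normal_distribution A = 0"
    then have "A \<in> null_sets std_normal_distribution" using assms(3) by (simp add: null_sets_def)
    then have "AE x in lborel. x \<in> A \<longrightarrow> std_normal_density x = 0"
      by (subst (asm) null_sets_density_iff) (auto simp: normal_density_nonneg)
    then have "AE x in lborel. x \<notin> {a<..<b}"
    proof eventually_elim
      case (elim x)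
      have "std_normal_density x \<noteq> 0" using normal_density_pos[of 1 0 x] by simp
      then show ?case using elim assms(2) by blast
    qed
    moreover have "{x \<in> space lborel. \<not> x \<notin> {a<..<b}} = {a<..<b}" by auto
    ultimately have "emeasure lborel {a<..<b} = 0" by (subst (asm) AE_iff_measurable[of "{a<..<b}"]) auto
    then show False using assms(1) by simp
  qed
  then show ?thesis by (simp add: S.emeasure_eq_measure zero_less_measure_iff)
qed

context stationary_gaussian
begin

text \<open>Any way of writing the spectral form as a sum of squares realises the lattice values as
  a linear image of a standard Gaussian vector. \<open>J\<close> may be larger than
  \<open>K\<close>, so different parts of the spectrum can be driven by separate independent
  coordinates.\<close>

lemma gaussian_law_transfer:
  fixes \<tau> :: "'i \<Rightarrow> real" and L :: "'i \<Rightarrow> 'j \<Rightarrow> real"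
  assumes K: "finite K" and J: "finite J"
    and form: "\<And>a. spectral_form K \<tau> a = (\<Sum>i\<in>J. (\<Sum>k\<in>K. a k * L k i)\<^sup>2)"
    and S: "S \<in> sets (\<Pi>\<^sub>M k\<in>K. borel)"
  shows "prob {\<omega>\<in>space M. (\<lambda>k\<in>K. F (\<tau> k) \<omega>) \<in> S}
    = measure (\<Pi>\<^sub>M i\<in>J. std_normal_distribution)
        {u\<in>space (\<Pi>\<^sub>M i\<in>J. std_normal_distribution). (\<lambda>k\<in>K. \<Sum>i\<in>J. L k i * u i) \<in> S}"
proof -
  define P where "P = (\<Pi>\<^sub>M i\<in>J. std_normal_distribution)"
  interpret P: prob_space P unfolding P_def by (rule prob_space_std_gaussian[OF J])
  note lin = measurable_linear_std_gaussian[OF J, folded P_def]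
  define f where "f = (\<lambda>\<omega>. \<lambda>k\<in>K. F (\<tau> k) \<omega>)"
  define g where "g = (\<lambda>u. \<lambda>k\<in>K. \<Sum>i\<in>J. L k i * u i)"
  have f: "f \<in> measurable M (\<Pi>\<^sub>M k\<in>K. borel)" unfolding f_def by (intro measurable_restrict) simp
  have g: "g \<in> measurable P (\<Pi>\<^sub>M k\<in>K. borel)" unfolding g_def by (intro measurable_restrict lin)
  have lm: "(\<lambda>x. cos ((\<Sum>k\<in>K. a k * x k) + \<theta>)) \<in> borel_measurable (\<Pi>\<^sub>M k\<in>K. borel)" for a :: "'i \<Rightarrow> real" and \<theta>
    by (intro measurable_compose[OF _ borel_measurable_cos] borel_measurable_add borel_measurable_sum borel_measurable_times
        borel_measurable_const measurable_component_singleton) 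
  have "distr M (\<Pi>\<^sub>M k\<in>K. borel) f = distr P (\<Pi>\<^sub>M k\<in>K. borel) g"
  proof (rule finite_measure_PiM_eqI_cos[OF _ _ _ _ K])
    show "finite_measure (distr M (\<Pi>\<^sub>M k\<in>K. borel) f)" "finite_measure (distr P (\<Pi>\<^sub>M k\<in>K. borel) g)"
      using f g by (auto intro!: finite_measure_distr P.finite_measure_distr)
    fix a \<theta>
    have "(LINT x|distr M (\<Pi>\<^sub>M k\<in>K. borel) f. cos ((\<Sum>k\<in>K. a k * x k) + \<theta>)) = (LINT \<omega>|M. cos ((\<Sum>k\<in>K. a k * F (\<tau> k) \<omega>) + \<theta>))"
      using f lm by (subst integral_distr) (auto simp: f_def)
    also have "\<dots> = exp (- spectral_form K \<tau> a / 2) * cos \<theta>"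
      using gaussian_cf[OF K, of \<tau>]
      by (intro cos_integral_of_cf) (auto simp: has_gaussian_cf_def finite_measure_axioms)
    also have "\<dots> = (LINT u|P. cos ((\<Sum>i\<in>J. (\<Sum>k\<in>K. a k * L k i) * u i) + \<theta>))"
      unfolding form P_def using lin[unfolded P_def] P.finite_measure_axioms[unfolded P_def]
      by (intro cos_integral_of_cf[symmetric] std_gaussian_cf J)
    also have "(\<lambda>u. \<Sum>i\<in>J. (\<Sum>k\<in>K. a k * L k i) * u i) = (\<lambda>u. \<Sum>k\<in>K. a k * (\<Sum>i\<in>J. L k i * u i))"
    proof
      fix u
      show "(\<Sum>i\<in>J. (\<Sum>k\<in>K. a k * L k i) * u i) = (\<Sum>k\<in>K. a k * (\<Sum>i\<in>J. L k i * u i))"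
        unfolding sum_distrib_left sum_distrib_right by (subst sum.swap) (simp add: mult.assoc)
    qed
    then have "(LINT u|P. cos ((\<Sum>i\<in>J. (\<Sum>k\<in>K. a k * L k i) * u i) + \<theta>)) = (LINT u|P. cos ((\<Sum>k\<in>K. a k * (\<Sum>i\<in>J. L k i * u i)) + \<theta>))"
      by (simp add: fun_eq_iff)
    also have "\<dots> = (LINT x|distr P (\<Pi>\<^sub>M k\<in>K. borel) g. cos ((\<Sum>k\<in>K. a k * x k) + \<theta>))"
      using g lm by (subst integral_distr) (auto simp: g_def)
    finally show "(LINT x|distr M (\<Pi>\<^sub>M k\<in>K. borel) f. cos ((\<Sum>k\<in>K. a k * x k) + \<theta>))
        = (LINT x|distr P (\<Pi>\<^sub>M k\<in>K. borel) g. cos ((\<Sum>k\<in>K. a k * x k) + \<theta>))" .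
  qed auto
  then have "measure (distr M (\<Pi>\<^sub>M k\<in>K. borel) f) S = measure (distr P (\<Pi>\<^sub>M k\<in>K. borel) g) S" by simp
  then show ?thesis
    using f g S by (simp add: measure_distr f_def g_def P_def vimage_def Int_def conj_commute)
qed

end

subsection \<open>Sign changes on a lattice\<close>

context stationary_gaussian
begin

text \<open>The covariance of the component of the process with frequencies in \<open>B\<close>; the
  component itself is never constructed.\<close>

definition restricted_covariance :: "real set \<Rightarrow> real \<Rightarrow> real \<Rightarrow> real" where
  "restricted_covariance B s t = (LINT x|\<mu>. indicator B x * cos ((t - s) * x))"

lemma restricted_cos_integrable:
  assumes "B \<in> sets borel"
  shows "integrable \<mu> (\<lambda>x. indicator B x * cos (t * x))"
  using assms by (intro mu.integrable_const_bound[of _ 1]) (auto simp: indicator_def)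

lemma restricted_covariance_factorization:
  fixes \<tau> :: "'i \<Rightarrow> real"
  assumes K: "finite K" and B: "B \<in> sets borel"
  obtains L :: "'i \<Rightarrow> 'i \<Rightarrow> real" where
    "\<And>j k. j \<in> K \<Longrightarrow> k \<in> K \<Longrightarrow> restricted_covariance B (\<tau> j) (\<tau> k) = (\<Sum>i\<in>K. L j i * L k i)"
proof -
  have "\<exists>L :: 'i \<Rightarrow> 'i \<Rightarrow> real. \<forall>j\<in>K. \<forall>k\<in>K. restricted_covariance B (\<tau> j) (\<tau> k) = (\<Sum>i\<in>K. L j i * L k i)"
  proof (rule gram_factorization[OF K])
    show "restricted_covariance B (\<tau> j) (\<tau> k) = restricted_covariance B (\<tau> k) (\<tau> j)" for j k
      unfolding restricted_covariance_def
    proof (intro Bochner_Integration.integral_cong refl)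
      fix x
      have "(\<tau> k - \<tau> j) * x = - ((\<tau> j - \<tau> k) * x)" by (simp add: algebra_simps)
      then show "indicator B x * cos ((\<tau> k - \<tau> j) * x) = indicator B x * cos ((\<tau> j - \<tau> k) * x)" by (simp only: cos_minus)
    qed
    fix c :: "'i \<Rightarrow> real"
    have "(\<Sum>j\<in>K. \<Sum>k\<in>K. c j * c k * restricted_covariance B (\<tau> j) (\<tau> k))
        = (LINT x|\<mu>. (\<Sum>j\<in>K. \<Sum>k\<in>K. c j * c k * (indicator B x * cos ((\<tau> k - \<tau> j) * x))))"
      unfolding restricted_covariance_def using restricted_cos_integrable[OF B] by simp
    also have "\<dots> = (LINT x|\<mu>. indicator B x * (norm (\<Sum>k\<in>K. of_real (c k) * cis (x * \<tau> k)))\<^sup>2)"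
      unfolding norm_trig_sum sum_distrib_left by (simp add: ac_simps)
    also have "0 \<le> \<dots>" by (intro integral_nonneg_AE) simp
    finally show "0 \<le> (\<Sum>j\<in>K. \<Sum>k\<in>K. c j * c k * restricted_covariance B (\<tau> j) (\<tau> k))" .
  qed
  then show thesis using that by blast
qed

lemma spectral_form_eq_cov:
  assumes K: "finite K"
  shows "spectral_form K \<tau> a = (\<Sum>j\<in>K. \<Sum>k\<in>K. a j * a k * restricted_covariance UNIV (\<tau> j) (\<tau> k))"
  unfolding spectral_form_def norm_trig_sum restricted_covariance_def
  using restricted_cos_integrable[of UNIV] by simp

lemma restricted_covariance_split:
  assumes B: "B \<in> sets borel"
  shows "restricted_covariance UNIV s t = restricted_covariance B s t + restricted_covariance (- B) s t"
proof -
  have "restricted_covariance B s t + restricted_covariance (- B) s t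
      = (LINT x|\<mu>. indicator B x * cos ((t - s) * x) + indicator (- B) x * cos ((t - s) * x))"
    unfolding restricted_covariance_def
    using B by (intro Bochner_Integration.integral_add[symmetric] restricted_cos_integrable) auto
  also have "\<dots> = restricted_covariance UNIV s t"
    unfolding restricted_covariance_def by (intro Bochner_Integration.integral_cong) (auto simp: indicator_def)
  finally show ?thesis by simp
qed

lemma square_sum_gram:
  fixes L :: "'i \<Rightarrow> 'j \<Rightarrow> real"
  shows "(\<Sum>i\<in>J. (\<Sum>k\<in>K. a k * L k i)\<^sup>2) = (\<Sum>j\<in>K. \<Sum>k\<in>K. a j * a k * (\<Sum>i\<in>J. L j i * L k i))"
proof -
  have "(\<Sum>i\<in>J. (\<Sum>k\<in>K. a k * L k i)\<^sup>2) = (\<Sum>i\<in>J. \<Sum>j\<in>K. \<Sum>k\<in>K. a j * a k * (L j i * L k i))"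
    by (simp add: power2_eq_square sum_product ac_simps)
  also have "\<dots> = (\<Sum>j\<in>K. \<Sum>i\<in>J. \<Sum>k\<in>K. a j * a k * (L j i * L k i))" by (rule sum.swap)
  also have "\<dots> = (\<Sum>j\<in>K. \<Sum>k\<in>K. \<Sum>i\<in>J. a j * a k * (L j i * L k i))"
    by (intro sum.cong refl sum.swap)
  finally show ?thesis by (simp add: sum_distrib_left)
qed

text \<open>The part of the spectrum away from the edge is damped by the factor s; this costs
  only a factor s per lattice point in probability, while the damped process oscillates like its
  highest frequency.\<close>
lemma many_sign_changes_damped:
  assumes B: "B \<in> sets borel" and m1: "measure \<mu> B > 0" and mu1: "measure \<mu> UNIV = 1"
    and q: "\<And>x. x \<in> B \<Longrightarrow> 1 + cos (h * x) \<le> q" and s: "0 < s" "s \<le> 1" and \<rho>: "\<rho> > 0"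
    and bound: "exp (1 / 2) * \<rho> / sqrt (measure \<mu> B) + (2 * q * measure \<mu> B + 4 * s\<^sup>2) / \<rho>\<^sup>2 \<le> \<eta> / 2"
    and \<eta>: "\<eta> > 0" and n: "n \<ge> 1"
  shows "s ^ Suc n / 2 \<le> prob {\<omega>\<in>space M. (\<Sum>j<n. if F (real j * h) \<omega> * F (real (Suc j) * h) \<omega> < 0 then 1 else 0) \<ge> (1 - \<eta>) * real n}"
proof -
  define K where "K = {..n}"
  define \<tau> where "\<tau> = (\<lambda>k::nat. real k * h)"
  have K: "finite K" "card K = Suc n" by (auto simp: K_def)
  obtain L1 where L1: "\<And>j k. j \<in> K \<Longrightarrow> k \<in> K \<Longrightarrow> restricted_covariance B (\<tau> j) (\<tau> k) = (\<Sum>i\<in>K. L1 j i * L1 k i)"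
    using restricted_covariance_factorization[OF K(1) B] by metis
  have Bc: "- B \<in> sets borel" using B by simp
  obtain L2 where L2: "\<And>j k. j \<in> K \<Longrightarrow> k \<in> K \<Longrightarrow> restricted_covariance (- B) (\<tau> j) (\<tau> k) = (\<Sum>i\<in>K. L2 j i * L2 k i)"
    using restricted_covariance_factorization[OF K(1) Bc] by metis
  \<comment> \<open>The left copy of \<open>K\<close> drives the frequencies in \<open>B\<close>,
    the right copy the others. Only the right copy is scaled by \<open>s\<close>, so the total cost
    is s^(n + 1).\<close>
  define J where "J = K <+> K"
  have J: "finite J" by (simp add: J_def K)
  define L where "L = (\<lambda>k. case_sum (L1 k) (L2 k))"
  define sc where "sc = (\<lambda>i::nat + nat. case_sum (\<lambda>_. 1) (\<lambda>_. s) i)"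
  have sc: "0 < sc i \<and> sc i \<le> 1" for i using s by (simp add: sc_def split: sum.split)
  define P where "P = (\<Pi>\<^sub>M i\<in>J. std_normal_distribution)"
  interpret P: prob_space P unfolding P_def by (rule prob_space_std_gaussian[OF J])
  note lin[measurable] = measurable_linear_std_gaussian[OF J, folded P_def]
  define Y where "Y = (\<lambda>k u. \<Sum>i\<in>J. L k i * u i)"
  define Z where "Z = (\<lambda>k u. \<Sum>i\<in>J. (L k i * sc i) * u i)"
  have [measurable]: "Y k \<in> borel_measurable P" "Z k \<in> borel_measurable P" for k
    unfolding Y_def Z_def by measurable
  have form: "spectral_form K \<tau> a = (\<Sum>i\<in>J. (\<Sum>k\<in>K. a k * L k i)\<^sup>2)" for a
    unfolding spectral_form_eq_cov[OF K(1)] square_sum_gram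
    by (intro sum.cong refl) (simp add: restricted_covariance_split[OF B] J_def L_def sum.Plus K L1 L2)
  define cnt where "cnt = (\<lambda>x::nat \<Rightarrow> real. \<Sum>j<n. if x j * x (Suc j) < 0 then 1 else (0::real))"
  define S where "S = {x\<in>space (\<Pi>\<^sub>M k\<in>K. borel). cnt x \<ge> (1 - \<eta>) * real n}"
  have cm: "cnt \<in> borel_measurable (\<Pi>\<^sub>M k\<in>K. borel)"
  proof -
    have "(\<lambda>x. x j) \<in> borel_measurable (\<Pi>\<^sub>M k\<in>K. borel :: real measure)" if "j \<le> n" for j
      using that by (intro measurable_component_singleton) (simp add: K_def)
    note comp = this
    show ?thesis unfolding cnt_def
    proof (intro borel_measurable_sum)
      fix j assume "j \<in> {..<n}"
      then have [measurable]: "(\<lambda>x. x j) \<in> borel_measurable (\<Pi>\<^sub>M k\<in>K. borel :: real measure)"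
          "(\<lambda>x. x (Suc j)) \<in> borel_measurable (\<Pi>\<^sub>M k\<in>K. borel :: real measure)"
        using comp[of j] comp[of "Suc j"] by auto
      show "(\<lambda>x. if x j * x (Suc j) < 0 then 1 else 0) \<in> borel_measurable (\<Pi>\<^sub>M k\<in>K. borel :: real measure)"
        by measurable
    qed
  qed
  then have S: "S \<in> sets (\<Pi>\<^sub>M k\<in>K. borel)" unfolding S_def by measurable
  have cr: "cnt (\<lambda>k\<in>K. f k) = cnt f" for f
    unfolding cnt_def K_def by (intro sum.cong refl) auto
  have sp: "(\<lambda>k\<in>K. f k) \<in> space (\<Pi>\<^sub>M k\<in>K. borel)" for f :: "nat \<Rightarrow> real" by (simp add: space_PiM)
  have trans: "prob {\<omega>\<in>space M. cnt (\<lambda>k. F (\<tau> k) \<omega>) \<ge> (1 - \<eta>) * real n} = P.prob {u\<in>space P. cnt (\<lambda>k. Y k u) \<ge> (1 - \<eta>) * real n}"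
    using gaussian_law_transfer[OF K(1) J form S] sp by (simp add: S_def cr P_def Y_def)
  have cY[measurable]: "(\<lambda>u. cnt (\<lambda>k. Y k u)) \<in> borel_measurable P" "(\<lambda>u. cnt (\<lambda>k. Z k u)) \<in> borel_measurable P"
    unfolding cnt_def by measurable
  have scaled: "P.prob {u\<in>space P. cnt (\<lambda>k. Z k u) \<ge> (1 - \<eta>) * real n}
      \<le> (1 / s) ^ Suc n * P.prob {u\<in>space P. cnt (\<lambda>k. Y k u) \<ge> (1 - \<eta>) * real n}"
  proof -
    have "Y k (\<lambda>i\<in>J. sc i * u i) = Z k u" for k u
      unfolding Y_def Z_def by (intro sum.cong) (auto simp: mult.assoc)
    moreover have "(\<lambda>i\<in>J. sc i * u i) \<in> space P" for u by (simp add: P_def space_PiM)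
    ultimately have "{u\<in>space P. cnt (\<lambda>k. Z k u) \<ge> (1 - \<eta>) * real n}
        = {u\<in>space P. (\<lambda>i\<in>J. sc i * u i) \<in> {u\<in>space P. cnt (\<lambda>k. Y k u) \<ge> (1 - \<eta>) * real n}}" by simp
    moreover have "{u\<in>space P. cnt (\<lambda>k. Y k u) \<ge> (1 - \<eta>) * real n} \<in> sets P" by measurable
    moreover have "(\<Prod>i\<in>J. 1 / sc i) = (1 / s) ^ Suc n"
      unfolding J_def using K by (simp add: prod.Plus sc_def)
    ultimately show ?thesis
      using scale_std_gaussian[OF J, of sc "{u\<in>space P. cnt (\<lambda>k. Y k u) \<ge> (1 - \<eta>) * real n}"] sc by (simp add: P_def)
  qed
  \<comment> \<open>The sum of two neighbouring damped values has small variance: frequencies in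
    \<open>B\<close> contribute 2 (1 + cos (h x)) \<le> 2 q each, and the damped rest at most 4 s^2
    in total.\<close>
  have change: "P.prob {u\<in>space P. \<not> Z j u * Z (Suc j) u < 0} \<le> \<eta> / 2" if j: "j < n" for j
  proof -
    have jK: "j \<in> K" "Suc j \<in> K" using j by (auto simp: K_def)
    have gram: "(\<Sum>i\<in>J. (L k i * sc i) * (L l i * sc i)) = restricted_covariance B (\<tau> k) (\<tau> l) + s\<^sup>2 * restricted_covariance (- B) (\<tau> k) (\<tau> l)"
      if "k \<in> K" "l \<in> K" for k l
      using that by (simp add: J_def L_def sc_def sum.Plus K L1 L2 sum_distrib_left power2_eq_square ac_simps)
    have d0: "restricted_covariance C t t = measure \<mu> C" if "C \<in> sets borel" for C t
      using that space_mu sets_mu by (simp add: restricted_covariance_def)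
    have v: "(\<Sum>i\<in>J. (L j i * sc i)\<^sup>2) \<ge> measure \<mu> B"
      unfolding power2_eq_square gram[OF jK(1) jK(1)] using B by (simp add: d0)
    have sum_sq: "(\<Sum>i\<in>J. (L j i * sc i + L (Suc j) i * sc i)\<^sup>2)
       = (2 * measure \<mu> B + 2 * restricted_covariance B (\<tau> j) (\<tau> (Suc j)))
         + s\<^sup>2 * (2 * measure \<mu> (- B) + 2 * restricted_covariance (- B) (\<tau> j) (\<tau> (Suc j)))"
    proof -
      have "(\<Sum>i\<in>J. (L j i * sc i + L (Suc j) i * sc i)\<^sup>2)
        = (\<Sum>i\<in>J. (L j i * sc i) * (L j i * sc i)) + (\<Sum>i\<in>J. (L (Suc j) i * sc i) * (L (Suc j) i * sc i))
          + 2 * (\<Sum>i\<in>J. (L j i * sc i) * (L (Suc j) i * sc i))"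
        unfolding sum_distrib_left sum.distrib[symmetric] by (intro sum.cong refl) (simp add: power2_eq_square algebra_simps)
      also have "\<dots> = (measure \<mu> B + s\<^sup>2 * measure \<mu> (- B)) + (measure \<mu> B + s\<^sup>2 * measure \<mu> (- B))
          + 2 * (restricted_covariance B (\<tau> j) (\<tau> (Suc j)) + s\<^sup>2 * restricted_covariance (- B) (\<tau> j) (\<tau> (Suc j)))"
        unfolding gram[OF jK(1) jK(1)] gram[OF jK(2) jK(2)] gram[OF jK] d0[OF B] d0[OF Bc] ..
      finally show ?thesis by (simp add: algebra_simps)
    qed
    have st: "\<tau> (Suc j) - \<tau> j = h" by (simp add: \<tau>_def algebra_simps)
    have b1: "measure \<mu> B + restricted_covariance B (\<tau> j) (\<tau> (Suc j)) \<le> q * measure \<mu> B"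
    proof -
      have i: "integrable \<mu> (\<lambda>x. indicator B x :: real)" using B sets_mu by (simp add: integrable_indicator_iff less_top[symmetric])
      have "measure \<mu> B + restricted_covariance B (\<tau> j) (\<tau> (Suc j)) = (LINT x|\<mu>. indicator B x + indicator B x * cos (h * x))"
        unfolding restricted_covariance_def st using restricted_cos_integrable[OF B, of h] i B sets_mu space_mu by simp
      also have "\<dots> \<le> (LINT x|\<mu>. q * indicator B x)"
        using i restricted_cos_integrable[OF B, of h] q by (intro integral_mono) (auto simp: indicator_def)
      finally show ?thesis using B sets_mu space_mu by simp
    qed
    have b2: "measure \<mu> (- B) + restricted_covariance (- B) (\<tau> j) (\<tau> (Suc j)) \<le> 2"
    proof -
      have "measure \<mu> (- B) \<le> 1" using mu.bounded_measure[of "- B"] mu1 space_mu by simp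
      moreover have "restricted_covariance (- B) (\<tau> j) (\<tau> (Suc j)) \<le> (LINT x|\<mu>. 1)"
        unfolding restricted_covariance_def using restricted_cos_integrable[OF Bc]
        by (intro integral_mono) (auto simp: indicator_def)
      ultimately show ?thesis using mu1 space_mu by simp
    qed
    have "P.prob {u\<in>space P. \<not> Z j u * Z (Suc j) u < 0}
        \<le> exp (1 / 2) * \<rho> / sqrt (\<Sum>i\<in>J. (L j i * sc i)\<^sup>2) + (\<Sum>i\<in>J. (L j i * sc i + L (Suc j) i * sc i)\<^sup>2) / \<rho>\<^sup>2"
      unfolding Z_def P_def using v m1 by (intro sign_change_std_gaussian J \<rho>) auto
    also have "\<dots> \<le> exp (1 / 2) * \<rho> / sqrt (measure \<mu> B) + (2 * q * measure \<mu> B + 4 * s\<^sup>2) / \<rho>\<^sup>2"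
    proof (intro add_mono divide_left_mono divide_right_mono)
      have "s\<^sup>2 * (measure \<mu> (- B) + restricted_covariance (- B) (\<tau> j) (\<tau> (Suc j))) \<le> s\<^sup>2 * 2"
        by (intro mult_left_mono b2) simp
      then show "(\<Sum>i\<in>J. (L j i * sc i + L (Suc j) i * sc i)\<^sup>2) \<le> 2 * q * measure \<mu> B + 4 * s\<^sup>2"
        unfolding sum_sq using b1 by (simp add: algebra_simps)
    qed (use v m1 \<rho> in auto)
    finally show ?thesis using bound by linarith
  qed
  \<comment> \<open>The expected number of missing sign changes is at most n \<eta> / 2, so by
    Markov's inequality it stays below n \<eta> with probability at least 1 / 2. No independence
    between lattice points is needed.\<close>
  define bad where "bad = (\<lambda>u. \<Sum>j<n. indicator {u\<in>space P. \<not> Z j u * Z (Suc j) u < 0} u :: real)"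
  have bi: "integrable P (\<lambda>u. indicator {u\<in>space P. \<not> Z j u * Z (Suc j) u < 0} u :: real)" for j
    by (intro integrable_real_indicator) (auto simp: P.emeasure_eq_measure)
  then have bint: "integrable P bad" unfolding bad_def by (intro Bochner_Integration.integrable_sum) auto
  have "(LINT u|P. bad u) = (\<Sum>j<n. P.prob {u\<in>space P. \<not> Z j u * Z (Suc j) u < 0})"
    unfolding bad_def using bi by (subst Bochner_Integration.integral_sum) (auto intro!: sum.cong arg_cong[where f = P.prob])
  also have "\<dots> \<le> (\<Sum>j<n. \<eta> / 2)" using change by (intro sum_mono) auto
  finally have Ebad: "(LINT u|P. bad u) \<le> real n * \<eta> / 2" by simp
  have "P.prob {u\<in>space P. bad u \<ge> \<eta> * real n} \<le> (LINT u|P. bad u) / (\<eta> * real n)"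
    using \<eta> n by (intro integral_Markov_inequality_measure[OF bint, where A = "space P"])
      (auto simp: bad_def intro!: sum_nonneg)
  also have "\<dots> \<le> (real n * \<eta> / 2) / (\<eta> * real n)" using Ebad \<eta> by (intro divide_right_mono) auto
  also have "\<dots> = 1 / 2" using \<eta> n by simp
  finally have half: "P.prob {u\<in>space P. bad u \<ge> \<eta> * real n} \<le> 1 / 2" .
  have bm[measurable]: "bad \<in> borel_measurable P" using bint by simp
  have "1 - P.prob {u\<in>space P. bad u \<ge> \<eta> * real n} = P.prob (space P - {u\<in>space P. bad u \<ge> \<eta> * real n})"
    by (subst P.prob_compl) auto
  also have "\<dots> \<le> P.prob {u\<in>space P. cnt (\<lambda>k. Z k u) \<ge> (1 - \<eta>) * real n}"
  proof (intro P.finite_measure_mono subsetI)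
    fix u assume u: "u \<in> space P - {u\<in>space P. bad u \<ge> \<eta> * real n}"
    have "cnt (\<lambda>k. Z k u) = real n - bad u"
    proof -
      have "cnt (\<lambda>k. Z k u) + bad u = (\<Sum>j<n. 1)"
        unfolding cnt_def bad_def sum.distrib[symmetric] using u by (intro sum.cong) (auto simp: indicator_def)
      then show ?thesis by simp
    qed
    with u show "u \<in> {u\<in>space P. cnt (\<lambda>k. Z k u) \<ge> (1 - \<eta>) * real n}" by (auto simp: algebra_simps)
  qed measurable
  finally have "1 / 2 \<le> (1 / s) ^ Suc n * P.prob {u\<in>space P. cnt (\<lambda>k. Y k u) \<ge> (1 - \<eta>) * real n}"
    using half scaled by linarith
  then have "s ^ Suc n * (1 / 2) \<le> s ^ Suc n * ((1 / s) ^ Suc n * P.prob {u\<in>space P. cnt (\<lambda>k. Y k u) \<ge> (1 - \<eta>) * real n})"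
    using s by (intro mult_left_mono) auto
  also have "\<dots> = P.prob {u\<in>space P. cnt (\<lambda>k. Y k u) \<ge> (1 - \<eta>) * real n}"
    using s by (simp add: mult.assoc[symmetric] power_mult_distrib[symmetric] del: power_Suc)
  finally show ?thesis unfolding trans[symmetric] by (simp add: cnt_def \<tau>_def)
qed

text \<open>Nondegeneracy lets l times the identity be split off the covariance. The vector then
  contains independent noise of size sqrt l, and a box of positive probability makes the noise
  alternate while the rest stays too small to spoil the signs.\<close>

lemma alternating_signs_positive:
  assumes l: "l > 0" and lower: "\<And>c. l * (\<Sum>k<m. (c k)\<^sup>2) \<le> spectral_form {..<m} (\<lambda>k. real k * h) c"
  shows "0 < prob {\<omega>\<in>space M. \<forall>k. Suc k < m \<longrightarrow> F (real k * h) \<omega> * F (real (Suc k) * h) \<omega> < 0}"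
proof -
  define K where "K = {..<m}"
  define \<tau> where "\<tau> = (\<lambda>k::nat. real k * h)"
  have K: "finite K" by (simp add: K_def)
  define R where "R = (\<lambda>j k. restricted_covariance UNIV (\<tau> j) (\<tau> k) - (if j = k then l else 0))"
  have dq: "(\<Sum>j\<in>K. \<Sum>k\<in>K. c j * c k * (if j = k then l else 0)) = l * (\<Sum>k\<in>K. (c k)\<^sup>2)" for c
    using K by (simp add: if_distrib[of "\<lambda>z. _ * z"] sum.delta sum_distrib_left power2_eq_square ac_simps cong: if_cong)
  have "\<exists>L :: nat \<Rightarrow> nat \<Rightarrow> real. \<forall>j\<in>K. \<forall>k\<in>K. R j k = (\<Sum>i\<in>K. L j i * L k i)"
  proof (rule gram_factorization[OF K])
    fix j k
    have "(\<tau> k - \<tau> j) * x = - ((\<tau> j - \<tau> k) * x)" for x by (simp add: algebra_simps)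
    then show "R j k = R k j" unfolding R_def restricted_covariance_def by (simp only: cos_minus eq_commute[of j k])
  next
    fix c
    have "(\<Sum>j\<in>K. \<Sum>k\<in>K. c j * c k * R j k) = spectral_form K \<tau> c - l * (\<Sum>k\<in>K. (c k)\<^sup>2)"
      unfolding spectral_form_eq_cov[OF K] dq[symmetric] R_def by (simp add: right_diff_distrib sum_subtractf)
    then show "0 \<le> (\<Sum>j\<in>K. \<Sum>k\<in>K. c j * c k * R j k)"
      using lower[of c] by (simp add: K_def \<tau>_def)
  qed
  then obtain L2 where L2: "\<And>j k. j \<in> K \<Longrightarrow> k \<in> K \<Longrightarrow> R j k = (\<Sum>i\<in>K. L2 j i * L2 k i)" by blast
  define J where "J = K <+> K"
  have J: "finite J" by (simp add: J_def K)
  define L where "L = (\<lambda>k. case_sum (\<lambda>i. if i = k then sqrt l else 0) (L2 k))"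
  have form: "spectral_form K \<tau> a = (\<Sum>i\<in>J. (\<Sum>k\<in>K. a k * L k i)\<^sup>2)" for a
    unfolding spectral_form_eq_cov[OF K] square_sum_gram
  proof (intro sum.cong refl arg_cong2[where f = "(*)"])
    fix j k assume jk: "j \<in> K" "k \<in> K"
    have "(\<Sum>i\<in>K. (if i = j then sqrt l else 0) * (if i = k then sqrt l else 0)) = (if j = k then l else 0)"
      using K jk l by (auto simp: if_distrib[of "\<lambda>z. z * _"] sum.delta cong: if_cong)
    then have "(\<Sum>i\<in>J. L j i * L k i) = (if j = k then l else 0) + R j k"
      using K jk by (simp add: J_def L_def sum.Plus L2)
    then show "restricted_covariance UNIV (\<tau> j) (\<tau> k) = (\<Sum>i\<in>J. L j i * L k i)" by (simp add: R_def)
  qed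
  define P where "P = (\<Pi>\<^sub>M i\<in>J. std_normal_distribution)"
  interpret P: prob_space P unfolding P_def by (rule prob_space_std_gaussian[OF J])
  interpret PS: product_prob_space "\<lambda>_::nat + nat. std_normal_distribution" J by (rule product_std_normal)
  interpret FP: finite_product_prob_space "\<lambda>_::nat + nat. std_normal_distribution" J by unfold_locales (rule J)
  \<comment> \<open>\<open>C\<close> exceeds every row sum of |L2|, so coordinates below r = sqrt l
    / C contribute at most sqrt l, less than the noise on the box.\<close>
  define C where "C = 1 + (\<Sum>k\<in>K. \<Sum>i\<in>K. \<bar>L2 k i\<bar>)"
  have C: "C \<ge> 1" by (simp add: C_def sum_nonneg)
  define r where "r = sqrt l / C"
  have r: "r > 0" using l C by (simp add: r_def)
  define A where "A = (\<lambda>i::nat + nat. case i of Inl k \<Rightarrow> {x::real. (- 1) ^ k * x > 1} | Inr k \<Rightarrow> {x. \<bar>x\<bar> < r})"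
  have A: "A i \<in> sets borel" for i unfolding A_def by (cases i) auto
  have Apos: "0 < measure std_normal_distribution (A i)" for i
  proof (cases i)
    case (Inl k)
    show ?thesis
    proof (cases "even k")
      case True
      then show ?thesis using A[of i] Inl by (intro std_normal_interval_pos[of 1 2]) (auto simp: A_def)
    next
      case False
      then show ?thesis using A[of i] Inl by (intro std_normal_interval_pos[of "- 2" "- 1"]) (auto simp: A_def)
    qed
  next
    case (Inr k)
    then show ?thesis using A[of i] r by (intro std_normal_interval_pos[of "- r" r]) (auto simp: A_def)
  qed
  have "P.prob (Pi\<^sub>E J A) = (\<Prod>i\<in>J. measure std_normal_distribution (A i))"
    unfolding P_def using A by (intro FP.prob_times) auto
  then have box: "0 < P.prob (Pi\<^sub>E J A)" using Apos by (simp add: prod_pos)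
  define S where "S = {x\<in>space (\<Pi>\<^sub>M k\<in>K. borel). \<forall>k. Suc k < m \<longrightarrow> x k * x (Suc k) < (0::real)}"
  have S: "S \<in> sets (\<Pi>\<^sub>M k\<in>K. borel)"
  proof -
    have "{x\<in>space (\<Pi>\<^sub>M k\<in>K. borel). Suc k < m \<longrightarrow> x k * x (Suc k) < (0::real)} \<in> sets (\<Pi>\<^sub>M k\<in>K. borel)" for k
    proof (cases "Suc k < m")
      case True
      have "(\<lambda>x. x j) \<in> borel_measurable (\<Pi>\<^sub>M k\<in>K. borel :: real measure)" if "j < m" for j
        using that by (intro measurable_component_singleton) (simp add: K_def)
      then show ?thesis using True by (auto intro!: borel_measurable_less borel_measurable_times)
    qed simp
    then show ?thesis unfolding S_def by (rule sets.sets_Collect_countable_All)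
  qed
  have sub: "Pi\<^sub>E J A \<subseteq> {u\<in>space P. (\<lambda>k\<in>K. \<Sum>i\<in>J. L k i * u i) \<in> S}"
  proof
    fix u assume u: "u \<in> Pi\<^sub>E J A"
    have val: "(- 1) ^ k * (\<Sum>i\<in>J. L k i * u i) > 0" if k: "k \<in> K" for k
    proof -
      have e1: "(\<Sum>i\<in>J. L k i * u i) = sqrt l * u (Inl k) + (\<Sum>i\<in>K. L2 k i * u (Inr i))"
        using K k by (simp add: J_def L_def sum.Plus if_distrib[of "\<lambda>z. z * _"] sum.delta cong: if_cong)
      have "u (Inl k) \<in> A (Inl k)" using u k by (auto simp: J_def)
      then have e2: "sqrt l * 1 < sqrt l * ((- 1) ^ k * u (Inl k))"
        using l by (intro mult_strict_left_mono) (auto simp: A_def)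
      have e3: "\<bar>(- 1) ^ k * (\<Sum>i\<in>K. L2 k i * u (Inr i))\<bar> \<le> sqrt l"
      proof -
        have "\<bar>(- 1) ^ k * (\<Sum>i\<in>K. L2 k i * u (Inr i))\<bar> = \<bar>\<Sum>i\<in>K. L2 k i * u (Inr i)\<bar>"
          by (simp add: abs_mult power_abs)
        also have "\<dots> \<le> (\<Sum>i\<in>K. \<bar>L2 k i\<bar> * r)"
        proof (rule order.trans[OF sum_abs sum_mono])
          fix i assume "i \<in> K"
          then have "u (Inr i) \<in> A (Inr i)" using u by (auto simp: J_def)
          then show "\<bar>L2 k i * u (Inr i)\<bar> \<le> \<bar>L2 k i\<bar> * r"
            by (simp add: A_def abs_mult mult_left_mono)
        qed
        also have "\<dots> = (\<Sum>i\<in>K. \<bar>L2 k i\<bar>) * r" by (simp add: sum_distrib_right)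
        also have "\<dots> \<le> C * r"
        proof (intro mult_right_mono)
          have "(\<Sum>i\<in>K. \<bar>L2 k i\<bar>) \<le> (\<Sum>k\<in>K. \<Sum>i\<in>K. \<bar>L2 k i\<bar>)"
            using k K by (intro member_le_sum) (auto intro: sum_nonneg)
          then show "(\<Sum>i\<in>K. \<bar>L2 k i\<bar>) \<le> C" by (simp add: C_def)
        qed (use r in simp)
        also have "\<dots> = sqrt l" using C by (simp add: r_def)
        finally show ?thesis .
      qed
      have "(- 1) ^ k * (\<Sum>i\<in>J. L k i * u i) = sqrt l * ((- 1) ^ k * u (Inl k)) + (- 1) ^ k * (\<Sum>i\<in>K. L2 k i * u (Inr i))"
        unfolding e1 distrib_left by (simp only: mult.left_commute)
      then show ?thesis using e2 e3 by linarith
    qed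
    have "(\<Sum>i\<in>J. L k i * u i) * (\<Sum>i\<in>J. L (Suc k) i * u i) < 0" if "Suc k < m" for k
    proof -
      have "k \<in> K" "Suc k \<in> K" using that by (auto simp: K_def)
      from mult_pos_pos[OF val[OF this(1)] val[OF this(2)]]
      have "0 < ((- 1) ^ k * (- 1) ^ Suc k) * ((\<Sum>i\<in>J. L k i * u i) * (\<Sum>i\<in>J. L (Suc k) i * u i))"
        by (simp only: ac_simps)
      moreover have "(- 1) ^ k * (- 1) ^ Suc k = (- 1 :: real)" by (simp add: power_mult_distrib[symmetric])
      ultimately show ?thesis by simp
    qed
    moreover have "u \<in> space P" using u by (auto simp: P_def space_PiM PiE_def)
    ultimately show "u \<in> {u\<in>space P. (\<lambda>k\<in>K. \<Sum>i\<in>J. L k i * u i) \<in> S}"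
      by (auto simp: S_def space_PiM K_def)
  qed
  have "(\<lambda>u. \<lambda>k\<in>K. \<Sum>i\<in>J. L k i * u i) \<in> measurable P (\<Pi>\<^sub>M k\<in>K. borel)"
    unfolding P_def by (intro measurable_restrict measurable_linear_std_gaussian J)
  from measurable_sets[OF this S] have "{u\<in>space P. (\<lambda>k\<in>K. \<Sum>i\<in>J. L k i * u i) \<in> S} \<in> sets P"
    by (simp add: vimage_def Int_def conj_commute)
  then have "P.prob (Pi\<^sub>E J A) \<le> P.prob {u\<in>space P. (\<lambda>k\<in>K. \<Sum>i\<in>J. L k i * u i) \<in> S}"
    using sub by (intro P.finite_measure_mono)
  also have "\<dots> = prob {\<omega>\<in>space M. (\<lambda>k\<in>K. F (\<tau> k) \<omega>) \<in> S}"
    unfolding P_def by (rule gaussian_law_transfer[OF K J form S, symmetric])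
  also have "{\<omega>\<in>space M. (\<lambda>k\<in>K. F (\<tau> k) \<omega>) \<in> S} = {\<omega>\<in>space M. \<forall>k. Suc k < m \<longrightarrow> F (real k * h) \<omega> * F (real (Suc k) * h) \<omega> < 0}"
    by (auto simp: S_def space_PiM K_def \<tau>_def)
  finally show ?thesis using box by simp
qed

end

text \<open>The intermediate value theorem gives a zero strictly inside each cell with a sign
  change, since the values at its ends are nonzero; zeros of different cells are therefore
  distinct.\<close>

lemma sign_changes_le_zero_count:
  assumes cont: "continuous_on UNIV f" and h: "h > 0" and T: "real n * h \<le> T"
    and x: "(\<Sum>j<n. if f (real j * h) * f (real (Suc j) * h) < 0 then 1 else 0) \<ge> x"
  shows "zero_count f T \<ge> ereal x"
proof -
  define S where "S = {j. j < n \<and> f (real j * h) * f (real (Suc j) * h) < 0}"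
  have S: "finite S" by (simp add: S_def)
  have "(\<Sum>j<n. if f (real j * h) * f (real (Suc j) * h) < 0 then 1 else (0 :: real)) = real (card S)"
    by (simp add: sum.If_cases S_def Int_def conj_commute)
  then have xS: "x \<le> real (card S)" using x by simp
  have "\<exists>z. real j * h < z \<and> z < real (Suc j) * h \<and> f z = 0" if "j \<in> S" for j
  proof -
    have neg: "f (real j * h) * f (real (Suc j) * h) < 0" using that by (simp add: S_def)
    have le: "real j * h \<le> real (Suc j) * h" using h by (intro mult_right_mono) auto
    have c: "continuous_on {real j * h..real (Suc j) * h} f" using cont continuous_on_subset by blast
    have "\<exists>z\<ge>real j * h. z \<le> real (Suc j) * h \<and> f z = 0"
    proof (cases "f (real j * h) \<le> 0")
      case True
      then show ?thesis using neg le c IVT'[of f "real j * h" 0 "real (Suc j) * h"] by (auto simp: mult_less_0_iff)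
    next
      case False
      then show ?thesis using neg le c IVT2'[of f "real (Suc j) * h" 0 "real j * h"] by (auto simp: mult_less_0_iff)
    qed
    then obtain z where z: "real j * h \<le> z" "z \<le> real (Suc j) * h" "f z = 0" by blast
    moreover have "z \<noteq> real j * h" "z \<noteq> real (Suc j) * h" using neg z by auto
    ultimately show ?thesis by (intro exI[of _ z]) auto
  qed
  then obtain z where z: "\<And>j. j \<in> S \<Longrightarrow> real j * h < z j \<and> z j < real (Suc j) * h \<and> f (z j) = 0" by metis
  have lt: "z i < z j" if "i \<in> S" "j \<in> S" "i < j" for i j
  proof -
    have "real (Suc i) * h \<le> real j * h" using that h by (intro mult_right_mono) auto
    then show ?thesis using z[OF that(1)] z[OF that(2)] by linarith
  qed
  have "inj_on z S"
    by (rule inj_onI) (metis lt less_irrefl linorder_neqE_nat)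
  then have card: "card (z ` S) = card S" by (rule card_image)
  have "z ` S \<subseteq> {t\<in>{0..T}. f t = 0}"
  proof
    fix t assume "t \<in> z ` S"
    then obtain j where j: "j \<in> S" "t = z j" by blast
    have "real (Suc j) * h \<le> real n * h" using j h by (intro mult_right_mono) (auto simp: S_def)
    moreover have "0 \<le> real j * h" using h by simp
    ultimately show "t \<in> {t\<in>{0..T}. f t = 0}" using z[OF j(1)] j T by auto
  qed
  note sub = this
  have "card S \<le> card {t\<in>{0..T}. f t = 0}" if "finite {t\<in>{0..T}. f t = 0}"
    using card_mono[OF that sub] unfolding card .
  then show ?thesis using xS by (auto simp: zero_count_def Let_def)
qed

text \<open>The sets in [- A, A] where the Radon-Nikodym density is at least 1 / (n + 1) exhaust its
  positivity set there. If all were null, \<open>\<mu>ac\<close> would vanish inside the interval,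
  and it vanishes outside because it is dominated by \<open>\<mu>\<close>.\<close>

lemma absolutely_continuous_part_lower_bound:
  fixes \<mu> \<mu>ac \<mu>s :: "real measure"
  assumes mu: "finite_measure \<mu>" "sets \<mu> = sets borel" and A: "AE x in \<mu>. \<bar>x\<bar> \<le> A"
    and dec: "lebesgue_decomposition \<mu> \<mu>ac \<mu>s" and ac: "emeasure \<mu>ac UNIV \<noteq> 0"
  obtains E \<kappa> where "E \<in> sets borel" "E \<subseteq> {- A..A}" "measure lborel E > 0" "\<kappa> > 0"
    "\<And>B. B \<in> sets borel \<Longrightarrow> \<kappa> * measure lborel (B \<inter> E) \<le> measure \<mu> B"
proof -
  interpret mu: finite_measure \<mu> by fact
  have sets_ac: "sets \<mu>ac = sets borel" and abs: "absolutely_continuous lborel \<mu>ac"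
    and le: "\<And>B. B \<in> sets borel \<Longrightarrow> emeasure \<mu>ac B \<le> emeasure \<mu> B"
    using dec by (auto simp: lebesgue_decomposition_def)
  obtain f where f: "f \<in> borel_measurable lborel" "density lborel f = \<mu>ac"
    using sigma_finite_measure.Radon_Nikodym[OF sigma_finite_lborel abs] sets_ac by auto
  have [measurable]: "f \<in> borel_measurable borel" using f(1) by simp
  define E where "E = (\<lambda>n::nat. {x\<in>{- A..A}. ennreal (1 / Suc n) \<le> f x})"
  have E: "E n \<in> sets borel" for n unfolding E_def by measurable
  have "\<exists>n. emeasure lborel (E n) \<noteq> 0"
  proof (rule ccontr)
    assume "\<not> ?thesis"
    then have "E n \<in> null_sets lborel" for n using E by (auto simp: null_sets_def)
    then have "(\<Union>n. E n) \<in> null_sets lborel" by (intro null_sets_UN) auto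
    moreover have "x \<in> (\<Union>n. E n)" if "x \<in> {- A..A}" "f x \<noteq> 0" for x
    proof -
      have "0 < f x" using that(2) by (simp add: zero_less_iff_neq_zero)
      then obtain r where r: "0 < r" "ennreal r \<le> f x"
        by (cases "f x") (auto intro: that[of 1] simp: ennreal_less_zero_iff)
      obtain n where "inverse (real (Suc n)) < r" using reals_Archimedean[OF r(1)] by auto
      then have "ennreal (1 / Suc n) \<le> f x"
        by (intro order.trans[OF ennreal_leI r(2)]) (simp add: inverse_eq_divide)
      then show ?thesis using that(1) by (auto simp: E_def)
    qed
    ultimately have "AE x in lborel. f x * indicator {- A..A} x = 0"
      by (intro AE_I'[of "\<Union>n. E n"]) (auto simp: indicator_def split: if_splits)
    then have "(\<integral>\<^sup>+x. f x * indicator {- A..A} x \<partial>lborel) = 0"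
      by (subst nn_integral_0_iff_AE) auto
    then have 1: "emeasure \<mu>ac {- A..A} = 0"
      unfolding f(2)[symmetric] by (simp add: emeasure_density)
    have "AE x in \<mu>. x \<notin> - {- A..A}" using A by eventually_elim auto
    then have "emeasure \<mu> (- {- A..A}) = 0"
      using sets_eq_imp_space_eq[OF mu(2)] mu(2) by (subst (asm) AE_iff_measurable[of "- {- A..A}"]) auto
    then have "emeasure \<mu>ac (- {- A..A}) = 0" using le[of "- {- A..A}"] by simp
    then have "emeasure \<mu>ac ({- A..A} \<union> - {- A..A}) = 0"
      using 1 sets_ac by (intro emeasure_Un_null_set[THEN trans]) (auto simp: null_sets_def)
    then show False using ac by (simp add: Compl_partition)
  qed
  then obtain n where n: "emeasure lborel (E n) \<noteq> 0" by blast
  have fin: "emeasure lborel (E n \<inter> B) \<noteq> \<infinity>" for B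
  proof -
    have "emeasure lborel (E n \<inter> B) \<le> emeasure lborel {- A..A}"
      by (intro emeasure_mono) (auto simp: E_def)
    also have "\<dots> < \<infinity>" by (simp add: emeasure_lborel_Icc_eq)
    finally show ?thesis by simp
  qed
  show thesis
  proof (rule that[of "E n" "1 / Suc n"])
    show "E n \<in> sets borel" "E n \<subseteq> {- A..A}" using E by (auto simp: E_def)
    show "measure lborel (E n) > 0" using n fin[of UNIV] by (simp add: measure_def enn2real_positive_iff less_top zero_less_iff_neq_zero)
    fix B :: "real set" assume B: "B \<in> sets borel"
    have "ennreal (1 / Suc n) * emeasure lborel (B \<inter> E n) = (\<integral>\<^sup>+x. ennreal (1 / Suc n) * indicator (B \<inter> E n) x \<partial>lborel)"
      using B E[of n] by (subst nn_integral_cmult_indicator) auto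
    also have "\<dots> \<le> (\<integral>\<^sup>+x. f x * indicator (B \<inter> E n) x \<partial>lborel)"
      by (intro nn_integral_mono) (auto simp: indicator_def E_def)
    also have "\<dots> = emeasure \<mu>ac (B \<inter> E n)"
      unfolding f(2)[symmetric] using B E[of n] by (simp add: emeasure_density)
    also have "\<dots> \<le> emeasure \<mu> (B \<inter> E n)" using B E[of n] by (intro le) auto
    also have "\<dots> \<le> emeasure \<mu> B" using B mu(2) by (intro emeasure_mono) auto
    finally have "ennreal (1 / Suc n) * ennreal (measure lborel (B \<inter> E n)) \<le> ennreal (measure \<mu> B)"
      using fin[of B] by (simp add: mu.emeasure_eq_measure emeasure_eq_ennreal_measure Int_commute top_unique)
    then show "1 / Suc n * measure lborel (B \<inter> E n) \<le> measure \<mu> B"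
      by (simp add: ennreal_mult[symmetric] del: of_nat_Suc)
  qed simp
qed

section \<open>The lower bound for large and for bounded T\<close>

context stationary_gaussian
begin

lemma many_zeros_bound:
  assumes A0: "A > 0" and mu1: "measure \<mu> UNIV = 1"
    and cont: "\<forall>\<omega>\<in>space M. continuous_on UNIV (\<lambda>t. F t \<omega>)"
    and edge: "\<And>\<delta>. \<delta> > 0 \<Longrightarrow> measure \<mu> {x. A - \<delta> < \<bar>x\<bar> \<and> \<bar>x\<bar> \<le> A} > 0"
    and nondeg: "\<And>h. h > 0 \<Longrightarrow> h * A \<le> 1 \<Longrightarrow> \<exists>C\<ge>1. \<forall>m c. (\<Sum>k<m. (c k)\<^sup>2) \<le> C ^ m * spectral_form {..<m} (\<lambda>k. real k * h) c"
    and eps: "\<epsilon> > 0"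
  shows "\<exists>c>0. \<forall>T\<ge>1. prob {\<omega>\<in>space M. zero_count (\<lambda>t. F t \<omega>) T \<ge> ereal (A / pi * T - \<epsilon> * T)} \<ge> exp (- c * T)"
proof -
  have meas: "{\<omega>\<in>space M. zero_count (\<lambda>t. F t \<omega>) T \<ge> ereal x} \<in> events" for T x
    using zero_count_measurable[of F M x T] cont by auto
  \<comment> \<open>At this spacing cos (h x) = - 1 exactly at the spectral edges x = A and x = -
    A.\<close>
  define h where "h = pi / A"
  have h: "h > 0" using A0 by (simp add: h_def)
  \<comment> \<open>A share \<open>\<eta>\<close> of about T A / pi cells amounts to \<epsilon> T /
    2; the other half of \<epsilon> T absorbs the rounding of \<open>n\<close>.\<close>
  define \<eta> where "\<eta> = \<epsilon> * pi / (2 * A)"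
  have \<eta>: "\<eta> > 0" using eps A0 by (simp add: \<eta>_def)
  \<comment> \<open>The budget \<eta> / 2 per cell is split: the small ball term gets 2 e = \<eta> /
    4, and \<open>q\<close> and \<open>s\<close> are chosen below so that undamped and damped
    variance get \<eta> / 8 each.\<close>
  define e where "e = \<eta> / 8"
  have e: "e > 0" using \<eta> by (simp add: e_def)
  define q where "q = e\<^sup>2 * \<eta> / 16"
  have q: "q > 0" using e \<eta> by (simp add: q_def)
  obtain d where d: "d > 0" "\<And>y. \<bar>y - pi\<bar> < d \<Longrightarrow> \<bar>cos y - cos pi\<bar> < q"
  proof -
    have "isCont cos (pi :: real)" by simp
    then show thesis using q that unfolding continuous_at_eps_delta dist_real_def by metis
  qed
  define B where "B = {x. A - d / h < \<bar>x\<bar> \<and> \<bar>x\<bar> \<le> A}"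
  have B: "B \<in> sets borel" unfolding B_def by measurable
  have m1: "measure \<mu> B > 0" unfolding B_def using d h by (intro edge) simp
  have qB: "1 + cos (h * x) \<le> q" if "x \<in> B" for x
  proof -
    have "h * A = pi" using A0 by (simp add: h_def)
    have "A - d / h < \<bar>x\<bar>" "\<bar>x\<bar> \<le> A" using that by (auto simp: B_def)
    then have "h * (A - d / h) < h * \<bar>x\<bar>" "h * \<bar>x\<bar> \<le> h * A" using h by auto
    then have "\<bar>h * \<bar>x\<bar> - pi\<bar> < d" using h \<open>h * A = pi\<close> by (simp add: right_diff_distrib)
    then have "\<bar>cos (h * \<bar>x\<bar>) - cos pi\<bar> < q" by (rule d(2))
    moreover have "cos (h * \<bar>x\<bar>) = cos (h * x)" by (cases "x \<ge> 0") auto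
    ultimately show ?thesis by simp
  qed
  define s where "s = min 1 (sqrt (measure \<mu> B * e\<^sup>2 * \<eta> / 32))"
  have s: "0 < s" "s \<le> 1" using m1 e \<eta> by (auto simp: s_def)
  have s2: "s\<^sup>2 \<le> measure \<mu> B * e\<^sup>2 * \<eta> / 32"
  proof -
    have "s\<^sup>2 \<le> (sqrt (measure \<mu> B * e\<^sup>2 * \<eta> / 32))\<^sup>2" using s by (intro power_mono) (auto simp: s_def)
    then show ?thesis using m1 e \<eta> by simp
  qed
  define \<rho> where "\<rho> = sqrt (measure \<mu> B) * e"
  have \<rho>: "\<rho> > 0" using m1 e by (simp add: \<rho>_def)
  have bound: "exp (1 / 2) * \<rho> / sqrt (measure \<mu> B) + (2 * q * measure \<mu> B + 4 * s\<^sup>2) / \<rho>\<^sup>2 \<le> \<eta> / 2"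
  proof -
    have "exp (1 / 2 :: real) \<le> 2"
    proof -
      have "(exp (1 / 2))\<^sup>2 \<le> (2 :: real)\<^sup>2" using exp_le by (simp add: exp_double[symmetric])
      then show ?thesis by (rule power2_le_imp_le) simp
    qed
    then have "exp (1 / 2) * \<rho> / sqrt (measure \<mu> B) \<le> 2 * e" using m1 e by (simp add: \<rho>_def)
    moreover have "(2 * q * measure \<mu> B + 4 * s\<^sup>2) / \<rho>\<^sup>2 \<le> \<eta> / 4"
    proof -
      have "2 * q * measure \<mu> B + 4 * s\<^sup>2 \<le> \<eta> / 4 * \<rho>\<^sup>2"
        using s2 m1 by (simp add: \<rho>_def q_def power_mult_distrib algebra_simps)
      then show ?thesis using \<rho> by (simp add: pos_divide_le_eq)
    qed
    moreover have "2 * e = \<eta> / 4" by (simp add: e_def)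
    ultimately show ?thesis by linarith
  qed
  \<comment> \<open>Beyond \<open>T0\<close> one lost cell is worth at most \<epsilon> T / 2, and at
    least one cell fits. In \<open>c1\<close> the factor A / pi + 1 bounds (n + 1) / T, and the
    final 1 pays for the factor 1 / 2.\<close>
  define T0 where "T0 = max (2 / \<epsilon>) (pi / A)"
  define c1 where "c1 = (A / pi + 1) * (- ln s) + 1"
  have c1: "c1 \<ge> 1" using s A0 by (simp add: c1_def mult_nonneg_nonpos)
  have large: "exp (- c1 * T) \<le> prob {\<omega>\<in>space M. zero_count (\<lambda>t. F t \<omega>) T \<ge> ereal (A / pi * T - \<epsilon> * T)}"
    if T: "T \<ge> 1" "T \<ge> T0" for T
  proof -
    define n where "n = nat \<lfloor>T * A / pi\<rfloor>"
    have TA: "T * A / pi \<ge> 1"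
    proof -
      have "T \<ge> pi / A" using T by (simp add: T0_def)
      then show ?thesis using A0 by (simp add: field_simps)
    qed
    have n: "real n \<le> T * A / pi" "T * A / pi - 1 \<le> real n" "n \<ge> 1"
      using TA unfolding n_def by linarith+
    have nh: "real n * h \<le> T" using n(1) A0 by (simp add: h_def field_simps)
    have cnt: "A / pi * T - \<epsilon> * T \<le> (1 - \<eta>) * real n"
    proof -
      have "\<eta> * real n \<le> \<eta> * (T * A / pi)" using n(1) \<eta> by (intro mult_left_mono) auto
      also have "\<dots> = \<epsilon> * T / 2" using A0 by (simp add: \<eta>_def)
      finally have 1: "\<eta> * real n \<le> \<epsilon> * T / 2" .
      have "2 / \<epsilon> \<le> T" using T by (simp add: T0_def)
      then have "1 \<le> \<epsilon> * T / 2" using eps by (simp add: field_simps)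
      then show ?thesis using 1 n(2) by (simp add: algebra_simps)
    qed
    have "exp (- c1 * T) \<le> s ^ Suc n / 2"
    proof -
      have "s ^ Suc n = exp (real (Suc n) * ln s)" unfolding exp_of_nat_mult using s by simp
      moreover have "(2::real) \<le> exp 1" using exp_ge_add_one_self[of 1] by simp
      then have "exp (- 1) \<le> (1 / 2 :: real)" by (simp add: exp_minus field_simps)
      moreover have "- c1 * T \<le> real (Suc n) * ln s + (- 1)"
      proof -
        have "real (Suc n) \<le> T * A / pi + T" using n(1) T by simp
        then have "real (Suc n) * (- ln s) \<le> (T * A / pi + T) * (- ln s)" using s by (intro mult_right_mono) auto
        also have "\<dots> = (c1 - 1) * T" by (simp add: c1_def algebra_simps)
        finally show ?thesis using T by (simp add: algebra_simps)
      qed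
      then have "exp (- c1 * T) \<le> exp (real (Suc n) * ln s) * exp (- 1)" by (simp only: exp_add[symmetric] exp_le_cancel_iff)
      moreover have "exp (real (Suc n) * ln s) * exp (- 1) \<le> exp (real (Suc n) * ln s) * (1 / 2)"
        by (intro mult_left_mono \<open>exp (- 1) \<le> (1 / 2 :: real)\<close>) simp
      ultimately show ?thesis by linarith
    qed
    also have "\<dots> \<le> prob {\<omega>\<in>space M. (\<Sum>j<n. if F (real j * h) \<omega> * F (real (Suc j) * h) \<omega> < 0 then 1 else 0) \<ge> (1 - \<eta>) * real n}"
      by (rule many_sign_changes_damped[OF B m1 mu1 qB s \<rho> bound \<eta> n(3)])
    also have "\<dots> \<le> prob {\<omega>\<in>space M. zero_count (\<lambda>t. F t \<omega>) T \<ge> ereal (A / pi * T - \<epsilon> * T)}"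
    proof (intro finite_measure_mono meas subsetI)
      fix \<omega> assume "\<omega> \<in> {\<omega>\<in>space M. (\<Sum>j<n. if F (real j * h) \<omega> * F (real (Suc j) * h) \<omega> < 0 then 1 else 0) \<ge> (1 - \<eta>) * real n}"
      then show "\<omega> \<in> {\<omega>\<in>space M. zero_count (\<lambda>t. F t \<omega>) T \<ge> ereal (A / pi * T - \<epsilon> * T)}"
        using cont cnt by (auto intro!: sign_changes_le_zero_count[OF _ h nh])
    qed
    finally show ?thesis .
  qed
  \<comment> \<open>For T \<le> T0 at most \<open>N\<close> zeros are asked for. A lattice of
    spacing \<open>g\<close> places that many sign changes already in [0, 1], with a probability
    \<open>p\<close> independent of \<open>T\<close>; the rate - ln p then suffices because T \<ge>
    1.\<close>
  define N where "N = nat \<lceil>A / pi * T0\<rceil>"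
  define g where "g = 1 / (A + real N + 1)"
  have N: "A / pi * T0 \<le> real N" unfolding N_def by linarith
  have g: "g > 0" "g * A \<le> 1" "real N * g \<le> 1" using A0 by (simp_all add: g_def field_simps)
  obtain C where C: "C \<ge> 1" "\<And>m c. (\<Sum>k<m. (c k)\<^sup>2) \<le> C ^ m * spectral_form {..<m} (\<lambda>k. real k * g) c"
    using nondeg[OF g(1,2)] by blast
  define p where "p = prob {\<omega>\<in>space M. \<forall>k. Suc k < Suc N \<longrightarrow> F (real k * g) \<omega> * F (real (Suc k) * g) \<omega> < 0}"
  have "0 < p"
    unfolding p_def
  proof (rule alternating_signs_positive[where l = "1 / C ^ Suc N"])
    show "1 / C ^ Suc N * (\<Sum>k<Suc N. (c k)\<^sup>2) \<le> spectral_form {..<Suc N} (\<lambda>k. real k * g) c" for c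
      using C(2)[of c "Suc N"] C(1) by (simp add: field_simps del: power_Suc sum.lessThan_Suc)
  qed (use C in simp)
  have p1: "p \<le> 1" by (simp add: p_def)
  have small: "p \<le> prob {\<omega>\<in>space M. zero_count (\<lambda>t. F t \<omega>) T \<ge> ereal (A / pi * T - \<epsilon> * T)}"
    if T: "T \<ge> 1" "T \<le> T0" for T
    unfolding p_def
  proof (intro finite_measure_mono meas subsetI)
    fix \<omega> assume \<omega>: "\<omega> \<in> {\<omega>\<in>space M. \<forall>k. Suc k < Suc N \<longrightarrow> F (real k * g) \<omega> * F (real (Suc k) * g) \<omega> < 0}"
    have "A / pi * T \<le> A / pi * T0" using T A0 by (intro mult_left_mono) auto
    moreover have "0 \<le> \<epsilon> * T" using eps T by simp
    moreover have "(\<Sum>j<N. if F (real j * g) \<omega> * F (real (Suc j) * g) \<omega> < 0 then 1 else 0) = real N"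
      using \<omega> by simp
    ultimately have ch: "(\<Sum>j<N. if F (real j * g) \<omega> * F (real (Suc j) * g) \<omega> < 0 then 1 else 0) \<ge> A / pi * T - \<epsilon> * T"
      using N by linarith
    have Ng: "real N * g \<le> T" using g(3) T(1) by linarith
    have "\<omega> \<in> space M" "continuous_on UNIV (\<lambda>t. F t \<omega>)" using \<omega> cont by auto
    then show "\<omega> \<in> {\<omega>\<in>space M. zero_count (\<lambda>t. F t \<omega>) T \<ge> ereal (A / pi * T - \<epsilon> * T)}"
      using sign_changes_le_zero_count[OF _ g(1) Ng ch] by simp
  qed
  show ?thesis
  proof (intro exI[of _ "max c1 (- ln p)"] conjI allI impI)
    show "0 < max c1 (- ln p)" using c1 by simp
    fix T :: real assume T: "T \<ge> 1"
    show "exp (- max c1 (- ln p) * T) \<le> prob {\<omega>\<in>space M. zero_count (\<lambda>t. F t \<omega>) T \<ge> ereal (A / pi * T - \<epsilon> * T)}"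
    proof (cases "T \<ge> T0")
      case True
      have "exp (- max c1 (- ln p) * T) \<le> exp (- c1 * T)" using T by (simp add: mult_right_mono)
      then show ?thesis using large[OF T True] by linarith
    next
      case False
      have "(- ln p) * 1 \<le> max c1 (- ln p) * T" using c1 T \<open>0 < p\<close> p1 by (intro mult_mono) auto
      then have "exp (- max c1 (- ln p) * T) \<le> exp (ln p)" by simp
      then show ?thesis using small[of T] T False \<open>0 < p\<close> by simp
    qed
  qed
qed

end

theorem theorem1:
  fixes M :: "'a measure" and F :: "real \<Rightarrow> 'a \<Rightarrow> real"
    and \<mu> \<mu>ac \<mu>s :: "real measure" and A :: real
  assumes "centered_stationary_gaussian_process M F"
    and "\<forall>\<omega>\<in>space M. continuous_on UNIV (\<lambda>t. F t \<omega>)"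
    and "is_spectral_measure M F \<mu>"
    and "prob_space \<mu>"
    and "compact (measure_support \<mu>)"
    and "lebesgue_decomposition \<mu> \<mu>ac \<mu>s"
    and "emeasure \<mu>ac UNIV \<noteq> 0"
    and "0 < A"
    and "measure_support \<mu> \<subseteq> {-A..A}"
    and "\<forall>B>0. measure_support \<mu> \<subseteq> {-B..B} \<longrightarrow> A \<le> B"
  shows "(\<exists>c>0. \<exists>d1>0. \<exists>d2>0. \<forall>T\<ge>exp 8. \<forall>\<epsilon>\<in>{d1 * (ln T / sqrt T)..d2}.
            measure M {\<omega>\<in>space M. zero_count (\<lambda>t. F t \<omega>) T \<ge> ereal (A / pi * T + \<epsilon> * T)}
              \<le> exp (- c * (\<epsilon> / ln \<epsilon>) ^ 4 * T\<^sup>2))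
       \<and> (\<forall>\<epsilon>>0. \<exists>c>0. \<forall>T\<ge>1.
            measure M {\<omega>\<in>space M. zero_count (\<lambda>t. F t \<omega>) T \<ge> ereal (A / pi * T - \<epsilon> * T)}
              \<ge> exp (- c * T))"
proof -
  interpret stationary_gaussian M F \<mu>
    using assms(1,3) by unfold_locales
  have mu1: "measure \<mu> UNIV = 1"
    using prob_space.prob_space[OF assms(4)] space_mu by simp
  have A: "AE x in \<mu>. \<bar>x\<bar> \<le> A"
    using AE_measure_support[OF sets_mu] by eventually_elim (use assms(9) in \<open>auto simp: abs_le_iff\<close>)
  obtain E \<kappa> where E: "E \<in> sets borel" "E \<subseteq> {- A..A}" "measure lborel E > 0"
    and \<kappa>: "\<kappa> > 0" "\<And>B. B \<in> sets borel \<Longrightarrow> \<kappa> * measure lborel (B \<inter> E) \<le> measure \<mu> B"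
    using absolutely_continuous_part_lower_bound[OF mu.finite_measure_axioms sets_mu A assms(6,7)] by metis
  obtain C where C: "C \<ge> 1"
    "\<And>m s \<eta>. \<eta> > 0 \<Longrightarrow> prob {\<omega>\<in>space M. \<forall>k<m. \<bar>F (s + real k * (1 / A)) \<omega>\<bar> \<le> \<eta>} \<le> (exp (1 / 2) * \<eta> * C ^ m) ^ m"
  proof (rule lattice_small_ball[OF E \<kappa>, of "1 / A"])
    show "0 < 1 / A" "1 / A * A \<le> 1" using assms(8) by auto
  qed (assumption, rule that)
  have edge: "measure \<mu> {x. A - \<delta> < \<bar>x\<bar> \<and> \<bar>x\<bar> \<le> A} > 0" if "\<delta> > 0" for \<delta>
  proof (rule ccontr)
    assume "\<not> ?thesis"
    then have "measure \<mu> {x. A - \<delta> < \<bar>x\<bar> \<and> \<bar>x\<bar> \<le> A} = 0" by (simp add: measure_le_0_iff not_less)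
    then have null: "emeasure \<mu> {x. A - \<delta> < \<bar>x\<bar> \<and> \<bar>x\<bar> \<le> A} = 0" by (simp add: mu.emeasure_eq_measure)
    \<comment> \<open>A smaller bound for the support, contradicting minimality of \<open>A\<close>.
      The maximum with A / 2 keeps it positive for large \<open>\<delta>\<close>, as minimality
      ranges over positive bounds only.\<close>
    define B where "B = max (A / 2) (A - \<delta>)"
    have B: "0 < B" "B < A" "A - \<delta> \<le> B" using assms(8) that by (auto simp: B_def)
    have "measure_support \<mu> \<subseteq> {- B..B}"
    proof
      fix y assume y: "y \<in> measure_support \<mu>"
      show "y \<in> {- B..B}"
      proof (rule ccontr)
        assume "y \<notin> {- B..B}"
        then have "y \<in> {x. B < \<bar>x\<bar>}" by (auto simp: abs_if)
        moreover have "open {x::real. B < \<bar>x\<bar>}" by (intro open_Collect_less continuous_intros)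
        ultimately have "0 < emeasure \<mu> {x. B < \<bar>x\<bar>}" using y by (auto simp: measure_support_def)
        also have "emeasure \<mu> {x. B < \<bar>x\<bar>} \<le> emeasure \<mu> {x. A - \<delta> < \<bar>x\<bar> \<and> \<bar>x\<bar> \<le> A}"
        proof (rule emeasure_mono_AE)
          show "AE x in \<mu>. x \<in> {x. B < \<bar>x\<bar>} \<longrightarrow> x \<in> {x. A - \<delta> < \<bar>x\<bar> \<and> \<bar>x\<bar> \<le> A}"
            using A by eventually_elim (use B in auto)
          have "{x::real. A - \<delta> < \<bar>x\<bar> \<and> \<bar>x\<bar> \<le> A} \<in> sets borel" by measurable
          then show "{x. A - \<delta> < \<bar>x\<bar> \<and> \<bar>x\<bar> \<le> A} \<in> sets \<mu>" by (simp add: sets_mu)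
        qed
        finally show False using null by simp
      qed
    qed
    with assms(10) B show False by fastforce
  qed
  have nondeg: "\<exists>C\<ge>1. \<forall>m c. (\<Sum>k<m. (c k)\<^sup>2) \<le> C ^ m * spectral_form {..<m} (\<lambda>k. real k * h) c"
    if "h > 0" "h * A \<le> 1" for h
    by (rule lattice_small_ball[OF E \<kappa> that]) (assumption, blast)
  show ?thesis
    using overcrowding_bound[OF A assms(8) mu1 assms(2) C]
      many_zeros_bound[OF assms(8) mu1 assms(2) edge nondeg] by blast
qed

end
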